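(* Let $Q=Q_3$ be the smooth quadric threefold with the $\mathbb{C}^*$-action described in the context. The $\mathbb{C}^*$-invariant cubic curves in $Q$, i.e. the fixed locus $\mathbf{S}_3(Q)^{\mathbb{C}^*}$ of the induced $\mathbb{C}^*$-action on $\mathbf{S}_3(Q)$, consist of exactly $32$ isolated points and two further connected components, each isomorphic to $\mathbb{P}^1$.
   Context: Everything is over $\mathbb{C}$. Let $V=\mathrm{Sym}^3(\mathbb{C}^2)$ with basis $v_3=x^3,\ v_1=x^2y,\ v_{-1}=xy^2,\ v_{-3}=y^3$, on which the maximal torus $\mathbb{C}^*$ of $\mathrm{SL}(2,\mathbb{C})$ acts with weights $3,1,-1,-3$. On $\mathbb{P}(\wedge^2V)\cong\mathbb{P}^5$ use the Plücker coordinates $[v_{3,1}:v_{3,-1}:v_{3,-3}:v_{1,-1}:v_{1,-3}:v_{-1,-3}]$, where $v_{a,b}=v_a^*\wedge v_b^*$; the torus acts diagonally with weights $(4,2,0,0,-2,-4)$. The Grassmannian $\mathrm{Gr}(2,V)\subset\mathbb{P}^5$ is given by $v_{3,1}v_{-1,-3}-v_{3,-1}v_{1,-3}+v_{3,-3}v_{1,-1}=0$. Let $H=\{v_{3,-3}-3v_{1,-1}=0\}\cong\mathbb{P}^4$ and $Q=\mathrm{Gr}(2,V)\cap H$, a smooth $\mathbb{C}^*$-invariant quadric threefold, with $\mathcal{O}_Q(1)$ the restriction of $\mathcal{O}_{\mathbb{P}^5}(1)$. For $d\ge 1$, $\mathbf{S}_d(Q)$ denotes the moduli space of stable sheaves $F$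 on $Q$ with Hilbert polynomial $\chi(F(m))=dm+1$; for $d\le 3$ it is isomorphic to the Hilbert scheme $\mathbf{H}_d(Q)$ of curves $C\subset Q$ with $\chi(\mathcal{O}_C(m))=dm+1$ (via $C\mapsto\mathcal{O}_C$). A "cubic curve in $Q$" is a curve $C\subset Q$ with $\chi(\mathcal{O}_C(m))=3m+1$. *)

theory Defs
  imports "HOL-Analysis.Analysis" "HOL-Library.Poly_Mapping"
begin

section \<open>Polynomials\<close>

text \<open>A finitely supported function \<open>'b \<Rightarrow>\<^sub>0 complex\<close> is a vector in the complex vector space with
  basis \<open>'b\<close>. If \<open>'b\<close> is the type \<open>'i \<Rightarrow>\<^sub>0 nat\<close> of monomials, it is a polynomial in the variables
  \<open>'i\<close>, and \<open>*\<close> is the multiplication of polynomials.\<close>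

type_synonym 'i cpoly = "('i \<Rightarrow>\<^sub>0 nat) \<Rightarrow>\<^sub>0 complex"

definition vscale :: "complex \<Rightarrow> ('b \<Rightarrow>\<^sub>0 complex) \<Rightarrow> ('b \<Rightarrow>\<^sub>0 complex)" where
  "vscale c v = Poly_Mapping.map (\<lambda>a. c * a) v"

lemma lookup_vscale [simp]: "Poly_Mapping.lookup (vscale c v) b = c * Poly_Mapping.lookup v b"
  by (simp add: vscale_def Poly_Mapping.map.rep_eq when_def)

interpretation vec: vector_space vscale
  by unfold_locales (auto intro!: poly_mapping_eqI simp: lookup_add algebra_simps)

interpretation ring_mod: module "(*) :: 'a \<Rightarrow> 'a \<Rightarrow> 'a::comm_ring_1"
  by unfold_locales (auto simp: algebra_simps)

abbreviation is_ideal :: "'a::comm_ring_1 set \<Rightarrow> bool" where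
  "is_ideal \<equiv> ring_mod.subspace"

abbreviation ideal_generated :: "'a::comm_ring_1 set \<Rightarrow> 'a set" where
  "ideal_generated \<equiv> ring_mod.span"

definition coord_space :: "'b set \<Rightarrow> ('b \<Rightarrow>\<^sub>0 complex) set" where
  "coord_space B = {v. Poly_Mapping.keys v \<subseteq> B}"

definition peval :: "'i cpoly \<Rightarrow> ('i \<Rightarrow> complex) \<Rightarrow> complex" where
  "peval p a = (\<Sum>m\<in>Poly_Mapping.keys p.
     Poly_Mapping.lookup p m * (\<Prod>i\<in>Poly_Mapping.keys m. a i ^ Poly_Mapping.lookup m i))"

definition mon_degree :: "('i \<Rightarrow>\<^sub>0 nat) \<Rightarrow> nat" where
  "mon_degree m = (\<Sum>i\<in>Poly_Mapping.keys m. Poly_Mapping.lookup m i)"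

definition monomials :: "nat \<Rightarrow> ('i \<Rightarrow>\<^sub>0 nat) set" where
  "monomials k = {m. mon_degree m = k}"

definition forms :: "nat \<Rightarrow> 'i cpoly set" where
  "forms k = coord_space (monomials k)"

definition hom_component :: "nat \<Rightarrow> 'i cpoly \<Rightarrow> 'i cpoly" where
  "hom_component k f = (\<Sum>m\<in>Poly_Mapping.keys f \<inter> monomials k.
     Poly_Mapping.single m (Poly_Mapping.lookup f m))"

definition homogeneous_ideal :: "'i cpoly set \<Rightarrow> bool" where
  "homogeneous_ideal I \<longleftrightarrow> is_ideal I \<and> (\<forall>f\<in>I. \<forall>k. hom_component k f \<in> I)"

text \<open>Saturated with respect to the irrelevant ideal: \<open>f\<close> lies in \<open>I\<close> as soon as all its multiples
  by forms of some degree \<open>k\<close> do.\<close>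

definition saturated :: "'i cpoly set \<Rightarrow> bool" where
  "saturated I \<longleftrightarrow> (\<forall>f k. (\<forall>g\<in>forms k. g * f \<in> I) \<longrightarrow> f \<in> I)"

definition hilbert_function :: "'i cpoly set \<Rightarrow> nat \<Rightarrow> int" where
  "hilbert_function I k = int (vec.dim (forms k :: 'i cpoly set)) - int (vec.dim (I \<inter> forms k))"


section \<open>Varieties as spaces with regular functions\<close>

text \<open>A topological space, together with the regular functions on each of its open subsets \<open>U\<close>.
  Only the values on \<open>U\<close> of a function in \<open>Reg X U\<close> matter.\<close>

record 'a fun_space =
  Top :: "'a topology"
  Reg :: "'a set \<Rightarrow> ('a \<Rightarrow> complex) set"

definition is_morphism :: "'a fun_space \<Rightarrow> 'b fun_space \<Rightarrow> ('a \<Rightarrow> 'b) \<Rightarrow> bool" where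
  "is_morphism X Y \<phi> \<longleftrightarrow>
     continuous_map (Top X) (Top Y) \<phi> \<and>
     (\<forall>V f. openin (Top Y) V \<and> f \<in> Reg Y V \<longrightarrow> f \<circ> \<phi> \<in> Reg X {x \<in> topspace (Top X). \<phi> x \<in> V})"

definition isomorphic :: "'a fun_space \<Rightarrow> 'b fun_space \<Rightarrow> bool" where
  "isomorphic X Y \<longleftrightarrow>
     (\<exists>\<phi> \<psi>. is_morphism X Y \<phi> \<and> is_morphism Y X \<psi> \<and>
        (\<forall>x\<in>topspace (Top X). \<psi> (\<phi> x) = x) \<and> (\<forall>y\<in>topspace (Top Y). \<phi> (\<psi> y) = y))"

text \<open>The Grassmannian of subspaces of codimension \<open>c\<close> of the space with finite basis \<open>B\<close>. For
  \<open>J \<subseteq> B\<close> with \<open>c\<close> elements, the standard affine chart \<open>J\<close> consists of the \<open>W\<close> complementary to the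
  span of \<open>J\<close>. Its coordinate at \<open>(b, j)\<close> is the coefficient of \<open>j\<close> when the basis vector \<open>b\<close> is
  expressed modulo \<open>W\<close> through \<open>J\<close>; these are ratios of Pluecker coordinates of \<open>W\<close>.\<close>

definition grassmannian :: "'b set \<Rightarrow> nat \<Rightarrow> ('b \<Rightarrow>\<^sub>0 complex) set set" where
  "grassmannian B c =
     {W. vec.subspace W \<and> W \<subseteq> coord_space B \<and> vec.dim W + c = card B}"

definition gr_index :: "'b set \<Rightarrow> nat \<Rightarrow> 'b set set" where
  "gr_index B c = {J. J \<subseteq> B \<and> card J = c}"

definition gr_chart :: "'b set \<Rightarrow> nat \<Rightarrow> 'b set \<Rightarrow> ('b \<Rightarrow>\<^sub>0 complex) set set" where
  "gr_chart B c J = {W \<in> grassmannian B c. W \<inter> coord_space J = {0}}"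

definition gr_coord :: "'b set \<Rightarrow> 'b set \<Rightarrow> ('b \<Rightarrow>\<^sub>0 complex) set \<Rightarrow> 'b \<times> 'b \<Rightarrow> complex" where
  "gr_coord B J W = (\<lambda>(b, j).
     if b \<in> B \<and> j \<in> J
     then Poly_Mapping.lookup (THE r. r \<in> coord_space J \<and> Poly_Mapping.single b 1 - r \<in> W) j
     else 0)"

definition gr_zariski :: "'b set \<Rightarrow> nat \<Rightarrow> ('b \<Rightarrow>\<^sub>0 complex) set topology" where
  "gr_zariski B c = topology_generated_by
     {{W \<in> gr_chart B c J. peval p (gr_coord B J W) \<noteq> 0} | J p. J \<in> gr_index B c}"

text \<open>The structure induced on a set \<open>X\<close> by an injection \<open>e\<close> of \<open>X\<close> onto a locally closed subset of
  the Grassmannian: the induced Zariski topology, and the functions that are locally quotients of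
  polynomials in the chart coordinates. This is the reduced induced structure.\<close>

definition embedded_variety ::
  "'b set \<Rightarrow> nat \<Rightarrow> 'a set \<Rightarrow> ('a \<Rightarrow> ('b \<Rightarrow>\<^sub>0 complex) set) \<Rightarrow> 'a fun_space" where
  "embedded_variety B c X e =
     (let T = pullback_topology X e (gr_zariski B c) in
      \<lparr> Top = T,
        Reg = (\<lambda>U. {f. \<forall>x\<in>U. \<exists>N J p q. openin T N \<and> x \<in> N \<and> N \<subseteq> U \<and> J \<in> gr_index B c \<and>
          (\<forall>y\<in>N. e y \<in> gr_chart B c J \<and> peval q (gr_coord B J (e y)) \<noteq> 0 \<and>
             f y = peval p (gr_coord B J (e y)) / peval q (gr_coord B J (e y)))}) \<rparr>)"

text \<open>\<open>\<P>\<^sup>1\<close> is the space of lines through the origin in \<open>\<complex>\<^sup>2\<close>.\<close>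

definition proj_line :: "(nat \<Rightarrow>\<^sub>0 complex) set fun_space" where
  "proj_line = embedded_variety {0, 1} 1 (grassmannian {0, 1} 1) id"


section \<open>The quadric threefold and its rational curves\<close>

text \<open>Labels of the Pluecker coordinates on \<open>\<P>(\<And>\<^sup>2 V)\<close>; \<open>P3_m1\<close> labels \<open>v\<^bsub>3,-1\<^esub>\<close>, and so on.\<close>

datatype pluecker = P3_1 | P3_m1 | P3_m3 | P1_m1 | P1_m3 | Pm1_m3

fun weight :: "pluecker \<Rightarrow> int" where
  "weight P3_1 = 4"
| "weight P3_m1 = 2"
| "weight P3_m3 = 0"
| "weight P1_m1 = 0"
| "weight P1_m3 = -2"
| "weight Pm1_m3 = -4"

definition pv :: "pluecker \<Rightarrow> pluecker cpoly" where
  "pv i = Poly_Mapping.single (Poly_Mapping.single i 1) 1"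

definition quadric_ideal :: "pluecker cpoly set" where
  "quadric_ideal = ideal_generated
     {pv P3_1 * pv Pm1_m3 - pv P3_m1 * pv P1_m3 + pv P3_m3 * pv P1_m1,
      pv P3_m3 - 3 * pv P1_m1}"

text \<open>Closed subschemes \<open>C\<close> of \<open>\<P>\<^sup>5\<close> are given by their saturated homogeneous ideals \<open>I\<close>, and
  \<open>\<chi>(\<O>\<^sub>C(k))\<close> is the value of the Hilbert function of \<open>I\<close> at every large \<open>k\<close>. The set below
  consists of the closed points of the Hilbert scheme of curves in the quadric
  with Hilbert polynomial \<open>d k + 1\<close>. For \<open>d \<le> 3\<close> it is isomorphic to the moduli space of stable sheaves with
  this Hilbert polynomial, through \<open>C \<mapsto> \<O>\<^sub>C\<close>.\<close>

definition hilb :: "nat \<Rightarrow> pluecker cpoly set set" where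
  "hilb d = {I. homogeneous_ideal I \<and> saturated I \<and> quadric_ideal \<subseteq> I \<and>
     (\<forall>\<^sub>F k in sequentially. hilbert_function I k = int d * int k + 1)}"

text \<open>The polynomial \<open>f(t \<cdot> z)\<close>, where \<open>t\<close> multiplies the coordinate \<open>z\<^sub>i\<close> by \<open>t\<close> to the power
  \<open>weight i\<close>. A form \<open>f\<close> vanishes on \<open>t \<cdot> C\<close> iff \<open>f(t \<cdot> z)\<close> vanishes on \<open>C\<close>.\<close>

definition torus_pullback :: "complex \<Rightarrow> pluecker cpoly \<Rightarrow> pluecker cpoly" where
  "torus_pullback t f = (\<Sum>m\<in>Poly_Mapping.keys f.
     Poly_Mapping.single m
       (Poly_Mapping.lookup f m * (\<Prod>i\<in>Poly_Mapping.keys m. (t powi weight i) ^ Poly_Mapping.lookup m i)))"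

definition torus_act :: "complex \<Rightarrow> pluecker cpoly set \<Rightarrow> pluecker cpoly set" where
  "torus_act t I = {f. torus_pullback t f \<in> I}"

definition fixed_locus :: "nat \<Rightarrow> pluecker cpoly set set" where
  "fixed_locus d = {I \<in> hilb d. \<forall>t. t \<noteq> 0 \<longrightarrow> torus_act t I = I}"

text \<open>The variety structure on a locally closed set \<open>X\<close> of points of the Hilbert scheme with Hilbert
  polynomial \<open>3 k + 1\<close>. The Gotzmann number of this polynomial is 4 and its value at 4 is 13, so
  mapping \<open>I\<close> to its degree 4 part embeds the Hilbert scheme of \<open>\<P>\<^sup>5\<close> as a closed subscheme of the
  Grassmannian of subspaces of codimension 13 of the space of quartic forms.\<close>

definition cubic_variety :: "pluecker cpoly set set \<Rightarrow> pluecker cpoly set fun_space" where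
  "cubic_variety X = embedded_variety (monomials 4) 13 X (\<lambda>I. I \<inter> forms 4)"

end

theory Submission
  imports Defs
begin

text \<open>The ideal \<open>I\<close> of a fixed point is graded by the torus weights. The sum of the coordinates other than
  \<open>P3_m3\<close>, whose weights are distinct, is a nonzerodivisor modulo \<open>I\<close>: compare components of top weight.
  Hence a special case of Macaulay's bound, applied to \<open>I\<close> and this linear form, gives the Hilbert function
  \<open>3 k + 1\<close> for every \<open>k \<ge> 1\<close>. In degree 1 it follows that \<open>I\<close> contains one of the five coordinates, so the
  curve lies on one of five toric quadric surfaces, a smooth one and four cones. The forms of degree \<open>k\<close> on
  such a surface have a basis indexed by the lattice points of a polygon. There \<open>I\<close> has dimension 2 in
  degree 2 and 6 in degree 3, which forces the two leading lattice points in degree 2 to be adjacent. This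
  leaves 12 curves cut out by monomials on the smooth surface and 6 on each cone, and, on the two cones on
  which two of these 6 equations have the same weight, the pencil spanned by them. Thus \<open>12 + 6 + 6 + 4 + 4 = 32\<close> points are isolated.

  Each of these ideals is the kernel of a map that sends every monomial to a multiple of its class, so its
  charts and coordinates in the Grassmannian are explicit. They separate the components and identify both
  pencils with \<open>\<P>\<^sup>1\<close>.\<close>

text \<open>Membership in \<open>hilb 3\<close> fixes the Hilbert function only in large degrees,
  while the classification needs it in degrees 1, 2 and 3. The nonzerodivisor bridges this gap:
  dividing by it turns the Hilbert function into its first differences, which count sets of
  monomials closed under division. If such a set has at most two elements in some degree from 2 on,
  it never grows again; but it eventually has three. So a Hilbert function that once exceeds 3 k + 1
  could not come back to it.

  On a cone, two of the six candidate equations have the same torus weight only for V T and S^3, and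
  only if V has four times the weight of S. The two monomial members V T and S^3 of that pencil are
  no isolated points, which leaves 6 - 2 = 4 of them.

  All structures are reduced, so no tangent spaces occur: a point is isolated as soon as charts of
  the Grassmannian separate it from each of the finitely many other components.\<close>

abbreviation "lookup \<equiv> Poly_Mapping.lookup"
abbreviation "keys \<equiv> Poly_Mapping.keys"
abbreviation "single \<equiv> Poly_Mapping.single"
abbreviation "linear_map \<equiv> Vector_Spaces.linear vscale vscale"

interpretation vec_pair: vector_space_pair vscale vscale
  by unfold_locales

section \<open>Coordinate subspaces of a free vector space\<close>

lemma in_coord_space: "v \<in> coord_space B \<longleftrightarrow> (\<forall>b. lookup v b \<noteq> 0 \<longrightarrow> b \<in> B)"
  by (auto simp: coord_space_def in_keys_iff)

lemma coord_space_mono: "A \<subseteq> B \<Longrightarrow> coord_space A \<subseteq> coord_space B"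
  by (auto simp: coord_space_def)

lemma subspace_coord_space [simp]: "vec.subspace (coord_space B)"
  by (rule vec.subspaceI) (simp_all add: in_coord_space lookup_add, metis add.right_neutral)

lemma single_in_coord_space: "b \<in> B \<Longrightarrow> single b x \<in> coord_space B"
  by (auto simp: in_coord_space lookup_single when_def)

lemma vscale_single [simp]: "vscale x (single b y) = single b (x * y)"
  by (rule poly_mapping_eqI) (simp add: lookup_single when_def)

lemma sum_singles: "f = (\<Sum>b\<in>keys f. single b (lookup f b))"
proof (rule poly_mapping_eqI)
  fix b
  have "(\<Sum>x\<in>keys f. (lookup f x when x = b)) = (\<Sum>x\<in>keys f. if x = b then lookup f b else 0)"
    by (intro sum.cong) (auto simp: when_def)
  also have "\<dots> = lookup f b" by (auto simp: sum.delta in_keys_iff)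
  finally show "lookup f b = lookup (\<Sum>b\<in>keys f. single b (lookup f b)) b"
    by (simp add: lookup_sum lookup_single)
qed

lemma linear_mapI:
  assumes "\<And>v w. f (v + w) = f v + f w" "\<And>c v. f (vscale c v) = vscale c (f v)"
  shows "linear_map f"
  using assms by (simp add: Vector_Spaces.linear_iff vec.vector_space_axioms)

lemma span_singles: "coord_space B \<subseteq> vec.span ((\<lambda>b. single b 1) ` B)"
proof
  fix v :: "'a \<Rightarrow>\<^sub>0 complex" assume v: "v \<in> coord_space B"
  have "(\<Sum>b\<in>keys v. vscale (lookup v b) (single b 1)) \<in> vec.span ((\<lambda>b. single b 1) ` B)"
    using v by (intro vec.span_sum vec.span_scale vec.span_base) (auto simp: coord_space_def)
  moreover have "(\<Sum>b\<in>keys v. vscale (lookup v b) (single b 1)) = v" by (simp flip: sum_singles)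
  ultimately show "v \<in> vec.span ((\<lambda>b. single b 1) ` B)" by simp
qed

subsection \<open>Leading positions\<close>

text \<open>\<open>ord\<close> is an explicit function, so that the same theory serves the monomial
  order on polynomials and the numbering \<open>slot\<close> of lattice points.\<close>

definition leads :: "('b \<Rightarrow> 'o::linorder) \<Rightarrow> ('b \<Rightarrow>\<^sub>0 complex) set \<Rightarrow> 'b set" where
  "leads ord W = {b. \<exists>f\<in>W. b \<in> keys f \<and> (\<forall>b'\<in>keys f. ord b' \<le> ord b)}"

lemma leads_subset: "W \<subseteq> coord_space B \<Longrightarrow> leads ord W \<subseteq> B"
  by (auto simp: leads_def coord_space_def)

lemma leads_mono: "W \<subseteq> W' \<Longrightarrow> leads ord W \<subseteq> leads ord W'"
  by (auto simp: leads_def)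

lemma ex_lead:
  assumes "f \<in> W" "f \<noteq> 0"
  obtains b where "b \<in> leads ord W" "b \<in> keys f" "\<forall>b'\<in>keys f. ord b' \<le> ord b"
proof -
  have ne: "keys f \<noteq> {}" using assms by simp
  have "Max (ord ` keys f) \<in> ord ` keys f" using ne by simp
  then obtain b where b: "b \<in> keys f" "ord b = Max (ord ` keys f)" by auto
  have "\<forall>b'\<in>keys f. ord b' \<le> ord b" using b(2) by simp
  then show thesis using that[of b] assms b unfolding leads_def by blast
qed

text \<open>Division with remainder: subtracting a multiple of an element of \<open>W\<close> with
  the same leading position lowers the leading position, and \<open>B\<close> has only finitely many
  positions.\<close>

lemma subset_of_leads_subset:
  fixes ord :: "'b \<Rightarrow> 'o::linorder"
  assumes W: "vec.subspace W" "W \<subseteq> W'" and W': "vec.subspace W'" "W' \<subseteq> coord_space B"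
    and B: "finite B" "inj_on ord B" and l: "leads ord W' \<subseteq> leads ord W"
  shows "W' \<subseteq> W"
proof
  fix f assume "f \<in> W'"
  then show "f \<in> W"
  proof (induction "card {b\<in>B. \<exists>k\<in>keys f. ord b \<le> ord k}" arbitrary: f rule: less_induct)
    case less
    show ?case
    proof (cases "f = 0")
      case True then show ?thesis using W(1) by (simp add: vec.subspace_0)
    next
      case False
      obtain b where b: "b \<in> leads ord W'" "b \<in> keys f" "\<forall>b'\<in>keys f. ord b' \<le> ord b"
        using ex_lead[OF less.prems False] by metis
      then obtain g where g: "g \<in> W" "b \<in> keys g" "\<forall>b'\<in>keys g. ord b' \<le> ord b"
        using l by (auto simp: leads_def)
      define h where "h = f - vscale (lookup f b / lookup g b) g"
      have gb: "lookup g b \<noteq> 0" using g by (simp add: in_keys_iff)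
      have hW: "h \<in> W'" unfolding h_def using W W' g less.prems
        by (meson subsetD vec.subspace_diff vec.subspace_scale)
      have bB: "b \<in> B" using b(2) less.prems W' by (auto simp: coord_space_def)
      have hb: "lookup h b = 0" using gb by (simp add: h_def lookup_minus)
      have keys_h: "ord k < ord b" if "k \<in> keys h" for k
      proof -
        have "k \<in> keys f \<or> k \<in> keys g" using that
          by (auto simp: h_def in_keys_iff lookup_minus)
        then have "ord k \<le> ord b" using b g by auto
        moreover have "k \<noteq> b" using that hb by (auto simp: in_keys_iff)
        moreover have "k \<in> B" using that hW W' by (auto simp: coord_space_def)
        ultimately show ?thesis using B(2) bB by (metis inj_onD order_le_less)
      qed
      have "{x\<in>B. \<exists>k\<in>keys h. ord x \<le> ord k} \<subset> {x\<in>B. \<exists>k\<in>keys f. ord x \<le> ord k}"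
      proof (rule psubsetI)
        show "{x\<in>B. \<exists>k\<in>keys h. ord x \<le> ord k} \<subseteq> {x\<in>B. \<exists>k\<in>keys f. ord x \<le> ord k}"
        proof safe
          fix x k assume "x \<in> B" "k \<in> keys h" "ord x \<le> ord k"
          then have "ord x \<le> ord b" using keys_h by force
          then show "\<exists>k\<in>keys f. ord x \<le> ord k" using b(2) by blast
        qed
        have "b \<in> {x\<in>B. \<exists>k\<in>keys f. ord x \<le> ord k}" using bB b by auto
        moreover have "b \<notin> {x\<in>B. \<exists>k\<in>keys h. ord x \<le> ord k}" using keys_h by (auto simp: not_le)
        ultimately show "{x\<in>B. \<exists>k\<in>keys h. ord x \<le> ord k} \<noteq> {x\<in>B. \<exists>k\<in>keys f. ord x \<le> ord k}" by blast
      qed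
      then have "h \<in> W" using B(1) hW by (intro less.hyps) (auto intro!: psubset_card_mono)
      then have "h + vscale (lookup f b / lookup g b) g \<in> W"
        using W g by (intro vec.subspace_add vec.subspace_scale) auto
      then show ?thesis by (simp add: h_def)
    qed
  qed
qed

text \<open>Elements with distinct leading positions are independent, and by the preceding lemma one
  for each leading position suffices to span. This turns dimensions into counts of
  positions.\<close>

lemma dim_leads:
  fixes ord :: "'b \<Rightarrow> 'o::linorder"
  assumes W: "vec.subspace W" "W \<subseteq> coord_space B" and B: "finite B" "inj_on ord B"
  shows "vec.dim W = card (leads ord W)"
proof -
  let ?L = "leads ord W"
  have LB: "?L \<subseteq> B" using leads_subset[OF W(2)] .
  then have fin: "finite ?L" using B(1) finite_subset by blast
  have "\<forall>b\<in>?L. \<exists>f\<in>W. b \<in> keys f \<and> (\<forall>b'\<in>keys f. ord b' \<le> ord b)" by (auto simp: leads_def)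
  then obtain F where F: "\<And>b. b \<in> ?L \<Longrightarrow> F b \<in> W \<and> b \<in> keys (F b) \<and> (\<forall>b'\<in>keys (F b). ord b' \<le> ord b)"
    by metis
  have inj: "inj_on F ?L"
  proof (rule inj_onI)
    fix x y assume "x \<in> ?L" "y \<in> ?L" "F x = F y"
    then have "ord x = ord y" using F by (metis order_antisym)
    then show "x = y" using B(2) LB \<open>x \<in> ?L\<close> \<open>y \<in> ?L\<close> by (auto dest: inj_onD)
  qed
  have indep: "vec.independent (F ` ?L)"
  proof (rule vec.independent_if_scalars_zero)
    show "finite (F ` ?L)" using fin by simp
    fix u x assume u: "(\<Sum>x\<in>F ` ?L. vscale (u x) x) = 0" and x: "x \<in> F ` ?L"
    have u': "(\<Sum>b\<in>?L. vscale (u (F b)) (F b)) = 0" using u inj by (simp add: sum.reindex)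
    show "u x = 0"
    proof (rule ccontr)
      assume "u x \<noteq> 0"
      \<comment> \<open>At the highest leading position that occurs in the relation, all other
        representatives in the relation have coefficient 0.\<close>
      define N where "N = {b\<in>?L. u (F b) \<noteq> 0}"
      have N: "finite N" "N \<noteq> {}" using fin x \<open>u x \<noteq> 0\<close> by (auto simp: N_def)
      then have "Max (ord ` N) \<in> ord ` N" by simp
      then obtain b where b: "b \<in> N" "ord b = Max (ord ` N)" by auto
      have mx: "ord b' \<le> ord b" if "b' \<in> N" for b' using b(2) N that by simp
      have bL: "b \<in> ?L" using b by (simp add: N_def)
      have z: "u (F b') * lookup (F b') b = 0" if "b' \<in> ?L" "b' \<noteq> b" for b'
      proof (rule ccontr)
        assume a: "u (F b') * lookup (F b') b \<noteq> 0"
        then have "b' \<in> N" "b \<in> keys (F b')" using that by (auto simp: N_def in_keys_iff)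
        then have "ord b' \<le> ord b" "ord b \<le> ord b'" using mx F that by auto
        then have "ord b' = ord b" by simp
        then show False using that bL LB B(2) by (auto dest: inj_onD)
      qed
      have "lookup (\<Sum>b\<in>?L. vscale (u (F b)) (F b)) b = (\<Sum>b'\<in>?L. u (F b') * lookup (F b') b)"
        by (simp add: lookup_sum)
      also have "\<dots> = u (F b) * lookup (F b) b"
        using fin bL z by (subst sum.remove[of _ b]) (auto intro!: sum.neutral, blast)
      finally have "u (F b) * lookup (F b) b = 0" using u' by simp
      then show False using b F bL by (auto simp: N_def in_keys_iff)
    qed
  qed
  have spW: "vec.span (F ` ?L) \<subseteq> W" using F W by (intro vec.span_minimal) auto
  have "W \<subseteq> vec.span (F ` ?L)"
  proof (rule subset_of_leads_subset[OF _ spW W B])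
    show "leads ord W \<subseteq> leads ord (vec.span (F ` ?L))"
    proof
      fix b assume b: "b \<in> ?L"
      then have "F b \<in> vec.span (F ` ?L)" by (intro vec.span_base) auto
      then show "b \<in> leads ord (vec.span (F ` ?L))" using F[OF b] by (auto simp: leads_def)
    qed
  qed simp
  then have "vec.dim W = card (F ` ?L)" using F
    by (intro vec.dim_unique[OF _ _ indep]) auto
  then show ?thesis using inj by (simp add: card_image)
qed

lemma dim_coord_space:
  assumes "finite B" shows "vec.dim (coord_space B) = card B"
proof -
  obtain ord :: "'a \<Rightarrow> nat" where "inj_on ord B"
    using assms finite_imp_inj_to_nat_seg by metis
  moreover have "leads ord (coord_space B) = B"
  proof
    show "leads ord (coord_space B) \<subseteq> B" by (rule leads_subset) simp
    show "B \<subseteq> leads ord (coord_space B)"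
    proof
      fix b assume "b \<in> B"
      then have "single b 1 \<in> coord_space B" by (rule single_in_coord_space)
      then show "b \<in> leads ord (coord_space B)" unfolding leads_def by force
    qed
  qed
  ultimately show ?thesis using dim_leads[of "coord_space B" B ord] assms by simp
qed

lemma dim_subset_coord:
  assumes "vec.subspace W" "vec.subspace W'" "W \<subseteq> W'" "W' \<subseteq> coord_space B" "finite B"
  shows "vec.dim W \<le> vec.dim W'"
proof -
  obtain ord :: "'a \<Rightarrow> nat" where o: "inj_on ord B"
    using assms finite_imp_inj_to_nat_seg by metis
  have "vec.dim W = card (leads ord W)" "vec.dim W' = card (leads ord W')"
    using assms o by (auto intro!: dim_leads)
  moreover have "finite (leads ord W')" using assms leads_subset finite_subset by metis
  ultimately show ?thesis using leads_mono[OF assms(3), of ord] by (simp add: card_mono)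
qed

lemma subspace_eq_of_dim:
  assumes "vec.subspace W" "vec.subspace W'" "W \<subseteq> W'" "W' \<subseteq> coord_space B" "finite B"
    "vec.dim W' \<le> vec.dim W"
  shows "W = W'"
proof -
  obtain ord :: "'a \<Rightarrow> nat" where o: "inj_on ord B"
    using assms finite_imp_inj_to_nat_seg by metis
  have "vec.dim W = card (leads ord W)" "vec.dim W' = card (leads ord W')"
    using assms o by (auto intro!: dim_leads)
  moreover have "finite (leads ord W')" using assms leads_subset finite_subset by metis
  ultimately have "leads ord W = leads ord W'" using leads_mono[OF assms(3), of ord] assms(6)
    by (metis card_seteq)
  then have "W' \<subseteq> W" using assms o by (intro subset_of_leads_subset[of W W' B ord]) auto
  then show ?thesis using assms by auto
qed

section \<open>Rank and nullity\<close>

lemma finite_dim_basis: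
  assumes "W \<subseteq> vec.span S" "finite S"
  obtains A where "A \<subseteq> W" "finite A" "vec.independent A" "W \<subseteq> vec.span A" "card A = vec.dim W"
proof -
  obtain A where A: "A \<subseteq> W" "vec.independent A" "W \<subseteq> vec.span A" "card A = vec.dim W"
    using vec.basis_exists by blast
  have "finite A" using vec.independent_span_bound[OF assms(2) A(2)] A(1) assms(1) by auto
  then show thesis using A that by blast
qed

text \<open>The ambient space has infinite dimension; finiteness comes from the finite set
  \<open>B\<close> that carries \<open>V\<close>. A basis of the kernel and preimages of a basis of
  the image together form a basis of \<open>V\<close>.\<close>

lemma rank_nullity:
  assumes T: "linear_map T" and V: "vec.subspace V" "V \<subseteq> coord_space B" "finite B"
  shows "vec.dim V = vec.dim (T ` V) + vec.dim {v\<in>V. T v = 0}"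
proof -
  interpret T: Vector_Spaces.linear vscale vscale T by (rule T)
  let ?K = "{v\<in>V. T v = 0}"
  let ?S = "(\<lambda>b. single b 1) ` B"
  have VS: "V \<subseteq> vec.span ?S" using V(2) span_singles by blast
  obtain A where A: "A \<subseteq> ?K" "finite A" "vec.independent A" "?K \<subseteq> vec.span A" "card A = vec.dim ?K"
  proof (rule finite_dim_basis)
    show "?K \<subseteq> vec.span ?S" using VS by blast
  qed (use V(3) in auto)
  obtain C where C: "C \<subseteq> T ` V" "finite C" "vec.independent C" "T ` V \<subseteq> vec.span C" "card C = vec.dim (T ` V)"
  proof (rule finite_dim_basis)
    show "T ` V \<subseteq> vec.span (T ` ?S)" using VS T.span_image[of ?S] by blast
  qed (use V(3) in auto)
  have "\<forall>c\<in>C. \<exists>v\<in>V. T v = c" using C(1) by auto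
  then obtain g where g: "\<And>c. c \<in> C \<Longrightarrow> g c \<in> V \<and> T (g c) = c" by metis
  have injg: "inj_on g C" using g by (metis inj_onI)
  have KS: "vec.subspace ?K" using V(1) vec.subspace_inter[OF V(1) T.subspace_kernel] by (simp add: Int_def)
  have sA: "vec.span A = ?K" using A KS by (intro vec.span_subspace) auto
  have sC: "vec.span C = T ` V" using C T.subspace_image[OF V(1)] by (intro vec.span_subspace) auto
  have disj: "A \<inter> g ` C = {}"
  proof (rule ccontr)
    assume "A \<inter> g ` C \<noteq> {}"
    then obtain c where c: "c \<in> C" "g c \<in> A" by auto
    then have "c = 0" using A g by auto
    then show False using C(3) c vec.dependent_zero by blast
  qed
  have "vec.independent (A \<union> g ` C)"
  proof (rule vec.independent_if_scalars_zero)
    show "finite (A \<union> g ` C)" using A C by auto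
    fix u x assume u: "(\<Sum>x\<in>A \<union> g ` C. vscale (u x) x) = 0" and x: "x \<in> A \<union> g ` C"
    have s: "(\<Sum>x\<in>A. vscale (u x) x) + (\<Sum>c\<in>C. vscale (u (g c)) (g c)) = 0"
      using u A C disj injg by (simp add: sum.union_disjoint sum.reindex)
    have "T (\<Sum>x\<in>A. vscale (u x) x) = 0" using A
      by (simp add: T.sum T.scale subset_iff)
    then have "T (\<Sum>c\<in>C. vscale (u (g c)) (g c)) = 0" using arg_cong[OF s, of T] by (simp add: T.add)
    then have "(\<Sum>c\<in>C. vscale (u (g c)) c) = 0" using g by (simp add: T.sum T.scale)
    then have uc: "u (g c) = 0" if "c \<in> C" for c
      using vec.independentD[OF C(3) C(2) subset_refl, of "\<lambda>c. u (g c)"] that by blast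
    then have "(\<Sum>x\<in>A. vscale (u x) x) = 0" using s by simp
    then have "u a = 0" if "a \<in> A" for a
      using vec.independentD[OF A(3) A(2) subset_refl, of u] that by blast
    then show "u x = 0" using uc x by auto
  qed
  moreover have "V \<subseteq> vec.span (A \<union> g ` C)"
  proof
    fix v assume v: "v \<in> V"
    then have "T v \<in> vec.span C" using sC by auto
    then obtain w where w: "T v = (\<Sum>c\<in>C. vscale (w c) c)" using vec.span_finite[OF C(2)] by auto
    let ?s = "\<Sum>c\<in>C. vscale (w c) (g c)"
    have "?s \<in> V" using g V(1) by (intro vec.subspace_sum vec.subspace_scale) auto
    moreover have "T ?s = T v" using g w by (simp add: T.sum T.scale)
    ultimately have "v - ?s \<in> ?K" using v V(1) by (simp add: vec.subspace_diff T.diff)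
    then have "v - ?s \<in> vec.span (A \<union> g ` C)" using sA vec.span_mono[of A "A \<union> g ` C"] by auto
    moreover have "?s \<in> vec.span (A \<union> g ` C)" by (intro vec.span_sum vec.span_scale vec.span_base) auto
    ultimately have "(v - ?s) + ?s \<in> vec.span (A \<union> g ` C)" by (rule vec.span_add)
    then show "v \<in> vec.span (A \<union> g ` C)" by simp
  qed
  ultimately have "vec.dim V = card (A \<union> g ` C)" using A(1) g by (intro vec.dim_unique[symmetric, THEN sym]) auto
  also have "\<dots> = card A + card C" using A C disj injg by (simp add: card_Un_disjoint card_image)
  finally show ?thesis using A C by simp
qed

subsection \<open>Polynomials and ideals\<close>

lemma single_times: "single m x * f = (\<Sum>n\<in>keys f. single (m + n) (x * lookup f n))"
proof -
  have "single m x * f = single m x * (\<Sum>n\<in>keys f. single n (lookup f n))"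
    by (rule arg_cong[OF sum_singles])
  also have "\<dots> = (\<Sum>n\<in>keys f. single (m + n) (x * lookup f n))"
    by (simp add: sum_distrib_left mult_single)
  finally show ?thesis .
qed

lemma lookup_single_times:
  fixes m :: "'m::cancel_comm_monoid_add"
  shows "lookup (single m x * f) (m + n) = (x::complex) * lookup f n"
proof -
  have "lookup (single m x * f) (m + n) = (\<Sum>k\<in>keys f. (x * lookup f k when k = n))"
    by (simp add: single_times lookup_sum lookup_single)
  also have "\<dots> = (\<Sum>k\<in>keys f. if k = n then x * lookup f n else 0)"
    by (intro sum.cong) (auto simp: when_def)
  also have "\<dots> = x * lookup f n" by (auto simp: sum.delta in_keys_iff)
  finally show ?thesis .
qed

lemma lookup_single_times_outside:
  fixes m :: "'m::cancel_comm_monoid_add"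
  assumes "\<And>n. m' \<noteq> m + n"
  shows "lookup (single m x * f) m' = (0::complex)"
  unfolding single_times lookup_sum using assms
  by (intro sum.neutral ballI) (auto simp: lookup_single when_def)

lemma vscale_eq_times: "vscale x f = single 0 x * (f :: 'm::cancel_comm_monoid_add \<Rightarrow>\<^sub>0 complex)"
proof (rule poly_mapping_eqI)
  fix m show "lookup (vscale x f) m = lookup (single 0 x * f) m"
    using lookup_single_times[of 0 x f m] by simp
qed

lemma mult_vscale: "g * vscale x f = vscale x (g * (f :: 'm::cancel_comm_monoid_add \<Rightarrow>\<^sub>0 complex))"
  by (simp add: vscale_eq_times mult.left_commute)

lemma ideal_subspace:
  fixes I :: "('m::cancel_comm_monoid_add \<Rightarrow>\<^sub>0 complex) set"
  shows "is_ideal I \<Longrightarrow> vec.subspace I"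
  by (rule vec.subspaceI)
    (auto simp: vscale_eq_times ring_mod.subspace_0 ring_mod.subspace_add ring_mod.subspace_scale)

lemma mon_degree_superset:
  "finite S \<Longrightarrow> keys m \<subseteq> S \<Longrightarrow> mon_degree m = (\<Sum>i\<in>S. lookup m i)"
  unfolding mon_degree_def by (rule sum.mono_neutral_left) (auto simp: in_keys_iff)

lemma mon_degree_add: "mon_degree (m + n) = mon_degree m + mon_degree n"
proof -
  have "keys (m + n) \<subseteq> keys m \<union> keys n" by (rule keys_add)
  then show ?thesis
    by (simp add: mon_degree_superset[of "keys m \<union> keys n"] lookup_add sum.distrib)
qed

lemma mon_degree_single [simp]: "mon_degree (single i k) = k"
  by (simp add: mon_degree_def)

lemma mon_degree_0 [simp]: "mon_degree 0 = 0"
  by (simp add: mon_degree_def)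

lemma mon_degree_eq_0: "mon_degree m = 0 \<Longrightarrow> m = 0"
  by (rule poly_mapping_eqI) (auto simp: mon_degree_def in_keys_iff)

lemma monomial_split:
  fixes m :: "'i \<Rightarrow>\<^sub>0 nat"
  assumes "i \<in> keys m" shows "m = single i 1 + (m - single i 1)"
  using assms by (intro poly_mapping_eqI) (auto simp: lookup_add lookup_minus lookup_single when_def in_keys_iff)

lemma monomial_induct [case_names zero step]:
  fixes m :: "'i \<Rightarrow>\<^sub>0 nat"
  assumes "P 0" "\<And>i m. P m \<Longrightarrow> P (single i 1 + m)"
  shows "P m"
proof (induction "mon_degree m" arbitrary: m)
  case 0
  then show ?case using assms(1) mon_degree_eq_0[of m] by simp
next
  case (Suc n)
  then have "m \<noteq> 0" by auto
  then obtain i where "i \<in> keys m" using keys_eq_empty by blast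
  then have m: "m = single i 1 + (m - single i 1)" by (rule monomial_split)
  then have "mon_degree m = 1 + mon_degree (m - single i 1)" using mon_degree_add[of "single i 1" "m - single i 1"] by simp
  then have "P (m - single i 1)" using Suc by simp
  then show ?case using assms(2) m by metis
qed

lemma finite_monomials: "finite (monomials k :: ('i::finite \<Rightarrow>\<^sub>0 nat) set)"
proof (rule finite_imageD)
  have "lookup m i \<le> k" if "mon_degree m = k" for m :: "'i \<Rightarrow>\<^sub>0 nat" and i
    using that member_le_sum[of i UNIV "lookup m"] by (simp add: mon_degree_superset[of UNIV])
  then have "lookup ` (monomials k :: ('i \<Rightarrow>\<^sub>0 nat) set) \<subseteq> PiE UNIV (\<lambda>_. {..k})"
    by (auto simp: monomials_def)
  then show "finite (lookup ` (monomials k :: ('i \<Rightarrow>\<^sub>0 nat) set))"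
    by (rule finite_subset) (simp add: finite_PiE)
  show "inj_on lookup (monomials k :: ('i \<Rightarrow>\<^sub>0 nat) set)"
    by (auto intro!: inj_onI poly_mapping_eqI)
qed

abbreviation var :: "'i \<Rightarrow> 'i cpoly" where
  "var i \<equiv> single (single i 1) 1"

lemma single_step: "single (single i 1 + m) x = var i * single m x"
  by (simp add: mult_single)

lemma idealI_var:
  fixes I :: "'i cpoly set"
  assumes I: "vec.subspace I" and v: "\<And>i f. f \<in> I \<Longrightarrow> var i * f \<in> I"
  shows "is_ideal I"
proof (rule ring_mod.subspaceI)
  have s: "single m x * f \<in> I" if "f \<in> I" for m x f
    using that
  proof (induction m rule: monomial_induct)
    case zero
    then show ?case using vec.subspace_scale[OF I] by (simp only: vscale_eq_times[symmetric])
  next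
    case (step i m)
    have "single (single i 1 + m) x * f = var i * (single m x * f)" by (simp only: single_step mult.assoc)
    then show ?case using v[OF step.IH[OF step.prems], of i] by (simp only:)
  qed
  fix g f assume "f \<in> I"
  then have "(\<Sum>m\<in>keys g. single m (lookup g m) * f) \<in> I" using I s by (intro vec.subspace_sum) auto
  then show "g * f \<in> I" by (simp only: sum_distrib_right[symmetric] sum_singles[symmetric])
qed (use I in \<open>auto simp: vec.subspace_0 vec.subspace_add\<close>)

lemma subspace_forms [simp]: "vec.subspace (forms k)"
  by (simp add: forms_def)

lemma single_in_forms: "mon_degree m = k \<Longrightarrow> single m x \<in> forms k"
  by (simp add: forms_def monomials_def single_in_coord_space)

lemma forms_mult: "f \<in> forms k \<Longrightarrow> g \<in> forms l \<Longrightarrow> f * g \<in> forms (k + l)"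
  using keys_mult[of f g]
  by (fastforce simp: forms_def coord_space_def monomials_def mon_degree_add)

lemma var_in_forms [simp]: "var i \<in> forms 1"
  by (simp add: single_in_forms)

lemma dim_forms: "vec.dim (forms k :: ('i::finite) cpoly set) = card (monomials k :: ('i \<Rightarrow>\<^sub>0 nat) set)"
  by (simp add: forms_def dim_coord_space finite_monomials)

definition vproj :: "'b set \<Rightarrow> ('b \<Rightarrow>\<^sub>0 complex) \<Rightarrow> ('b \<Rightarrow>\<^sub>0 complex)" where
  "vproj S f = (\<Sum>b\<in>keys f \<inter> S. single b (lookup f b))"

lemma lookup_vproj [simp]: "lookup (vproj S f) b = (if b \<in> S then lookup f b else 0)"
proof -
  have "lookup (vproj S f) b = (\<Sum>x\<in>keys f \<inter> S. if x = b then lookup f b else 0)"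
    unfolding vproj_def lookup_sum by (intro sum.cong) (auto simp: lookup_single when_def)
  then show ?thesis by (auto simp: sum.delta in_keys_iff)
qed

lemma hom_component_eq: "hom_component k f = vproj (monomials k) f"
  by (simp add: hom_component_def vproj_def)

lemma hom_component_in_forms: "hom_component k f \<in> forms k"
  by (simp add: hom_component_eq forms_def in_coord_space)

lemma sum_hom_components: "f = (\<Sum>k\<in>mon_degree ` keys f. hom_component k f)"
proof (rule poly_mapping_eqI)
  fix m
  have "(\<Sum>k\<in>mon_degree ` keys f. lookup (hom_component k f) m)
      = (\<Sum>k\<in>mon_degree ` keys f. if k = mon_degree m then lookup f m else 0)"
    by (intro sum.cong) (auto simp: hom_component_eq monomials_def)
  also have "\<dots> = lookup f m" by (auto simp: sum.delta in_keys_iff image_iff)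
  finally show "lookup f m = lookup (\<Sum>k\<in>mon_degree ` keys f. hom_component k f) m"
    by (simp add: lookup_sum)
qed

subsection \<open>Ideals given by one functional for each class of monomials\<close>

text \<open>For additive \<pi> and multiplicative c this is a monomial ring homomorphism. For the
  curves c is no longer multiplicative, and the map is only linear.\<close>

definition qmap :: "('b \<Rightarrow> 'p) \<Rightarrow> ('b \<Rightarrow> complex) \<Rightarrow> ('b \<Rightarrow>\<^sub>0 complex) \<Rightarrow> ('p \<Rightarrow>\<^sub>0 complex)" where
  "qmap \<pi> c f = (\<Sum>b\<in>keys f. single (\<pi> b) (c b * lookup f b))"

definition mq :: "('b \<Rightarrow> 'p) \<Rightarrow> ('b \<Rightarrow> complex) \<Rightarrow> ('b \<Rightarrow>\<^sub>0 complex) set" where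
  "mq \<pi> c = {f. qmap \<pi> c f = 0}"

definition classes :: "('b \<Rightarrow> 'p) \<Rightarrow> ('b \<Rightarrow> complex) \<Rightarrow> 'b set \<Rightarrow> 'p set" where
  "classes \<pi> c B = \<pi> ` {b \<in> B. c b \<noteq> 0}"

lemma lookup_qmap_superset:
  assumes "finite S" "keys f \<subseteq> S"
  shows "lookup (qmap \<pi> c f) p = (\<Sum>b\<in>S. if \<pi> b = p then c b * lookup f b else 0)"
proof -
  have "lookup (qmap \<pi> c f) p = (\<Sum>b\<in>keys f. if \<pi> b = p then c b * lookup f b else 0)"
    unfolding qmap_def lookup_sum by (intro sum.cong) (auto simp: lookup_single when_def)
  also have "\<dots> = (\<Sum>b\<in>S. if \<pi> b = p then c b * lookup f b else 0)"
    using assms by (intro sum.mono_neutral_left) (auto simp: in_keys_iff)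
  finally show ?thesis .
qed

lemmas lookup_qmap = lookup_qmap_superset[OF finite_keys order_refl]

lemma qmap_add: "qmap \<pi> c (f + g) = qmap \<pi> c f + qmap \<pi> c g"
proof (rule poly_mapping_eqI)
  fix p
  have "keys (f + g) \<subseteq> keys f \<union> keys g" by (rule keys_add)
  then show "lookup (qmap \<pi> c (f + g)) p = lookup (qmap \<pi> c f + qmap \<pi> c g) p"
    by (simp add: lookup_qmap_superset[of "keys f \<union> keys g"] lookup_add distrib_left
        flip: sum.distrib) (intro sum.cong, auto simp: lookup_add distrib_left)
qed

lemma qmap_vscale: "qmap \<pi> c (vscale x f) = vscale x (qmap \<pi> c f)"
proof (rule poly_mapping_eqI)
  fix p
  have "keys (vscale x f) \<subseteq> keys f" by (auto simp: in_keys_iff)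
  then show "lookup (qmap \<pi> c (vscale x f)) p = lookup (vscale x (qmap \<pi> c f)) p"
    by (simp add: lookup_qmap_superset[of "keys f"] sum_distrib_left) (intro sum.cong, auto)
qed

lemma linear_qmap [simp]: "linear_map (qmap \<pi> c)"
  by (rule linear_mapI) (simp_all add: qmap_add qmap_vscale)

lemma qmap_single [simp]: "qmap \<pi> c (single b x) = single (\<pi> b) (c b * x)"
  by (simp add: qmap_def)

lemma qmap_0 [simp]: "qmap \<pi> c 0 = 0"
  by (simp add: qmap_def)

lemma qmap_minus: "qmap \<pi> c (f - g) = qmap \<pi> c f - qmap \<pi> c g"
  using module_hom.diff[of vscale vscale "qmap \<pi> c" f g] linear_qmap[of \<pi> c]
  by (simp add: module_hom_iff_linear)

lemma qmap_sum: "qmap \<pi> c (\<Sum>x\<in>A. f x) = (\<Sum>x\<in>A. qmap \<pi> c (f x))"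
  by (induction A rule: infinite_finite_induct) (simp_all add: qmap_add)

lemma subspace_mq [simp]: "vec.subspace (mq \<pi> c)"
  by (rule vec.subspaceI) (auto simp: mq_def qmap_add qmap_vscale)

lemma qmap_nonzero_class:
  assumes "lookup (qmap \<pi> c f) p \<noteq> 0"
  obtains b where "b \<in> keys f" "\<pi> b = p" "c b \<noteq> 0"
proof -
  have "\<exists>b\<in>keys f. (if \<pi> b = p then c b * lookup f b else 0) \<noteq> 0"
    using assms sum.neutral[of "keys f" "\<lambda>b. if \<pi> b = p then c b * lookup f b else 0"]
    unfolding lookup_qmap by blast
  then show thesis using that by (auto split: if_splits)
qed

text \<open>The classes with a nonvanishing coefficient form a basis of the image, so the Hilbert
  function of the kernel is a count of classes.\<close>

lemma qmap_image:
  fixes B :: "'b set"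
  shows "qmap \<pi> c ` coord_space B = coord_space (classes \<pi> c B)"
proof
  show "qmap \<pi> c ` coord_space B \<subseteq> coord_space (classes \<pi> c B)"
  proof clarsimp
    fix f :: "'b \<Rightarrow>\<^sub>0 complex" assume f: "f \<in> coord_space B"
    show "qmap \<pi> c f \<in> coord_space (classes \<pi> c B)"
      unfolding in_coord_space
    proof (intro allI impI)
      fix p assume "lookup (qmap \<pi> c f) p \<noteq> 0"
      then obtain b where "b \<in> keys f" "\<pi> b = p" "c b \<noteq> 0" by (rule qmap_nonzero_class)
      then show "p \<in> classes \<pi> c B" using f by (auto simp: classes_def coord_space_def)
    qed
  qed
  interpret Vector_Spaces.linear vscale vscale "qmap \<pi> c" by simp
  have "single p 1 \<in> qmap \<pi> c ` coord_space B" if "p \<in> classes \<pi> c B" for p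
  proof -
    obtain b where b: "b \<in> B" "c b \<noteq> 0" "p = \<pi> b" using \<open>p \<in> classes \<pi> c B\<close> by (auto simp: classes_def)
    have "qmap \<pi> c (single b (1 / c b)) = single p 1" using b by simp
    moreover have "single b (1 / c b) \<in> coord_space B" using b by (simp add: single_in_coord_space)
    ultimately show ?thesis by (metis imageI)
  qed
  then have "vec.span ((\<lambda>b. single b 1) ` classes \<pi> c B) \<subseteq> qmap \<pi> c ` coord_space B"
    by (intro vec.span_minimal subspace_image) auto
  then show "coord_space (classes \<pi> c B) \<subseteq> qmap \<pi> c ` coord_space B"
    using span_singles by blast
qed

lemma finite_classes: "finite B \<Longrightarrow> finite (classes \<pi> c B)"
  by (simp add: classes_def)

lemma dim_mq_Int:
  assumes "finite B"
  shows "vec.dim (mq \<pi> c \<inter> coord_space B) + card (classes \<pi> c B) = card B"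
proof -
  have "vec.dim (coord_space B) = vec.dim (qmap \<pi> c ` coord_space B) + vec.dim {v \<in> coord_space B. qmap \<pi> c v = 0}"
    using assms by (intro rank_nullity[of _ _ B]) simp_all
  moreover have "{v \<in> coord_space B. qmap \<pi> c v = 0} = mq \<pi> c \<inter> coord_space B" by (auto simp: mq_def)
  ultimately show ?thesis using assms by (simp add: qmap_image dim_coord_space finite_classes)
qed

lemma hilbert_function_mq:
  "hilbert_function (mq \<pi> c :: ('i::finite) cpoly set) k = int (card (classes \<pi> c (monomials k)))"
  using dim_mq_Int[OF finite_monomials, of \<pi> c k]
  by (simp add: hilbert_function_def dim_forms) (simp add: forms_def)

text \<open>A condition on basis elements that depends only on the class, wherever c does not
  vanish, descends to the image. It is applied to degrees, to torus weights and to
  divisibility.\<close>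

lemma qmap_vproj:
  assumes "\<And>b. c b \<noteq> 0 \<Longrightarrow> b \<in> S \<longleftrightarrow> P (\<pi> b)"
  shows "lookup (qmap \<pi> c (vproj S f)) p = (if P p then lookup (qmap \<pi> c f) p else 0)"
proof -
  have "keys (vproj S f) \<subseteq> keys f" by (auto simp: in_keys_iff split: if_splits)
  then have "lookup (qmap \<pi> c (vproj S f)) p
      = (\<Sum>b\<in>keys f. if \<pi> b = p then c b * lookup (vproj S f) b else 0)"
    by (rule lookup_qmap_superset[OF finite_keys])
  also have "\<dots> = (\<Sum>b\<in>keys f. if P p then (if \<pi> b = p then c b * lookup f b else 0) else 0)"
    using assms by (intro sum.cong) auto
  finally show ?thesis by (simp add: lookup_qmap)
qed

definition mon_weight :: "(pluecker \<Rightarrow>\<^sub>0 nat) \<Rightarrow> int" where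
  "mon_weight m = (\<Sum>i\<in>keys m. weight i * int (lookup m i))"

lemma lookup_torus_pullback:
  assumes "t \<noteq> 0"
  shows "lookup (torus_pullback t f) m = t powi mon_weight m * lookup f m"
proof -
  have w: "(\<Prod>i\<in>keys m. (t powi weight i) ^ lookup m i) = t powi mon_weight m"
  proof -
    have "t powi (\<Sum>i\<in>A. weight i * int (lookup m i)) = (\<Prod>i\<in>A. (t powi weight i) ^ lookup m i)"
      if "finite A" for A
      using that assms by (induction A) (simp_all add: power_int_add power_int_mult)
    then show ?thesis by (simp add: mon_weight_def)
  qed
  have "lookup (torus_pullback t f) m = (\<Sum>n\<in>keys f. if n = m then t powi mon_weight m * lookup f m else 0)"
    unfolding torus_pullback_def lookup_sum by (intro sum.cong) (auto simp: lookup_single when_def w)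
  then show ?thesis by (auto simp: sum.delta in_keys_iff)
qed

text \<open>The factor \<open>\<mu> i\<close> depends on a monomial only through its class, so
  multiplication by a variable descends to the image of \<open>qmap \<pi> c\<close> and the kernel
  is an ideal. The assumption \<open>extend\<close> says that no class is killed by all variables,
  which gives saturation.\<close>

locale monomial_quotient =
  fixes \<pi> :: "('i::finite \<Rightarrow>\<^sub>0 nat) \<Rightarrow> 'p::cancel_comm_monoid_add" and c :: "('i \<Rightarrow>\<^sub>0 nat) \<Rightarrow> complex"
    and \<epsilon> :: "'i \<Rightarrow> 'p" and \<mu> :: "'i \<Rightarrow> 'p \<Rightarrow> complex" and d :: "'p \<Rightarrow> nat"
  assumes \<pi>_step: "\<And>i m. \<pi> (single i 1 + m) = \<epsilon> i + \<pi> m"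
    and c_step: "\<And>i m. c (single i 1 + m) = \<mu> i (\<pi> m) * c m"
    and degree: "\<And>m. c m \<noteq> 0 \<Longrightarrow> d (\<pi> m) = mon_degree m"
    and extend: "\<And>m. c m \<noteq> 0 \<Longrightarrow> \<exists>i. \<mu> i (\<pi> m) \<noteq> 0"
begin

lemma qmap_var:
  "qmap \<pi> c (var i * f) = (\<Sum>n\<in>keys f. single (\<epsilon> i + \<pi> n) (\<mu> i (\<pi> n) * (c n * lookup f n)))"
  by (simp only: single_times qmap_sum qmap_single \<pi>_step c_step mult_1_left mult.assoc)

lemma lookup_qmap_var: "lookup (qmap \<pi> c (var i * f)) (\<epsilon> i + p) = \<mu> i p * lookup (qmap \<pi> c f) p"
  unfolding qmap_var lookup_sum lookup_qmap sum_distrib_left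
  by (intro sum.cong) (auto simp: lookup_single when_def)

lemma lookup_qmap_var_outside:
  "(\<And>p. q \<noteq> \<epsilon> i + p) \<Longrightarrow> lookup (qmap \<pi> c (var i * f)) q = 0"
  unfolding qmap_var lookup_sum by (intro sum.neutral) (auto simp: lookup_single when_def)

lemma ideal_mq: "is_ideal (mq \<pi> c)"
proof (rule idealI_var)
  fix i and f :: "'i cpoly" assume "f \<in> mq \<pi> c"
  then have f: "qmap \<pi> c f = 0" by (simp add: mq_def)
  have "lookup (qmap \<pi> c (var i * f)) q = 0" for q
    using lookup_qmap_var[of i f] lookup_qmap_var_outside[of q i f] f
    by (cases "\<exists>p. q = \<epsilon> i + p") auto
  then show "var i * f \<in> mq \<pi> c" by (simp add: mq_def poly_mapping_eqI)
qed simp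

lemma homogeneous_mq: "homogeneous_ideal (mq \<pi> c)"
  unfolding homogeneous_ideal_def
proof (intro conjI ballI allI ideal_mq)
  fix f k assume "f \<in> mq \<pi> c"
  then have "qmap \<pi> c f = 0" by (simp add: mq_def)
  moreover have "lookup (qmap \<pi> c (vproj (monomials k) f)) p = (if d p = k then lookup (qmap \<pi> c f) p else 0)" for p
    using degree by (intro qmap_vproj) (auto simp: monomials_def)
  ultimately show "hom_component k f \<in> mq \<pi> c"
    by (simp add: mq_def hom_component_eq poly_mapping_eqI)
qed

text \<open>A nonzero coefficient at the class p survives multiplication by a variable with
  \<open>\<mu> i p \<noteq> 0\<close>, since translation by \<open>\<epsilon> i\<close> is injective
  and cannot merge classes.\<close>

lemma extend_nonmember:
  assumes "f \<notin> mq \<pi> c" shows "\<exists>g\<in>forms k. g * f \<notin> mq \<pi> c"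
proof (induction k)
  case 0
  have "1 * f \<notin> mq \<pi> c" using assms by simp
  moreover have "(1 :: 'i cpoly) \<in> forms 0" using single_in_forms[of 0 0 1] by simp
  ultimately show ?case by blast
next
  case (Suc k)
  then obtain g where g: "g \<in> forms k" "g * f \<notin> mq \<pi> c" by blast
  then have "qmap \<pi> c (g * f) \<noteq> 0" by (simp add: mq_def)
  then obtain p where p: "lookup (qmap \<pi> c (g * f)) p \<noteq> 0" by (metis lookup_zero poly_mapping_eqI)
  then obtain m where "\<pi> m = p" "c m \<noteq> 0" by (rule qmap_nonzero_class)
  then obtain i where "\<mu> i p \<noteq> 0" using extend by blast
  then have "lookup (qmap \<pi> c (var i * (g * f))) (\<epsilon> i + p) \<noteq> 0"
    using p by (simp only: lookup_qmap_var) simp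
  then have "qmap \<pi> c (var i * (g * f)) \<noteq> 0" by (metis lookup_zero)
  moreover have "var i * g \<in> forms (Suc k)" using forms_mult[OF var_in_forms g(1)] by simp
  ultimately show ?case by (metis (mono_tags, lifting) mem_Collect_eq mq_def mult.assoc)
qed

lemma saturated_mq: "saturated (mq \<pi> c)"
  unfolding saturated_def using extend_nonmember by blast

text \<open>This supplies quartic monomials outside an ideal from linear ones; they are the pivots
  of Grassmannian charts.\<close>

lemma extend_monomial:
  assumes "c m \<noteq> 0" shows "\<exists>n. mon_degree n = k \<and> c (n + m) \<noteq> 0"
proof (induction k)
  case 0
  then show ?case using assms by (intro exI[of _ 0]) simp
next
  case (Suc k)
  then obtain n where n: "mon_degree n = k" "c (n + m) \<noteq> 0" by blast
  then obtain i where "\<mu> i (\<pi> (n + m)) \<noteq> 0" using extend by blast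
  then have "c (single i 1 + (n + m)) \<noteq> 0" using c_step n by simp
  then show ?case using n by (intro exI[of _ "single i 1 + n"]) (simp add: mon_degree_add add.assoc)
qed

end

text \<open>The weight is a function of the class, so the torus only rescales each coefficient of
  the image by a nonzero power of t.\<close>

lemma torus_act_mq:
  assumes W: "\<And>m. c m \<noteq> 0 \<Longrightarrow> mon_weight m = W (\<pi> m)" and t: "t \<noteq> 0"
  shows "torus_act t (mq \<pi> c) = mq \<pi> c"
proof -
  have "lookup (qmap \<pi> c (torus_pullback t f)) p = t powi W p * lookup (qmap \<pi> c f) p" for f p
  proof -
    have "keys (torus_pullback t f) \<subseteq> keys f" using t by (auto simp: in_keys_iff lookup_torus_pullback)
    moreover have "c m * lookup (torus_pullback t f) m = t powi W (\<pi> m) * (c m * lookup f m)" for m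
      using W[of m] t by (cases "c m = 0") (simp_all add: lookup_torus_pullback)
    ultimately show ?thesis
      by (simp add: lookup_qmap_superset[of "keys f"] sum_distrib_left) (intro sum.cong, auto)
  qed
  then have "qmap \<pi> c (torus_pullback t f) = 0 \<longleftrightarrow> qmap \<pi> c f = 0" for f
    using t by (simp add: poly_mapping_eq_iff fun_eq_iff)
  then show ?thesis by (simp add: torus_act_def mq_def)
qed

section \<open>Dimensions modulo an ideal\<close>

text \<open>The quotient is realized inside the same vector space: extend a basis of
  \<open>W\<close>, send \<open>W\<close> to 0 and fix the added basis vectors. Dimensions modulo
  \<open>W\<close> become dimensions of images.\<close>

lemma ex_quotient_map:
  assumes W: "vec.subspace W"
  shows "\<exists>T :: ('b \<Rightarrow>\<^sub>0 complex) \<Rightarrow> ('b \<Rightarrow>\<^sub>0 complex). linear_map T \<and> (\<forall>v. T v = 0 \<longleftrightarrow> v \<in> W)"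
proof -
  obtain A where A: "A \<subseteq> W" "vec.independent A" "W \<subseteq> vec.span A"
    using vec.basis_exists[of W] by metis
  obtain A' where A': "A \<subseteq> A'" "vec.independent A'" "UNIV \<subseteq> vec.span A'"
    using vec.maximal_independent_subset_extend[OF subset_UNIV A(2)] by metis
  obtain T where T: "linear_map T" "\<And>x. x \<in> A' \<Longrightarrow> T x = (if x \<in> A then 0 else x)"
    using vec_pair.linear_independent_extend[OF A'(2), of "\<lambda>x. if x \<in> A then 0 else x"] by metis
  interpret T: Vector_Spaces.linear vscale vscale T by (rule T)
  have sA: "vec.span A = W" using A W by (intro vec.span_subspace)
  have TA: "T v = 0" if "v \<in> W" for v
  proof -
    have "T x = 0" if "x \<in> A" for x using that T(2) A'(1) by auto
    then show ?thesis using T.eq_0_on_span[of A v] \<open>v \<in> W\<close> sA by blast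
  qed
  have TC: "T v = v" if "v \<in> vec.span (A' - A)" for v
    using that
  proof (induction rule: vec.span_induct)
    case base
    show ?case using T.subspace_kernel by (auto intro!: vec.subspaceI simp: T.add T.scale)
  next
    case (step x) then show ?case using T(2)[of x] by auto
  qed
  show ?thesis
  proof (intro exI[of _ T] conjI T(1) allI)
    fix v
    have "A \<union> (A' - A) = A'" using A'(1) by auto
    then have "vec.span A' = {x + y |x y. x \<in> vec.span A \<and> y \<in> vec.span (A' - A)}"
      using vec.span_Un[of A "A' - A"] by (simp only:)
    then have "v \<in> {x + y |x y. x \<in> vec.span A \<and> y \<in> vec.span (A' - A)}"
      using A'(3) by blast
    then obtain x y where xy: "v = x + y" "x \<in> W" "y \<in> vec.span (A' - A)" using sA by auto
    then have "T v = y" using TA TC by (simp add: T.add)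
    then show "T v = 0 \<longleftrightarrow> v \<in> W" using xy TA by auto
  qed
qed

lemma hilbert_function_eq_dim:
  fixes I :: "('i::finite) cpoly set"
  assumes T: "linear_map T" "\<And>v. T v = 0 \<longleftrightarrow> v \<in> I"
  shows "hilbert_function I k = int (vec.dim (T ` forms k))"
proof -
  have "vec.dim (forms k :: 'i cpoly set) = vec.dim (T ` forms k) + vec.dim {v \<in> forms k. T v = 0}"
    by (rule rank_nullity[OF T(1), of _ "monomials k"]) (simp_all add: finite_monomials, simp add: forms_def)
  moreover have "{v \<in> forms k. T v = 0} = I \<inter> forms k" using T by auto
  ultimately show ?thesis by (simp add: hilbert_function_def)
qed

text \<open>If \<open>B\<close> already spans the forms of degree k modulo \<open>I\<close>, only
  the relations among the elements of \<open>B\<close> have to be counted.\<close>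

lemma hilbert_function_eq_spanning:
  fixes I :: "('i::finite) cpoly set"
  assumes I: "vec.subspace I" and B: "B \<subseteq> monomials k"
    and spans: "\<And>m. mon_degree m = k \<Longrightarrow> \<exists>g\<in>coord_space B. single m 1 - g \<in> I"
  shows "hilbert_function I k = int (card B) - int (vec.dim (I \<inter> coord_space B))"
proof -
  obtain T :: "'i cpoly \<Rightarrow> 'i cpoly" where T: "linear_map T" "\<And>v. T v = 0 \<longleftrightarrow> v \<in> I"
    using ex_quotient_map[OF I] by auto
  interpret T: Vector_Spaces.linear vscale vscale T by (rule T)
  have fin: "finite B" by (rule finite_subset[OF B finite_monomials])
  have "T v \<in> T ` coord_space B" if "v \<in> forms k" for v
  proof -
    have sub: "vec.subspace (T ` coord_space B)" by (rule T.subspace_image) simp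
    have "T (single m 1) \<in> T ` coord_space B" if "m \<in> keys v" for m
    proof -
      have "mon_degree m = k" using that \<open>v \<in> forms k\<close> by (auto simp: forms_def coord_space_def monomials_def)
      then obtain g where "g \<in> coord_space B" "single m 1 - g \<in> I" using spans by blast
      then show ?thesis using T by (metis T.diff imageI right_minus_eq)
    qed
    then have "(\<Sum>m\<in>keys v. vscale (lookup v m) (T (single m 1))) \<in> T ` coord_space B"
      using sub by (intro vec.subspace_sum vec.subspace_scale) auto
    moreover have "T v = T (\<Sum>m\<in>keys v. single m (lookup v m))" by (rule arg_cong[OF sum_singles])
    ultimately show ?thesis by (simp add: T.sum flip: T.scale)
  qed
  moreover have "coord_space B \<subseteq> forms k" unfolding forms_def by (rule coord_space_mono[OF B])
  ultimately have "T ` forms k = T ` coord_space B" by auto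
  moreover have "vec.dim (coord_space B) = vec.dim (T ` coord_space B) + vec.dim {v \<in> coord_space B. T v = 0}"
    by (rule rank_nullity[OF T(1), of _ B]) (simp_all add: fin)
  moreover have "{v \<in> coord_space B. T v = 0} = I \<inter> coord_space B" using T by auto
  ultimately show ?thesis by (simp add: hilbert_function_eq_dim[OF T] dim_coord_space fin)
qed

subsection \<open>Weight components\<close>

text \<open>Applying T minus the eigenvalue of one summand removes that summand and rescales the
  others by nonzero numbers.\<close>

lemma eigenvector_components:
  assumes T: "linear_map T" and I: "vec.subspace I" "\<And>f. f \<in> I \<Longrightarrow> T f \<in> I"
    and W: "finite W" "inj_on l W" "\<And>w. w \<in> W \<Longrightarrow> T (F w) = vscale (l w) (F w)" "(\<Sum>w\<in>W. F w) \<in> I"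
  shows "\<forall>w\<in>W. F w \<in> I"
  using W
proof (induction W arbitrary: F rule: finite_induct)
  case (insert w0 W)
  interpret T: Vector_Spaces.linear vscale vscale T by (rule T)
  let ?s = "\<Sum>w\<in>insert w0 W. F w"
  have "T ?s - vscale (l w0) ?s \<in> I"
    using insert.prems I by (intro vec.subspace_diff vec.subspace_scale) auto
  moreover have "T ?s - vscale (l w0) ?s = (\<Sum>w\<in>W. vscale (l w - l w0) (F w))"
    using insert.prems(2) insert.hyps
    by (simp add: T.sum T.add vec.scale_right_distrib vec.scale_sum_right vec.scale_left_diff_distrib sum_subtractf)
  ultimately have s: "(\<Sum>w\<in>W. vscale (l w - l w0) (F w)) \<in> I" by simp
  have "\<forall>w\<in>W. vscale (l w - l w0) (F w) \<in> I"
  proof (rule insert.IH)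
    show "inj_on l W" using insert.prems(1) by auto
    show "T (vscale (l w - l w0) (F w)) = vscale (l w) (vscale (l w - l w0) (F w))" if "w \<in> W" for w
      using that insert.prems(2) by (simp add: T.scale mult.commute)
  qed (rule s)
  then have FW: "F w \<in> I" if "w \<in> W" for w
  proof -
    have "l w \<noteq> l w0"
    proof
      assume "l w = l w0"
      then have "w = w0" using inj_onD[OF insert.prems(1), of w w0] that by simp
      then show False using insert.hyps(2) that by simp
    qed
    moreover have "vscale (inverse (l w - l w0)) (vscale (l w - l w0) (F w)) \<in> I"
      by (rule vec.subspace_scale[OF I(1)]) (use \<open>\<forall>w\<in>W. _\<close> that in blast)
    ultimately show ?thesis by simp
  qed
  have "?s - (\<Sum>w\<in>W. F w) \<in> I"
    by (rule vec.subspace_diff[OF I(1) insert.prems(3) vec.subspace_sum[OF I(1) FW]])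
  then show ?case using FW insert.hyps by simp
qed simp

lemma mon_weight_superset:
  "finite S \<Longrightarrow> keys m \<subseteq> S \<Longrightarrow> mon_weight m = (\<Sum>i\<in>S. weight i * int (lookup m i))"
  unfolding mon_weight_def by (rule sum.mono_neutral_left) (auto simp: in_keys_iff)

lemma mon_weight_add: "mon_weight (m + n) = mon_weight m + mon_weight n"
proof -
  have "keys (m + n) \<subseteq> keys m \<union> keys n" by (rule keys_add)
  then show ?thesis
    by (simp add: mon_weight_superset[of "keys m \<union> keys n"] lookup_add sum.distrib distrib_left)
qed

lemma mon_weight_single [simp]: "mon_weight (single i k) = weight i * int k"
  by (simp add: mon_weight_def)

abbreviation wcomp :: "int \<Rightarrow> pluecker cpoly \<Rightarrow> pluecker cpoly" where
  "wcomp w \<equiv> vproj {m. mon_weight m = w}"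

lemma sum_wcomp:
  assumes "finite W" "mon_weight ` keys f \<subseteq> W"
  shows "f = (\<Sum>w\<in>W. wcomp w f)"
proof (rule poly_mapping_eqI)
  fix m
  have "(\<Sum>w\<in>W. lookup (wcomp w f) m) = (\<Sum>w\<in>W. if w = mon_weight m then lookup f m else 0)"
    by (intro sum.cong) auto
  also have "\<dots> = lookup f m" using assms by (auto simp: sum.delta in_keys_iff image_subset_iff)
  finally show "lookup f m = lookup (\<Sum>w\<in>W. wcomp w f) m" by (simp add: lookup_sum)
qed

lemma torus_pullback_linear: "t \<noteq> 0 \<Longrightarrow> linear_map (torus_pullback t)"
  by (rule linear_mapI; rule poly_mapping_eqI)
    (simp_all add: lookup_torus_pullback lookup_add distrib_left mult.left_commute)

lemma wcomp_in_ideal: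
  assumes I: "vec.subspace I" and inv: "\<And>t. t \<noteq> 0 \<Longrightarrow> torus_act t I = I" and f: "f \<in> I"
  shows "wcomp w f \<in> I"
proof -
  let ?W = "mon_weight ` keys f"
  \<comment> \<open>The single torus element 2 suffices: its powers separate all integer
    weights.\<close>
  have "\<forall>w\<in>?W. wcomp w f \<in> I"
  proof (rule eigenvector_components[of "torus_pullback 2" I ?W "\<lambda>w. 2 powi w"])
    show "torus_pullback 2 g \<in> I" if "g \<in> I" for g
      using inv[of 2] that by (auto simp: torus_act_def)
    show "inj_on (\<lambda>w. 2 powi w :: complex) ?W"
    proof (rule inj_onI)
      fix x y :: int assume "(2::complex) powi x = 2 powi y"
      then have "complex_of_real (2 powi x) = complex_of_real (2 powi y)" by simp
      then have "(2::real) powi x = 2 powi y" using of_real_eq_iff by blast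
      then show "x = y" by (metis less_irrefl linorder_neqE power_int_strict_increasing one_less_numeral_iff semiring_norm(76))
    qed
    show "(\<Sum>w\<in>?W. wcomp w f) \<in> I" using f by (simp flip: sum_wcomp[of ?W f])
    show "torus_pullback 2 (wcomp w f) = vscale (2 powi w) (wcomp w f)" for w
      by (rule poly_mapping_eqI) (simp add: lookup_torus_pullback)
  qed (use I in \<open>simp_all add: torus_pullback_linear\<close>)
  moreover have "wcomp w f = 0" if "w \<notin> ?W"
    using that by (intro poly_mapping_eqI) (auto simp: in_keys_iff)
  ultimately show ?thesis using vec.subspace_0[OF I] by (cases "w \<in> ?W") auto
qed

lemma wcomp_var: "wcomp w (var i * f) = var i * wcomp (w - weight i) f"
proof (rule poly_mapping_eqI)
  fix m
  show "lookup (wcomp w (var i * f)) m = lookup (var i * wcomp (w - weight i) f) m"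
  proof (cases "\<exists>n. m = single i 1 + n")
    case True
    then obtain n where m: "m = single i 1 + n" by blast
    show ?thesis unfolding m
      by (simp only: lookup_vproj lookup_single_times mem_Collect_eq mon_weight_add mon_weight_single) auto
  next
    case False
    then have "lookup (var i * g) m = 0" for g by (intro lookup_single_times_outside) auto
    then show ?thesis by simp
  qed
qed

lemma wcomp_sum: "wcomp w (\<Sum>x\<in>A. f x) = (\<Sum>x\<in>A. wcomp w (f x))"
  by (rule poly_mapping_eqI) (simp add: lookup_sum)

text \<open>An order on the variables induces a linear order on exponent vectors that is compatible
  with addition, hence a monomial order for the leading monomials below.\<close>

instantiation pluecker :: linorder
begin

fun pluecker_rank :: "pluecker \<Rightarrow> nat" where
  "pluecker_rank P3_1 = 0"
| "pluecker_rank P3_m1 = 1"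
| "pluecker_rank P3_m3 = 2"
| "pluecker_rank P1_m1 = 3"
| "pluecker_rank P1_m3 = 4"
| "pluecker_rank Pm1_m3 = 5"

definition "(i::pluecker) \<le> j \<longleftrightarrow> pluecker_rank i \<le> pluecker_rank j"
definition "(i::pluecker) < j \<longleftrightarrow> pluecker_rank i < pluecker_rank j"

instance
proof
  fix x y :: pluecker
  show "x \<le> y \<Longrightarrow> y \<le> x \<Longrightarrow> x = y"
    by (cases x; cases y) (simp_all add: less_eq_pluecker_def)
qed (auto simp: less_eq_pluecker_def less_pluecker_def)

end

lemma UNIV_pluecker: "UNIV = {P3_1, P3_m1, P3_m3, P1_m1, P1_m3, Pm1_m3}"
  using pluecker.exhaust by auto

instance pluecker :: finite
  by standard (simp add: UNIV_pluecker)

subsection \<open>Monomial order ideals with at most two elements in some degree\<close>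

text \<open>Dividing each monomial of \<open>M\<close> by its variable of largest exponent is an
  injection into \<open>N\<close>. If m = x_i n and m' = x_j n collided, each would have another
  divisor in \<open>N\<close> besides n; with only two elements in \<open>N\<close> these divisors
  agree, but their exponents of x_i differ. In degree 1 the bound fails: x and y give x^2, x y,
  y^2.\<close>

lemma order_ideal_two_elements:
  fixes N M :: "('i \<Rightarrow>\<^sub>0 nat) set"
  assumes N: "finite N" "card N \<le> 2" and k: "k \<ge> 2"
    and M: "\<And>m. m \<in> M \<Longrightarrow> mon_degree m = Suc k"
    and step: "\<And>m i. m \<in> M \<Longrightarrow> i \<in> keys m \<Longrightarrow> m - single i 1 \<in> N"
  shows "finite M" "card M \<le> card N"
proof -
  have "\<exists>i\<in>keys m. \<forall>j. lookup m j \<le> lookup m i" if "m \<in> M" for m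
  proof -
    have ne: "keys m \<noteq> {}" using M[OF that] by auto
    have "Max (lookup m ` keys m) \<in> lookup m ` keys m" using ne by simp
    then obtain i where i: "i \<in> keys m" "lookup m i = Max (lookup m ` keys m)" by auto
    have "lookup m j \<le> lookup m i" for j
      using i(2) by (cases "j \<in> keys m") (simp_all add: in_keys_iff)
    then show ?thesis using i by blast
  qed
  then obtain g where g: "\<And>m. m \<in> M \<Longrightarrow> g m \<in> keys m \<and> (\<forall>j. lookup m j \<le> lookup m (g m))"
    by metis
  let ?r = "\<lambda>m. m - single (g m) 1"
  have "inj_on ?r M"
  proof (rule inj_onI, rule ccontr)
    fix m m' assume mm: "m \<in> M" "m' \<in> M" "?r m = ?r m'" "m \<noteq> m'"
    define i j n where "i = g m" "j = g m'" "n = ?r m"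
    have m: "m = single i 1 + n" and m': "m' = single j 1 + n"
      using monomial_split[of i m] monomial_split[of j m'] g mm by (auto simp: i_j_n_def)
    have ij: "i \<noteq> j" using m m' mm by auto
    have "mon_degree m = 1 + mon_degree n"
      using arg_cong[OF m, of mon_degree] by (simp only: mon_degree_add mon_degree_single)
    then have n: "mon_degree n = k" "n \<in> N"
      using M[OF mm(1)] step[OF mm(1), of "g m"] g[OF mm(1)] by (simp_all add: i_j_n_def)
    \<comment> \<open>Otherwise n is the k-th power of x_b, and then x_b rather than x_b' has the
      largest exponent in y = x_b' n, because k is at least 2.\<close>
    have other: "\<exists>a\<in>keys x. a \<noteq> b"
      if "x \<in> M" "y \<in> M" "x = single b 1 + n" "y = single b' 1 + n" "b \<noteq> b'" "b' = g y" for x y b b'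
    proof (rule ccontr)
      assume "\<not> ?thesis"
      then have "keys x \<subseteq> {b}" by auto
      moreover have "keys n \<subseteq> keys x" using that(3) by (auto simp: in_keys_iff lookup_add)
      ultimately have kn: "keys n \<subseteq> {b}" by auto
      then have nb: "lookup n b = k" using n by (simp add: mon_degree_superset[of "{b}"])
      have "lookup n b' = 0" using kn that(5) by (auto simp: in_keys_iff)
      then have "lookup y b' = 1" "lookup y b = k"
        using that(4,5) nb by (simp_all add: lookup_add lookup_single when_def)
      moreover have "lookup y b \<le> lookup y b'" using g[OF that(2)] that(6) by blast
      ultimately show False using k by simp
    qed
    obtain a where a: "a \<in> keys m" "a \<noteq> i"
      using other[OF mm(1,2) m m' ij] i_j_n_def by auto
    obtain b where b: "b \<in> keys m'" "b \<noteq> j"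
      using other[OF mm(2,1) m' m] ij i_j_n_def by auto
    define u v where "u = m - single a 1" "v = m' - single b 1"
    have u: "m = single a 1 + u" "u \<in> N" and v: "m' = single b 1 + v" "v \<in> N"
      using monomial_split[OF a(1)] monomial_split[OF b(1)] step a b mm by (auto simp: u_v_def)
    have "lookup m a = lookup u a + 1" "lookup m a = lookup n a"
      using arg_cong[OF u(1), of "\<lambda>z. lookup z a"] arg_cong[OF m, of "\<lambda>z. lookup z a"] a(2)
      by (simp_all add: lookup_add lookup_single when_def)
    then have un: "u \<noteq> n" by auto
    have "lookup m' b = lookup v b + 1" "lookup m' b = lookup n b"
      using arg_cong[OF v(1), of "\<lambda>z. lookup z b"] arg_cong[OF m', of "\<lambda>z. lookup z b"] b(2)
      by (simp_all add: lookup_add lookup_single when_def)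
    then have vn: "v \<noteq> n" by auto
    have "u = v"
    proof (rule ccontr)
      assume "u \<noteq> v"
      then have "card {n, u, v} = 3" using un vn by auto
      moreover have "{n, u, v} \<subseteq> N" using u v n by auto
      ultimately show False using N card_mono[of N "{n, u, v}"] by simp
    qed
    have "lookup u i = lookup n i + 1"
      using arg_cong[OF trans[OF m[symmetric] u(1)], of "\<lambda>z. lookup z i"] a(2)
      by (simp add: lookup_add lookup_single when_def)
    moreover have "lookup v i \<le> lookup n i"
      using arg_cong[OF trans[OF m'[symmetric] v(1)], of "\<lambda>z. lookup z i"] ij
      by (simp add: lookup_add lookup_single when_def)
    ultimately show False using \<open>u = v\<close> by simp
  qed
  moreover have "?r ` M \<subseteq> N" using step g by auto
  ultimately show "finite M" "card M \<le> card N"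
    using N(1) by (auto intro: inj_on_finite card_inj_on_le)
qed

subsection \<open>The Hilbert function of a torus-fixed cubic\<close>

text \<open>On the hyperplane \<open>P3_m3\<close> is three times \<open>P1_m1\<close>, so these
  five are homogeneous coordinates of the ambient projective 4-space.\<close>

definition coords :: "pluecker set" where
  "coords = {P3_1, P3_m1, P1_m1, P1_m3, Pm1_m3}"

definition linear_form :: "pluecker cpoly" where
  "linear_form = (\<Sum>i\<in>coords. var i)"

lemma pv_eq_var: "pv i = var i"
  by (simp add: pv_def)

lemma three_times_var: "3 * var i = single (single i 1) (3::complex)"
proof -
  have "3 * var i = single 0 3 * (var i :: 'a cpoly)" by simp
  also have "\<dots> = single (single i 1) 3" by (simp only: mult_single) simp
  finally show ?thesis .
qed

lemma dim_zero [simp]: "vec.dim {0} = 0"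
  unfolding vec.span_empty[symmetric] vec.dim_span
  by (simp only: vec.dim_eq_card_independent[OF vec.independent_empty] card.empty)

lemma dim_pos:
  assumes "vec.subspace W" "W \<subseteq> coord_space B" "finite B" "f \<in> W" "f \<noteq> 0"
  shows "vec.dim W \<ge> 1"
proof -
  have "vec.dim {f} = 1" using assms(5) vec.dim_eq_card_independent[of "{f}"] by simp
  then have "vec.dim (vec.span {f}) = 1" by simp
  moreover have "vec.span {f} \<subseteq> W" using assms by (intro vec.span_minimal) auto
  ultimately show ?thesis using dim_subset_coord[OF _ assms(1) _ assms(2,3), of "vec.span {f}"] by simp
qed

lemma degree_one: "mon_degree m = 1 \<Longrightarrow> \<exists>i. m = single i 1"
proof -
  assume m: "mon_degree m = 1"
  then have "m \<noteq> 0" by auto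
  then obtain i where "i \<in> keys m" using keys_eq_empty by blast
  then have s: "m = single i 1 + (m - single i 1)" by (rule monomial_split)
  then have "mon_degree m = 1 + mon_degree (m - single i 1)"
    using mon_degree_add[of "single i 1" "m - single i 1"] by simp
  then have "m - single i 1 = 0" using m mon_degree_eq_0 by auto
  then show ?thesis using s by (metis add.right_neutral)
qed

locale fixed_cubic =
  fixes I :: "pluecker cpoly set"
  assumes fixed: "I \<in> fixed_locus 3"
begin

lemma hilb: "homogeneous_ideal I" "saturated I" "quadric_ideal \<subseteq> I"
    "\<forall>\<^sub>F k in sequentially. hilbert_function I k = 3 * int k + 1"
  using fixed by (simp_all add: fixed_locus_def hilb_def)

lemma ideal: "is_ideal I"
  using hilb(1) by (simp add: homogeneous_ideal_def)

lemma sub: "vec.subspace I"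
  using ideal by (rule ideal_subspace)

lemma times_in: "f \<in> I \<Longrightarrow> g * f \<in> I"
  using ring_mod.subspace_scale[OF ideal] .

lemma wcomp_in: "f \<in> I \<Longrightarrow> wcomp w f \<in> I"
  using fixed by (intro wcomp_in_ideal[OF sub]) (auto simp: fixed_locus_def)

lemma z_rel: "var P3_m3 - 3 * var P1_m1 \<in> I"
  using hilb(3) ring_mod.span_base[of "pv P3_m3 - 3 * pv P1_m1"]
  unfolding quadric_ideal_def pv_eq_var by blast

lemma q_rel: "var P3_1 * var Pm1_m3 - var P3_m1 * var P1_m3 + var P3_m3 * var P1_m1 \<in> I"
  using hilb(3) ring_mod.span_base[of "pv P3_1 * pv Pm1_m3 - pv P3_m1 * pv P1_m3 + pv P3_m3 * pv P1_m1"]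
  unfolding quadric_ideal_def pv_eq_var by blast

text \<open>Saturation tested on linear forms; the omitted coordinate is recovered through the
  hyperplane equation.\<close>

lemma in_if_vars_times_in:
  assumes "\<And>i. i \<in> coords \<Longrightarrow> var i * f \<in> I"
  shows "f \<in> I"
proof -
  have z: "var P3_m3 * f \<in> I"
  proof -
    have "f * (var P3_m3 - 3 * var P1_m1) + 3 * (var P1_m1 * f) \<in> I"
      by (rule vec.subspace_add[OF sub times_in[OF z_rel] times_in[OF assms]]) (simp add: coords_def)
    moreover have "f * (var P3_m3 - 3 * var P1_m1) + 3 * (var P1_m1 * f) = var P3_m3 * f"
      by (simp only: right_diff_distrib mult.commute mult.left_commute mult.assoc) simp
    ultimately show ?thesis by simp
  qed
  have v: "var i * f \<in> I" for i
    using z assms by (cases i) (simp_all add: coords_def)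
  have "g * f \<in> I" if "g \<in> forms 1" for g
  proof -
    have "single m x * f \<in> I" if m: "mon_degree m = 1" for m x
    proof -
      obtain i where mi: "m = single i 1" using degree_one[OF m] by blast
      have "vscale x (var i * f) \<in> I" using v sub by (rule vec.subspace_scale[rotated])
      moreover have "vscale x (var i * f) = single m x * f"
        unfolding mi vscale_eq_times mult.assoc[symmetric] mult_single by simp
      ultimately show ?thesis by simp
    qed
    then have "(\<Sum>m\<in>keys g. single m (lookup g m) * f) \<in> I" using that
      by (intro vec.subspace_sum[OF sub]) (auto simp: forms_def coord_space_def monomials_def)
    then show ?thesis by (simp only: sum_distrib_right[symmetric] sum_singles[symmetric])
  qed
  then show ?thesis using hilb(2) unfolding saturated_def by blast
qed

text \<open>Induction on the number of weight components of \<open>f\<close> outside \<open>I\<close>: the coordinate \<open>y\<close> of largest weight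
  multiplies the top one into \<open>I\<close>, so \<open>y f\<close> has fewer of them.\<close>

lemma nonzerodivisor_step:
  assumes y: "y \<in> coords" "y \<notin> S" "\<And>i. i \<in> coords \<Longrightarrow> i \<noteq> y \<Longrightarrow> i \<notin> S \<Longrightarrow> weight i < weight y"
    and S: "S \<subseteq> coords"
    and IH: "\<And>f. (\<And>i. i \<in> insert y S \<Longrightarrow> var i * f \<in> I) \<Longrightarrow> linear_form * f \<in> I \<Longrightarrow> f \<in> I"
    and f: "\<And>i. i \<in> S \<Longrightarrow> var i * f \<in> I" "linear_form * f \<in> I"
  shows "f \<in> I"
  using f
proof (induction "card {w. wcomp w f \<notin> I}" arbitrary: f rule: less_induct)
  case less
  let ?Z = "\<lambda>f. {w. wcomp w f \<notin> I}"
  have fin: "finite (?Z g)" for g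
  proof (rule finite_subset)
    show "?Z g \<subseteq> mon_weight ` keys g"
    proof
      fix w assume "w \<in> ?Z g"
      then have "wcomp w g \<noteq> 0" using vec.subspace_0[OF sub] by auto
      then obtain m where "lookup (wcomp w g) m \<noteq> 0" by (metis lookup_zero poly_mapping_eqI)
      then show "w \<in> mon_weight ` keys g" by (auto simp: in_keys_iff split: if_splits)
    qed
  qed simp
  show ?case
  proof (cases "?Z f = {}")
    case True
    have "(\<Sum>w\<in>mon_weight ` keys f. wcomp w f) \<in> I"
      using True by (intro vec.subspace_sum[OF sub]) auto
    then show ?thesis by (simp flip: sum_wcomp)
  next
    case False
    define w where "w = Max (?Z f)"
    have w: "w \<in> ?Z f" using False fin[of f] Max_in unfolding w_def by blast
    have above: "wcomp w' f \<in> I" if "w < w'" for w'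
      using Max_ge[OF fin[of f], of w'] that unfolding w_def by fastforce
    let ?g = "\<lambda>i. var i * wcomp (w + weight y - weight i) f"
    have "(\<Sum>i\<in>coords. ?g i) \<in> I"
      using wcomp_in[OF less.prems(2), of "w + weight y"]
      by (simp add: linear_form_def sum_distrib_right wcomp_sum wcomp_var del: One_nat_def)
    moreover have "?g i \<in> I" if "i \<in> coords - {y}" for i
    proof (cases "i \<in> S")
      case True
      then have "wcomp (w + weight y) (var i * f) \<in> I" by (intro wcomp_in less.prems(1))
      then show ?thesis by (simp add: wcomp_var del: One_nat_def)
    next
      case False
      then have "w < w + weight y - weight i" using y that by auto
      then show ?thesis by (intro times_in above)
    qed
    then have "(\<Sum>i\<in>coords - {y}. ?g i) \<in> I" by (intro vec.subspace_sum[OF sub])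
    ultimately have "(\<Sum>i\<in>coords. ?g i) - (\<Sum>i\<in>coords - {y}. ?g i) \<in> I"
      by (rule vec.subspace_diff[OF sub])
    then have top: "var y * wcomp w f \<in> I"
      using y(1) by (simp add: sum.remove[of coords y])
    have sub_Z: "?Z (var y * f) \<subseteq> (\<lambda>w'. w' + weight y) ` (?Z f - {w})"
    proof
      fix w' assume "w' \<in> ?Z (var y * f)"
      then have n: "var y * wcomp (w' - weight y) f \<notin> I" by (simp add: wcomp_var del: One_nat_def)
      then have "wcomp (w' - weight y) f \<notin> I" using times_in by blast
      moreover have "w' - weight y \<noteq> w" using n top by auto
      ultimately have "w' - weight y \<in> ?Z f - {w}" by simp
      then show "w' \<in> (\<lambda>w'. w' + weight y) ` (?Z f - {w})" by (intro image_eqI[of _ _ "w' - weight y"]) auto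
    qed
    have "card (?Z (var y * f)) \<le> card (?Z f - {w})"
      using card_mono[OF _ sub_Z] card_image_le[of "?Z f - {w}" "\<lambda>w'. w' + weight y"] fin[of f]
      by (meson finite_Diff finite_imageI order_trans)
    also have "\<dots> < card (?Z f)" using w fin[of f] by (intro psubset_card_mono) auto
    finally have lt: "card (?Z (var y * f)) < card (?Z f)" .
    have "var y * f \<in> I"
    proof (rule less.hyps[OF lt])
      show "var i * (var y * f) \<in> I" if "i \<in> S" for i
        using times_in[OF less.prems(1)[OF that], of "var y"] by (simp only: mult.left_commute)
      show "linear_form * (var y * f) \<in> I"
        using times_in[OF less.prems(2), of "var y"] by (simp only: mult.left_commute)
    qed
    then show ?thesis using less.prems by (intro IH[of f]) (blast intro: less.prems)+
  qed
qed

text \<open>For \<open>S\<close> consisting of all five coordinates the claim \<open>Cl S\<close> is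
  saturation. The coordinates are then dropped from \<open>S\<close> in order of increasing weight,
  so that the one being dropped always has the largest weight among those outside
  \<open>S\<close>.\<close>

lemma nonzerodivisor:
  assumes f: "linear_form * f \<in> I" shows "f \<in> I"
proof -
  define Cl where "Cl S \<longleftrightarrow> (\<forall>f. (\<forall>i\<in>S. var i * f \<in> I) \<longrightarrow> linear_form * f \<in> I \<longrightarrow> f \<in> I)" for S
  have step: "Cl S"
    if "Cl (insert y S)" "y \<in> coords" "y \<notin> S" "\<forall>i\<in>coords. i \<noteq> y \<longrightarrow> i \<notin> S \<longrightarrow> weight i < weight y" "S \<subseteq> coords"
    for y S
    unfolding Cl_def
  proof (intro allI impI)
    fix f assume "\<forall>i\<in>S. var i * f \<in> I" "linear_form * f \<in> I"
    with that show "f \<in> I" by (intro nonzerodivisor_step[of y S f]) (simp_all only: Cl_def, blast+)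
  qed
  have "Cl {Pm1_m3, P1_m3, P1_m1, P3_m1, P3_1}"
    unfolding Cl_def using in_if_vars_times_in by (auto simp: coords_def)
  then have "Cl {P1_m3, P1_m1, P3_m1, P3_1}" by (rule step) (simp_all add: coords_def)
  then have "Cl {P1_m1, P3_m1, P3_1}" by (rule step) (simp_all add: coords_def)
  then have "Cl {P3_m1, P3_1}" by (rule step) (simp_all add: coords_def)
  then have "Cl {P3_1}" by (rule step) (simp_all add: coords_def)
  then have "Cl {}" by (rule step) (simp_all add: coords_def)
  then show ?thesis using f by (simp add: Cl_def)
qed

section \<open>The hyperplane section and its standard monomials\<close>

text \<open>The degree k part of the ideal generated by \<open>I\<close> and
  \<open>linear_form\<close>. This reading requires k \<ge> 1, because of the truncated k -
  1.\<close>

definition section_space :: "nat \<Rightarrow> pluecker cpoly set" where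
  "section_space k = {f + linear_form * h | f h. f \<in> I \<inter> forms k \<and> h \<in> forms (k - 1)}"

lemma linear_form_in_forms: "linear_form \<in> forms 1"
  unfolding linear_form_def by (rule vec.subspace_sum) (simp_all only: subspace_forms var_in_forms)

lemma section_space_subset: "k \<ge> 1 \<Longrightarrow> section_space k \<subseteq> forms k"
proof
  fix g assume k: "k \<ge> 1" and "g \<in> section_space k"
  then obtain f h where g: "g = f + linear_form * h" "f \<in> forms k" "h \<in> forms (k - 1)"
    unfolding section_space_def by blast
  have "linear_form * h \<in> forms (1 + (k - 1))" by (rule forms_mult[OF linear_form_in_forms g(3)])
  then have "linear_form * h \<in> forms k" using k by simp
  then show "g \<in> forms k" using g by (simp add: vec.subspace_add)
qed

lemma subspace_section_space: "vec.subspace (section_space k)"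
proof (rule vec.subspaceI)
  have "0 + linear_form * 0 \<in> section_space k"
    unfolding section_space_def using vec.subspace_0[OF sub] vec.subspace_0[OF subspace_forms] by blast
  then show "0 \<in> section_space k" by simp
next
  fix x y assume "x \<in> section_space k" "y \<in> section_space k"
  then obtain f h f' h' where "x = f + linear_form * h" "f \<in> I \<inter> forms k" "h \<in> forms (k - 1)"
    "y = f' + linear_form * h'" "f' \<in> I \<inter> forms k" "h' \<in> forms (k - 1)"
    unfolding section_space_def by blast
  moreover have "f + linear_form * h + (f' + linear_form * h') = (f + f') + linear_form * (h + h')"
    by (simp add: algebra_simps)
  ultimately show "x + y \<in> section_space k"
    unfolding section_space_def using vec.subspace_add[OF sub] vec.subspace_add[OF subspace_forms] by blast
next
  fix c x assume "x \<in> section_space k"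
  then obtain f h where "x = f + linear_form * h" "f \<in> I \<inter> forms k" "h \<in> forms (k - 1)"
    unfolding section_space_def by blast
  moreover have "vscale c (f + linear_form * h) = vscale c f + linear_form * vscale c h"
    by (simp only: vec.scale_right_distrib mult_vscale)
  ultimately show "vscale c x \<in> section_space k"
    unfolding section_space_def using vec.subspace_scale[OF sub] vec.subspace_scale[OF subspace_forms] by blast
qed

lemma var_times_section_space:
  assumes "g \<in> section_space k" "k \<ge> 1" shows "var i * g \<in> section_space (Suc k)"
proof -
  obtain f h where g: "g = f + linear_form * h" "f \<in> I" "f \<in> forms k" "h \<in> forms (k - 1)"
    using assms(1) unfolding section_space_def by blast
  have "var i * g = var i * f + linear_form * (var i * h)"
    unfolding g(1) by (simp only: distrib_left mult.left_commute)
  moreover have "var i * f \<in> I \<inter> forms (Suc k)" using forms_mult[OF var_in_forms g(3)] times_in[OF g(2)] by simp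
  moreover have "var i * h \<in> forms (Suc k - 1)" using forms_mult[OF var_in_forms g(4)] assms(2) by simp
  ultimately show ?thesis unfolding section_space_def by blast
qed

text \<open>Since \<open>linear_form\<close> is a nonzerodivisor, multiplication by it embeds degree
  k of the coordinate ring in degree k + 1; the cokernel is the coordinate ring of the hyperplane
  section.\<close>

lemma dim_section_space:
  "int (card (monomials (Suc k) :: (pluecker \<Rightarrow>\<^sub>0 nat) set)) - int (vec.dim (section_space (Suc k)))
    = hilbert_function I (Suc k) - hilbert_function I k"
proof -
  obtain T :: "pluecker cpoly \<Rightarrow> pluecker cpoly" where T: "linear_map T" "\<And>v. T v = 0 \<longleftrightarrow> v \<in> I"
    using ex_quotient_map[OF sub] by auto
  interpret T: Vector_Spaces.linear vscale vscale T by (rule T)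
  let ?J = "section_space (Suc k)"
  let ?T = "\<lambda>h. T (linear_form * h)"
  have "?J \<subseteq> coord_space (monomials (Suc k))"
    using section_space_subset[of "Suc k"] by (simp add: forms_def)
  then have 1: "vec.dim ?J = vec.dim (T ` ?J) + vec.dim {v \<in> ?J. T v = 0}"
    by (rule rank_nullity[OF T(1) subspace_section_space _ finite_monomials])
  have "{v \<in> ?J. T v = 0} = I \<inter> forms (Suc k)"
  proof
    show "{v \<in> ?J. T v = 0} \<subseteq> I \<inter> forms (Suc k)" using T(2) section_space_subset[of "Suc k"] by auto
    show "I \<inter> forms (Suc k) \<subseteq> {v \<in> ?J. T v = 0}"
    proof
      fix f assume f: "f \<in> I \<inter> forms (Suc k)"
      then have "f + linear_form * 0 \<in> ?J"
        unfolding section_space_def using vec.subspace_0[OF subspace_forms] by blast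
      then show "f \<in> {v \<in> ?J. T v = 0}" using f T(2) by simp
    qed
  qed
  moreover have "T ` ?J = ?T ` forms k"
  proof
    show "T ` ?J \<subseteq> ?T ` forms k"
    proof
      fix v assume "v \<in> T ` ?J"
      then obtain f h where "v = T (f + linear_form * h)" "f \<in> I" "h \<in> forms k"
        unfolding section_space_def by auto
      then show "v \<in> ?T ` forms k" using T(2)[of f] by (auto simp: T.add)
    qed
    show "?T ` forms k \<subseteq> T ` ?J"
    proof
      fix v assume "v \<in> ?T ` forms k"
      then obtain h where h: "v = T (0 + linear_form * h)" "h \<in> forms k" by auto
      have "0 + linear_form * h \<in> ?J"
        unfolding section_space_def using h(2) vec.subspace_0[OF sub] vec.subspace_0[OF subspace_forms, of "Suc k"]
        by (metis (mono_tags, lifting) CollectI IntI diff_Suc_1)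
      then show "v \<in> T ` ?J" using h(1) by blast
    qed
  qed
  moreover have "vec.dim (forms k :: pluecker cpoly set) = vec.dim (?T ` forms k) + vec.dim {h \<in> forms k. ?T h = 0}"
  proof -
  have lin: "linear_map ?T"
    by (rule linear_mapI) (simp_all only: distrib_left T.add mult_vscale T.scale)
  have "(forms k :: pluecker cpoly set) \<subseteq> coord_space (monomials k)" by (simp add: forms_def)
  then show "vec.dim (forms k :: pluecker cpoly set) = vec.dim (?T ` forms k) + vec.dim {h \<in> forms k. ?T h = 0}"
    by (rule rank_nullity[OF lin subspace_forms _ finite_monomials])
  qed
  moreover have "{h \<in> forms k. ?T h = 0} = I \<inter> forms k"
  proof -
    have "?T h = 0 \<longleftrightarrow> h \<in> I" for h using T(2) nonzerodivisor times_in by blast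
    then show ?thesis by auto
  qed
  ultimately show ?thesis using 1
    by (simp add: hilbert_function_def dim_forms)
qed

text \<open>Their residues are a basis of the coordinate ring of the hyperplane section in degree k,
  so their number is a first difference of the Hilbert function.\<close>

definition standard_monomials :: "nat \<Rightarrow> (pluecker \<Rightarrow>\<^sub>0 nat) set" where
  "standard_monomials k = monomials k - leads (\<lambda>m. m) (section_space k)"

lemma finite_standard_monomials [simp]: "finite (standard_monomials k)"
  by (simp add: standard_monomials_def finite_monomials)

lemma card_standard_monomials:
  "int (card (standard_monomials (Suc k))) = hilbert_function I (Suc k) - hilbert_function I k"
proof -
  let ?J = "section_space (Suc k)"
  have s: "?J \<subseteq> coord_space (monomials (Suc k))"
    using section_space_subset[of "Suc k"] by (simp add: forms_def)
  have "vec.dim ?J = card (leads (\<lambda>m. m) ?J)"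
    by (rule dim_leads[OF subspace_section_space s finite_monomials inj_on_id2])
  moreover have l: "leads (\<lambda>m. m) ?J \<subseteq> monomials (Suc k)" by (rule leads_subset[OF s])
  moreover have "card (leads (\<lambda>m. m) ?J) \<le> card (monomials (Suc k) :: (pluecker \<Rightarrow>\<^sub>0 nat) set)"
    by (rule card_mono[OF finite_monomials l])
  moreover have "finite (leads (\<lambda>m. m) ?J)" by (rule finite_subset[OF l finite_monomials])
  ultimately have "int (card (standard_monomials (Suc k)))
      = int (card (monomials (Suc k) :: (pluecker \<Rightarrow>\<^sub>0 nat) set)) - int (vec.dim ?J)"
    by (simp only: standard_monomials_def card_Diff_subset of_nat_diff)
  then show ?thesis using dim_section_space[of k] by simp
qed

lemma standard_monomials_step:
  assumes m: "m \<in> standard_monomials (Suc k)" "i \<in> keys m" and k: "k \<ge> 1"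
  shows "m - single i 1 \<in> standard_monomials k"
proof -
  let ?n = "m - single i 1"
  have mn: "m = single i 1 + ?n" by (rule monomial_split[OF m(2)])
  have "mon_degree m = Suc k" using m(1) by (simp add: standard_monomials_def monomials_def)
  then have "mon_degree ?n = k"
    using arg_cong[OF mn, of mon_degree] by (simp only: mon_degree_add mon_degree_single)
  moreover have "?n \<notin> leads (\<lambda>m. m) (section_space k)"
  proof
    assume "?n \<in> leads (\<lambda>m. m) (section_space k)"
    then obtain f where f: "f \<in> section_space k" "?n \<in> keys f" "\<forall>m'\<in>keys f. m' \<le> ?n"
      unfolding leads_def by blast
    have "lookup (var i * f) m \<noteq> 0"
      using f(2) lookup_single_times[of "single i 1" 1 f ?n] mn by (simp add: in_keys_iff)
    then have "m \<in> keys (var i * f)" by (simp add: in_keys_iff)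
    moreover have "m' \<le> m" if "m' \<in> keys (var i * f)" for m'
    proof -
      have "m' \<in> {a + b |a b. a \<in> keys (var i :: pluecker cpoly) \<and> b \<in> keys f}"
        using keys_mult[of "var i" f] that by blast
      then obtain b where b: "b \<in> keys f" "m' = single i 1 + b" by auto
      then have "m' \<le> single i 1 + ?n" using f(3) by (simp add: add_left_mono)
      then show ?thesis using mn by simp
    qed
    moreover have "var i * f \<in> section_space (Suc k)" by (rule var_times_section_space[OF f(1) k])
    ultimately have "m \<in> leads (\<lambda>m. m) (section_space (Suc k))" unfolding leads_def by blast
    then show False using m(1) by (simp add: standard_monomials_def)
  qed
  ultimately show ?thesis by (simp add: standard_monomials_def monomials_def)
qed

text \<open>At most two standard monomials in a degree k \<ge> 2 would mean at most two in all
  higher degrees, but the differences of 3 k + 1 are 3.\<close>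

lemma three_standard_monomials:
  assumes k: "k \<ge> 2" shows "card (standard_monomials k) \<ge> 3"
proof (rule ccontr)
  assume "\<not> ?thesis"
  then have c: "card (standard_monomials k) \<le> 2" by simp
  have le: "card (standard_monomials (k + j)) \<le> 2" for j
  proof (induction j)
    case (Suc j)
    have "card (standard_monomials (Suc (k + j))) \<le> card (standard_monomials (k + j))"
    proof (rule order_ideal_two_elements(2)[OF finite_standard_monomials Suc.IH])
      show "mon_degree m = Suc (k + j)" if "m \<in> standard_monomials (Suc (k + j))" for m
        using that by (simp add: standard_monomials_def monomials_def)
      show "m - single i 1 \<in> standard_monomials (k + j)"
        if "m \<in> standard_monomials (Suc (k + j))" "i \<in> keys m" for m i
        using standard_monomials_step[OF that] k by simp
    qed (use k in simp)
    then show ?case using Suc.IH by simp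
  qed (use c in simp)
  obtain K where K: "\<And>k. k \<ge> K \<Longrightarrow> hilbert_function I k = 3 * int k + 1"
    using hilb(4) unfolding eventually_sequentially by blast
  have "int (card (standard_monomials (Suc (k + K)))) = 3"
    unfolding card_standard_monomials using K[of "Suc (k + K)"] K[of "k + K"] by simp
  then show False using le[of "Suc K"] by simp
qed

lemma hilbert_function_growth:
  assumes "k \<ge> 1" shows "hilbert_function I (k + j) \<ge> hilbert_function I k + 3 * int j"
proof (induction j)
  case (Suc j)
  have "hilbert_function I (Suc (k + j)) - hilbert_function I (k + j) \<ge> 3"
    using three_standard_monomials[of "Suc (k + j)"] assms card_standard_monomials[of "k + j"] by simp
  then show ?case using Suc.IH by simp
qed simp

text \<open>An excess over 3 k + 1 would persist in all higher degrees by
  \<open>hilbert_function_growth\<close>, including those where equality is known.\<close>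

lemma hilbert_function_le:
  assumes "k \<ge> 1" shows "hilbert_function I k \<le> 3 * int k + 1"
proof -
  obtain K where K: "\<And>k. k \<ge> K \<Longrightarrow> hilbert_function I k = 3 * int k + 1"
    using hilb(4) unfolding eventually_sequentially by blast
  show ?thesis using hilbert_function_growth[OF assms, of K] K[of "k + K"] by simp
qed

lemma one_notin: "1 \<notin> I"
proof
  assume "1 \<in> I"
  then have "g \<in> I" for g using times_in[of 1 g] by simp
  then have "hilbert_function I k = 0" for k by (simp add: hilbert_function_def Int_absorb1 subsetI)
  then show False using hilbert_function_growth[of 1 1] by simp
qed

lemma hilbert_function_0: "hilbert_function I 0 = 1"
proof -
  have "hilbert_function I 0 = int (card {0 :: pluecker \<Rightarrow>\<^sub>0 nat}) - int (vec.dim (I \<inter> coord_space {0}))"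
  proof (rule hilbert_function_eq_spanning[OF sub])
    show "\<exists>g\<in>coord_space {0}. single m 1 - g \<in> I" if "mon_degree m = 0" for m
    proof
      show "single m 1 \<in> coord_space {0}"
        using mon_degree_eq_0[OF that] by (intro single_in_coord_space) simp
    qed (use vec.subspace_0[OF sub] in simp)
  qed (simp add: monomials_def)
  moreover have "I \<inter> coord_space {0} = {0}"
  proof -
    have "f = 0" if f: "f \<in> I" "f \<in> coord_space {0}" for f
    proof (rule ccontr)
      assume "f \<noteq> 0"
      define x where "x = lookup f 0"
      have fx: "f = single 0 x"
        using f(2) by (intro poly_mapping_eqI) (auto simp: in_coord_space lookup_single when_def x_def)
      then have "x \<noteq> 0" using \<open>f \<noteq> 0\<close> by auto
      then have "vscale (1 / x) f = 1" unfolding fx by simp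
      then show False using one_notin vec.subspace_scale[OF sub f(1), of "1 / x"] by simp
    qed
    then show ?thesis using vec.subspace_0[OF sub] by (auto simp: in_coord_space)
  qed
  ultimately show ?thesis by simp
qed

section \<open>Linear and quadratic forms modulo the ideal\<close>

definition survivors :: "pluecker set" where
  "survivors = {i \<in> coords. var i \<notin> I}"

definition survivor_monomials :: "(pluecker \<Rightarrow>\<^sub>0 nat) set" where
  "survivor_monomials = (\<lambda>i. single i 1) ` survivors"

definition reduce_var :: "pluecker \<Rightarrow> pluecker cpoly" where
  "reduce_var i = (if i = P3_m3 then (if P1_m1 \<in> survivors then single (single P1_m1 1) 3 else 0)
     else if i \<in> survivors then var i else 0)"

lemma survivors_cases: "i = P3_m3 \<or> i \<in> survivors \<or> (i \<in> coords \<and> var i \<in> I)"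
  by (cases i) (auto simp: survivors_def coords_def)

lemma reduce_var_coord: "reduce_var i \<in> coord_space survivor_monomials"
  by (auto simp: reduce_var_def survivor_monomials_def intro!: single_in_coord_space vec.subspace_0)

lemma reduce_var_cong: "var i - reduce_var i \<in> I"
proof (cases "i = P3_m3")
  case True
  show ?thesis
  proof (cases "P1_m1 \<in> survivors")
    case True
    then show ?thesis using z_rel \<open>i = P3_m3\<close> by (simp add: reduce_var_def three_times_var[unfolded One_nat_def])
  next
    case False
    then have "var P1_m1 \<in> I" by (simp add: survivors_def coords_def)
    then have "(var P3_m3 - 3 * var P1_m1) + 3 * var P1_m1 \<in> I"
      by (intro vec.subspace_add[OF sub z_rel] times_in)
    then show ?thesis using False \<open>i = P3_m3\<close> by (simp add: reduce_var_def)
  qed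
next
  case False
  then show ?thesis using survivors_cases[of i] vec.subspace_0[OF sub]
    by (auto simp: reduce_var_def survivors_def)
qed

lemma inj_single: "inj (\<lambda>i. single i (1::nat))"
proof (rule injI)
  fix i j :: 'a assume "single i (1::nat) = single j 1"
  then have "keys (single i (1::nat)) = keys (single j (1::nat))" by simp
  then show "i = j" by simp
qed

text \<open>The survivors have distinct weights. So the weight components of a linear form in them
  are multiples of single coordinates, and if the form lies in \<open>I\<close>, so do
  these.\<close>

lemma hilbert_function_1: "hilbert_function I 1 = int (card survivors)"
proof -
  have "hilbert_function I 1
      = int (card survivor_monomials) - int (vec.dim (I \<inter> coord_space survivor_monomials))"
  proof (rule hilbert_function_eq_spanning[OF sub])
    show "survivor_monomials \<subseteq> monomials 1" by (auto simp: survivor_monomials_def monomials_def)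
    show "\<exists>g\<in>coord_space survivor_monomials. single m 1 - g \<in> I" if m: "mon_degree m = 1" for m
    proof -
      obtain i where "m = single i 1" using degree_one[OF m] by blast
      then show ?thesis using reduce_var_coord[of i] reduce_var_cong[of i] by blast
    qed
  qed
  moreover have "I \<inter> coord_space survivor_monomials = {0}"
  proof -
    have "f = 0" if f: "f \<in> I" "f \<in> coord_space survivor_monomials" for f
    proof (rule ccontr)
      assume "f \<noteq> 0"
      then obtain m where m: "lookup f m \<noteq> 0" by (metis lookup_zero poly_mapping_eqI)
      then have "m \<in> survivor_monomials" using f(2) unfolding in_coord_space by blast
      then obtain i where i: "i \<in> survivors" "m = single i 1" unfolding survivor_monomials_def by blast
      have "wcomp (weight i) f = single m (lookup f m)"
      proof (rule poly_mapping_eqI)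
        fix m'
        have "m' = m" if "lookup f m' \<noteq> 0" "mon_weight m' = weight i"
        proof -
          have "m' \<in> survivor_monomials" using f(2) that(1) unfolding in_coord_space by blast
          then obtain j where j: "j \<in> survivors" "m' = single j 1" unfolding survivor_monomials_def by blast
          then have "weight j = weight i" using that by simp
          then have "j = i" using i(1) j(1) by (cases i; cases j) (auto simp: survivors_def coords_def)
          then show ?thesis using i j by simp
        qed
        then show "lookup (wcomp (weight i) f) m' = lookup (single m (lookup f m)) m'"
          using i(2) by (auto simp: lookup_single when_def)
      qed
      then have "single m (lookup f m) \<in> I" using wcomp_in[OF f(1)] by metis
      then have "vscale (1 / lookup f m) (single m (lookup f m)) \<in> I" by (rule vec.subspace_scale[OF sub])
      then have "var i \<in> I" using m i(2) by simp
      then show False using i(1) by (simp add: survivors_def)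
    qed
    then show ?thesis using vec.subspace_0[OF sub] by (auto simp: in_coord_space)
  qed
  moreover have "card survivor_monomials = card survivors"
    unfolding survivor_monomials_def by (rule card_image) (rule inj_on_subset[OF inj_single subset_UNIV])
  ultimately show ?thesis by simp
qed

text \<open>With at most two survivors the hyperplane section has at most one standard monomial s of
  degree 1, hence at most the square of s in degree 2, where three are required.\<close>

lemma three_survivors: "card survivors \<ge> 3"
proof (rule ccontr)
  assume "\<not> ?thesis"
  then have "card (standard_monomials 1) \<le> 1"
    using card_standard_monomials[of 0] hilbert_function_0 hilbert_function_1 by simp
  then have u: "s = s'" if "s \<in> standard_monomials 1" "s' \<in> standard_monomials 1" for s s'
    using card_le_Suc0_iff_eq[OF finite_standard_monomials] that by auto
  have "m = m'" if mm: "m \<in> standard_monomials 2" "m' \<in> standard_monomials 2" for m m'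
  proof -
    have double: "x = s + s" if x: "x \<in> standard_monomials 2" and s: "s \<in> standard_monomials 1" for x s
    proof -
      have red: "x - single i 1 = s" if "i \<in> keys x" for i
        using u[OF standard_monomials_step s] that x by (simp add: numeral_2_eq_2)
      have "mon_degree s = 1" using s by (simp add: standard_monomials_def monomials_def)
      then obtain j where j: "s = single j 1" using degree_one by blast
      have "mon_degree x = 2" using x by (simp add: standard_monomials_def monomials_def)
      then have "keys x \<noteq> {}" by auto
      then obtain i where i: "i \<in> keys x" by blast
      have xi: "x = single i 1 + s" using monomial_split[OF i] red[OF i] by simp
      then have "j \<in> keys x" using j by (simp add: in_keys_iff lookup_add)
      then have "x = single j 1 + s" using monomial_split red by metis
      then show ?thesis using j by simp
    qed
    have "mon_degree m = 2" using mm by (simp add: standard_monomials_def monomials_def)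
    then have "keys m \<noteq> {}" by auto
    then obtain i where "i \<in> keys m" by blast
    then have "m - single i 1 \<in> standard_monomials 1"
      using standard_monomials_step[of m 1 i] mm by (simp add: numeral_2_eq_2)
    then show ?thesis using double mm by metis
  qed
  then have "card (standard_monomials 2) \<le> 1" by (simp add: card_le_Suc0_iff_eq)
  then show False using three_standard_monomials[of 2] by simp
qed

text \<open>Three survivors would put the curve in a plane. The plane is not contained in the
  quadric, so the equation of the quadric is a nontrivial relation among the six quadratic monomials
  and leaves at most 5 in degree 2, while growth by 3 requires at least 6.\<close>

lemma four_survivors: "card survivors = 4"
proof (rule ccontr)
  assume "card survivors \<noteq> 4"
  moreover have "card survivors \<le> 4" using hilbert_function_le[of 1] hilbert_function_1 by simp
  ultimately have three: "card survivors = 3" using three_survivors by simp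
  then obtain u v w where uvw: "survivors = {u, v, w}" by (auto simp: card_3_iff)
  define B where "B = (\<lambda>(i, j). single i 1 + single j (1::nat)) ` {(u, u), (u, v), (u, w), (v, v), (v, w), (w, w)}"
  have finB: "finite B" and "card B \<le> 6"
    using card_image_le[of "{(u, u), (u, v), (u, w), (v, v), (v, w), (w, w)}" "\<lambda>(i, j). single i 1 + single j (1::nat)"]
      card_length[of "[(u, u), (u, v), (u, w), (v, v), (v, w), (w, w)]"]
    by (auto simp: B_def)
  have B: "single i 1 + single j 1 \<in> B" if "i \<in> survivors" "j \<in> survivors" for i j
    using that by (auto simp: B_def uvw add.commute)
  have prod_B: "reduce_var i * reduce_var j \<in> coord_space B" for i j
  proof -
    have "keys (reduce_var i * reduce_var j) \<subseteq> {a + b |a b. a \<in> keys (reduce_var i) \<and> b \<in> keys (reduce_var j)}"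
      by (rule keys_mult)
    also have "\<dots> \<subseteq> B"
      using reduce_var_coord[of i] reduce_var_coord[of j] B
      by (auto simp: coord_space_def survivor_monomials_def subset_iff)
    finally show ?thesis by (simp add: coord_space_def)
  qed
  have prod_cong: "var i * var j - reduce_var i * reduce_var j \<in> I" for i j
  proof -
    have "var i * (var j - reduce_var j) + reduce_var j * (var i - reduce_var i) \<in> I"
      by (intro vec.subspace_add[OF sub] times_in reduce_var_cong)
    moreover have "var i * (var j - reduce_var j) + reduce_var j * (var i - reduce_var i)
        = var i * var j - reduce_var i * reduce_var j"
      by (simp only: right_diff_distrib mult.commute[of "reduce_var j"]) simp
    ultimately show ?thesis by simp
  qed
  have h2: "hilbert_function I 2 = int (card B) - int (vec.dim (I \<inter> coord_space B))"
  proof (rule hilbert_function_eq_spanning[OF sub])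
    show "B \<subseteq> monomials 2" by (auto simp: B_def monomials_def mon_degree_add)
    show "\<exists>g\<in>coord_space B. single m 1 - g \<in> I" if m: "mon_degree m = 2" for m
    proof -
      have "keys m \<noteq> {}" using m by auto
      then obtain i where i: "i \<in> keys m" by blast
      note ms = monomial_split[OF i]
      then have "mon_degree (m - single i 1) = 1"
        using m mon_degree_add[of "single i 1" "m - single i 1"] by simp
      then obtain j where "m - single i 1 = single j 1" using degree_one by blast
      then have "single m 1 = var i * var j" using ms by (simp add: mult_single)
      then show ?thesis using prod_B[of i j] prod_cong[of i j] by metis
    qed
  qed
  define q where "q = reduce_var P3_1 * reduce_var Pm1_m3 - reduce_var P3_m1 * reduce_var P1_m3
    + reduce_var P3_m3 * reduce_var P1_m1"
  have "(var P3_1 * var Pm1_m3 - var P3_m1 * var P1_m3 + var P3_m3 * var P1_m1)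
     - ((var P3_1 * var Pm1_m3 - reduce_var P3_1 * reduce_var Pm1_m3)
        - (var P3_m1 * var P1_m3 - reduce_var P3_m1 * reduce_var P1_m3)
        + (var P3_m3 * var P1_m1 - reduce_var P3_m3 * reduce_var P1_m1)) \<in> I"
    by (intro vec.subspace_add[OF sub] vec.subspace_diff[OF sub] q_rel prod_cong)
  then have qI: "q \<in> I" by (simp add: q_def algebra_simps)
  have qB: "q \<in> coord_space B"
    unfolding q_def
    by (intro vec.subspace_add[OF subspace_coord_space] vec.subspace_diff[OF subspace_coord_space] prod_B)
  \<comment> \<open>If \<open>q\<close> vanished, \<open>P1_m1\<close> and at least one coordinate
    of each pair \<open>P3_1\<close>, \<open>Pm1_m3\<close> and \<open>P3_m1\<close>,
    \<open>P1_m3\<close> would fail to survive, leaving at most two survivors.\<close>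
  have "q \<noteq> 0"
  proof
    assume "q = 0"
    have ne: "single i 1 + single j (1::nat) \<noteq> single k 1 + single l (1::nat)"
      if "i \<noteq> k" "i \<noteq> l" for i j k l :: pluecker
    proof
      assume "single i 1 + single j (1::nat) = single k 1 + single l (1::nat)"
      then have "lookup (single i 1 + single j (1::nat)) i = lookup (single k 1 + single l (1::nat)) i" by simp
      then show False using that by (simp add: lookup_add lookup_single when_def split: if_splits)
    qed
    let ?l = "\<lambda>i j. lookup q (single i 1 + single j 1)"
    have "\<not> (P3_1 \<in> survivors \<and> Pm1_m3 \<in> survivors)"
    proof
      assume "P3_1 \<in> survivors \<and> Pm1_m3 \<in> survivors"
      then have "?l P3_1 Pm1_m3 = 1"
        using ne[of P3_1 P3_m1 P1_m3] ne[of P3_1 P1_m1 P1_m1] ne[of P3_m1 P3_1 Pm1_m3] ne[of P1_m1 P3_1 Pm1_m3]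
        by (auto simp: q_def reduce_var_def mult_single lookup_add lookup_minus lookup_single when_def)
      then show False using \<open>q = 0\<close> by simp
    qed
    moreover have "\<not> (P3_m1 \<in> survivors \<and> P1_m3 \<in> survivors)"
    proof
      assume "P3_m1 \<in> survivors \<and> P1_m3 \<in> survivors"
      then have "?l P3_m1 P1_m3 = -1"
        using ne[of P3_1 P3_m1 P1_m3] ne[of P3_m1 P1_m1 P1_m1] ne[of P3_m1 P3_1 Pm1_m3] ne[of P1_m1 P3_m1 P1_m3]
        by (auto simp: q_def reduce_var_def mult_single lookup_add lookup_minus lookup_single when_def)
      then show False using \<open>q = 0\<close> by simp
    qed
    moreover have "P1_m1 \<notin> survivors"
    proof
      assume "P1_m1 \<in> survivors"
      then have "?l P1_m1 P1_m1 = 3"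
        using ne[of P3_1 P1_m1 P1_m1] ne[of P3_m1 P1_m1 P1_m1] ne[of P1_m1 P3_1 Pm1_m3] ne[of P1_m1 P3_m1 P1_m3]
        by (auto simp: q_def reduce_var_def mult_single lookup_add lookup_minus lookup_single when_def)
      then show False using \<open>q = 0\<close> by simp
    qed
    ultimately have "\<exists>x\<in>{P3_1, Pm1_m3}. \<exists>y\<in>{P3_m1, P1_m3}. survivors \<subseteq> coords - {x, y, P1_m1}"
      by (auto simp: survivors_def)
    then obtain x y where xy: "x \<in> {P3_1, Pm1_m3}" "y \<in> {P3_m1, P1_m3}" "survivors \<subseteq> coords - {x, y, P1_m1}" by blast
    then have "card survivors \<le> card (coords - {x, y, P1_m1})" by (intro card_mono) auto
    also have "\<dots> = 2" using xy(1,2) by (auto simp: coords_def insert_Diff_if)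
    finally show False using three by simp
  qed
  then have "vec.dim (I \<inter> coord_space B) \<ge> 1"
    using qI qB finB sub by (intro dim_pos[of _ B q] vec.subspace_inter) auto
  then have "hilbert_function I 2 \<le> 5" using h2 \<open>card B \<le> 6\<close> by simp
  then show False using hilbert_function_growth[of 1 1] hilbert_function_1 three by (simp add: numeral_2_eq_2)
qed

text \<open>The value 4 in degree 1 meets the upper bound, and growth by at least 3 keeps it
  there.\<close>

lemma hilbert_function_eq: "k \<ge> 1 \<Longrightarrow> hilbert_function I k = 3 * int k + 1"
  using hilbert_function_growth[of 1 "k - 1"] hilbert_function_le[of k] hilbert_function_1 four_survivors
  by simp

lemma ex_var: "\<exists>y\<in>coords. var y \<in> I"
proof (rule ccontr)
  assume "\<not> ?thesis"
  then have "survivors = coords" by (auto simp: survivors_def)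
  then show False using four_survivors by (simp add: coords_def)
qed

end

subsection \<open>The five torus-invariant hyperplane sections\<close>

definition lin :: "('i \<Rightarrow> nat) \<Rightarrow> ('i \<Rightarrow>\<^sub>0 nat) \<Rightarrow> nat" where
  "lin h m = (\<Sum>i\<in>keys m. lookup m i * h i)"

definition mon_prod :: "('i \<Rightarrow> complex) \<Rightarrow> ('i \<Rightarrow>\<^sub>0 nat) \<Rightarrow> complex" where
  "mon_prod g m = (\<Prod>i\<in>keys m. g i ^ lookup m i)"

lemma lin_superset: "finite S \<Longrightarrow> keys m \<subseteq> S \<Longrightarrow> lin h m = (\<Sum>i\<in>S. lookup m i * h i)"
  unfolding lin_def by (rule sum.mono_neutral_left) (auto simp: in_keys_iff)

lemma mon_prod_superset: "finite S \<Longrightarrow> keys m \<subseteq> S \<Longrightarrow> mon_prod g m = (\<Prod>i\<in>S. g i ^ lookup m i)"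
  unfolding mon_prod_def by (rule prod.mono_neutral_left) (auto simp: in_keys_iff)

lemma lin_add [simp]: "lin h (m + n) = lin h m + lin h n"
proof -
  have "keys (m + n) \<subseteq> keys m \<union> keys n" by (rule keys_add)
  then show ?thesis
    by (simp add: lin_superset[of "keys m \<union> keys n"] lookup_add sum.distrib distrib_right)
qed

lemma mon_prod_add [simp]: "mon_prod g (m + n) = mon_prod g m * mon_prod g n"
proof -
  have "keys (m + n) \<subseteq> keys m \<union> keys n" by (rule keys_add)
  then show ?thesis
    by (simp add: mon_prod_superset[of "keys m \<union> keys n"] lookup_add prod.distrib power_add)
qed

lemma lin_single [simp]: "lin h (single i n) = n * h i"
  by (simp add: lin_def)

lemma mon_prod_single [simp]: "mon_prod g (single i n) = g i ^ n"
  by (simp add: mon_prod_def)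

lemma lin_0 [simp]: "lin h 0 = 0"
  by (simp add: lin_def)

lemma mon_prod_0 [simp]: "mon_prod g 0 = 1"
  by (simp add: mon_prod_def)

text \<open>The section of the quadric by the hyperplane on which the coordinate \<open>y\<close> vanishes is the
  smooth quadric surface \<open>z\<^bsub>3,1\<^esub> z\<^bsub>-1,-3\<^esub> = z\<^bsub>3,-1\<^esub> z\<^bsub>1,-3\<^esub>\<close> if \<open>y\<close> is \<open>P1_m1\<close>, and otherwise the
  cone \<open>z\<^sub>p z\<^sub>q = \<kappa> z\<^bsub>1,-1\<^esub>\<^sup>2\<close> with apex the coordinate point \<open>v\<close>, where \<open>(v, p, q, \<kappa>)\<close> is
  \<open>(apex y, left y, right y, kappa y)\<close>.\<close>

fun apex :: "pluecker \<Rightarrow> pluecker" where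
  "apex P3_1 = Pm1_m3"
| "apex P1_m3 = P3_m1"
| "apex P3_m1 = P1_m3"
| "apex _ = P3_1"

fun left :: "pluecker \<Rightarrow> pluecker" where
  "left P3_1 = P1_m3"
| "left P1_m3 = P3_1"
| "left P3_m1 = Pm1_m3"
| "left _ = P3_m1"

fun right :: "pluecker \<Rightarrow> pluecker" where
  "right P3_1 = P3_m1"
| "right P1_m3 = Pm1_m3"
| "right P3_m1 = P3_1"
| "right _ = P1_m3"

definition kappa :: "pluecker \<Rightarrow> complex" where
  "kappa y = (if y \<in> {P1_m3, P3_m1} then -3 else 3)"

text \<open>\<open>row\<close> and \<open>col\<close> are exponents in a toric parametrization: of X
  and Y in (X'Y', XY', X'Y, XY) on the smooth surface, and of V and S on the cone, where the apex
  coordinate is V, \<open>left\<close> is S^2 and \<open>P1_m1\<close> is S T.\<close>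

definition row :: "pluecker \<Rightarrow> pluecker \<Rightarrow> nat" where
  "row y x = (if y = P1_m1 then (if x \<in> {P3_m1, Pm1_m3} then 1 else 0)
     else if x = apex y then 1 else 0)"

definition col :: "pluecker \<Rightarrow> pluecker \<Rightarrow> nat" where
  "col y x = (if y = P1_m1 then (if x \<in> {P1_m3, Pm1_m3} then 1 else 0)
     else if x = left y then 2 else if x \<in> {P1_m1, P3_m3} then 1 else 0)"

text \<open>The scalar in front of the toric monomial of the coordinate x: zero for the vanishing
  coordinate \<open>y\<close>, \<kappa> for \<open>right\<close> (which is \<kappa> T^2), and 3
  times the value at \<open>P1_m1\<close> for \<open>P3_m3\<close>.\<close>

definition unit_coef :: "pluecker \<Rightarrow> pluecker \<Rightarrow> complex" where
  "unit_coef y x = (if x = y then 0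
     else if y = P1_m1 then (if x = P3_m3 then 0 else 1)
     else if x = right y then kappa y else if x = P3_m3 then 3 else 1)"

definition position :: "pluecker \<Rightarrow> (pluecker \<Rightarrow>\<^sub>0 nat) \<Rightarrow> nat \<times> nat \<times> nat" where
  "position y m = (mon_degree m, lin (row y) m, lin (col y) m)"

definition coef :: "pluecker \<Rightarrow> (pluecker \<Rightarrow>\<^sub>0 nat) \<Rightarrow> complex" where
  "coef y = mon_prod (unit_coef y)"

definition shift :: "pluecker \<Rightarrow> pluecker \<Rightarrow> nat \<times> nat \<times> nat" where
  "shift y x = (1, row y x, col y x)"

text \<open>The k-th multiple of the polygon of the toric surface: the unit square for P^1 x P^1,
  the triangle with corners (0,0), (1,0), (0,2) for the quadric cone P(1,1,2).\<close>

definition polygon :: "pluecker \<Rightarrow> nat \<Rightarrow> (nat \<times> nat) set" where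
  "polygon y k = (if y = P1_m1 then {(i, j). i \<le> k \<and> j \<le> k} else {(i, j). 2 * i + j \<le> 2 * k})"

abbreviation surface_ideal :: "pluecker \<Rightarrow> pluecker cpoly set" where
  "surface_ideal y \<equiv> mq (position y) (coef y)"

lemma coords_cases:
  assumes "y \<in> coords"
  obtains "y = P1_m1" | "y = P3_1" | "y = P3_m1" | "y = P1_m3" | "y = Pm1_m3"
  using assms unfolding coords_def by blast

lemma position_step: "position y (single x 1 + m) = shift y x + position y m"
  by (simp add: position_def shift_def mon_degree_add)

lemma coef_step: "coef y (single x 1 + m) = unit_coef y x * coef y m"
  by (simp add: coef_def)

lemma in_polygon: "(lin (row y) m, lin (col y) m) \<in> polygon y (mon_degree m)"
proof (induction m rule: monomial_induct)
  case zero
  show ?case by (simp add: polygon_def)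
next
  case (step i m)
  have "row y i \<le> 1 \<and> col y i \<le> 1" if "y = P1_m1" using that by (simp add: row_def col_def)
  moreover have "2 * row y i + col y i \<le> 2" if "y \<noteq> P1_m1"
    using that by (cases y) (auto simp: row_def col_def)
  ultimately show ?case using step by (auto simp: polygon_def mon_degree_add split: if_splits)
qed

text \<open>The representative of a lattice point that avoids the product of \<open>P3_m1\<close>
  and \<open>P1_m3\<close> (smooth case) or the square of \<open>P1_m1\<close> (cone), the terms
  that the surface equation rewrites. On the polygon the truncated subtractions are exact.\<close>

definition normal_monomial :: "pluecker \<Rightarrow> nat \<Rightarrow> nat \<Rightarrow> nat \<Rightarrow> (pluecker \<Rightarrow>\<^sub>0 nat)" where
  "normal_monomial y k i j = (if y = P1_m1
     then single Pm1_m3 (min i j) + single P3_m1 (i - min i j) + single P1_m3 (j - min i j)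
       + single P3_1 (k - max i j)
     else single (apex y) i + single (left y) (j div 2) + single P1_m1 (j mod 2)
       + single (right y) (k - i - j div 2 - j mod 2))"

lemma normal_monomial:
  assumes y: "y \<in> coords" and ij: "(i, j) \<in> polygon y k"
  shows "position y (normal_monomial y k i j) = (k, i, j)" "coef y (normal_monomial y k i j) \<noteq> 0"
proof -
  have "j div 2 + j mod 2 + i \<le> k \<and> 2 * (j div 2) + j mod 2 = j" if "y \<noteq> P1_m1"
    using that ij by (simp add: polygon_def) presburger
  then show "position y (normal_monomial y k i j) = (k, i, j)" "coef y (normal_monomial y k i j) \<noteq> 0"
    using ij
    by (rule_tac coords_cases[OF y];
        auto simp: normal_monomial_def position_def mon_degree_add row_def col_def coef_def
          unit_coef_def kappa_def polygon_def min_def max_def)+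
qed

lemma classes_position:
  assumes y: "y \<in> coords"
  shows "classes (position y) (coef y) (monomials k) = Pair k ` polygon y k"
proof
  show "classes (position y) (coef y) (monomials k) \<subseteq> Pair k ` polygon y k"
    using in_polygon[of y] by (auto simp: classes_def position_def monomials_def)
  show "Pair k ` polygon y k \<subseteq> classes (position y) (coef y) (monomials k)"
  proof
    fix p assume "p \<in> Pair k ` polygon y k"
    then obtain i j where p: "p = (k, i, j)" "(i, j) \<in> polygon y k" by auto
    note n = normal_monomial[OF y p(2)]
    then have "normal_monomial y k i j \<in> monomials k" by (simp add: position_def monomials_def)
    then show "p \<in> classes (position y) (coef y) (monomials k)"
      unfolding classes_def using n p(1) by (intro image_eqI[of _ _ "normal_monomial y k i j"]) auto
  qed
qed

lemma surface_monomial_quotient: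
  assumes y: "y \<in> coords"
  shows "monomial_quotient (position y) (coef y) (shift y) (\<lambda>x _. unit_coef y x) fst"
proof
  show "\<exists>i. unit_coef y i \<noteq> 0"
    using y by (intro exI[of _ "if y = P1_m1 then P3_1 else P1_m1"]) (auto simp: unit_coef_def kappa_def coords_def)
qed (simp_all only: position_step coef_step, simp add: position_def)

lemma quadric_in_surface:
  assumes y: "y \<in> coords" shows "quadric_ideal \<subseteq> surface_ideal y"
proof -
  interpret monomial_quotient "position y" "coef y" "shift y" "\<lambda>x _. unit_coef y x" fst
    by (rule surface_monomial_quotient[OF y])
  have "qmap (position y) (coef y) (var P3_1 * var Pm1_m3 - var P3_m1 * var P1_m3 + var P3_m3 * var P1_m1) = 0"
    by (rule coords_cases[OF y])
      (simp_all add: qmap_add qmap_minus mult_single position_def mon_degree_add coef_def row_def col_def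
        unit_coef_def kappa_def numeral_2_eq_2 flip: single_add single_diff single_uminus)
  moreover have "qmap (position y) (coef y) (var P3_m3 - 3 * var P1_m1) = 0"
    unfolding three_times_var
    by (rule coords_cases[OF y])
      (simp_all add: qmap_add qmap_minus mult_single position_def mon_degree_add coef_def row_def col_def
        unit_coef_def kappa_def)
  ultimately show ?thesis
    unfolding quadric_ideal_def pv_eq_var by (intro ring_mod.span_minimal ideal_mq) (auto simp: mq_def)
qed

text \<open>The maps that define the curves factor through the map of the surface, so their kernels
  contain the ideal of the surface.\<close>

lemma qmap_factor:
  "qmap (\<lambda>m. \<tau> (\<pi> m)) (\<lambda>m. c m * \<phi> (\<pi> m)) f = qmap \<tau> \<phi> (qmap \<pi> c f)"
proof -
  have "qmap \<tau> \<phi> (qmap \<pi> c f) = (\<Sum>b\<in>keys f. qmap \<tau> \<phi> (single (\<pi> b) (c b * lookup f b)))"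
    by (simp only: qmap_def[of \<pi> c f] qmap_sum)
  then show ?thesis
    by (simp only: qmap_def[of "\<lambda>m. \<tau> (\<pi> m)" _ f] qmap_single mult.assoc mult.left_commute)
qed

lemma mq_factor: "mq \<pi> c \<subseteq> mq (\<lambda>m. \<tau> (\<pi> m)) (\<lambda>m. c m * \<phi> (\<pi> m))"
  by (auto simp: mq_def qmap_factor)

text \<open>On a cone S T has weight 0, so S and T have weights plus and minus half of
  \<open>weight (left y)\<close>; with exponents j and 2 k - 2 i - j this gives
  \<open>weight (left y) * (j + i - k)\<close>.\<close>

definition position_weight :: "pluecker \<Rightarrow> nat \<times> nat \<times> nat \<Rightarrow> int" where
  "position_weight y = (\<lambda>(k, i, j). if y = P1_m1 then 4 * int k - 2 * int i - 6 * int j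
     else int i * weight (apex y) + weight (left y) * (int j + int i - int k))"

lemma mon_weight_position:
  assumes y: "y \<in> coords"
  shows "coef y m \<noteq> 0 \<Longrightarrow> mon_weight m = position_weight y (position y m)"
proof (induction m rule: monomial_induct)
  case zero
  then show ?case by (simp add: mon_weight_def position_def position_weight_def)
next
  case (step x m)
  have "unit_coef y x \<noteq> 0" "coef y m \<noteq> 0" using step.prems coef_step[of y x m] by auto
  then show ?case using step.IH
    by (rule_tac coords_cases[OF y]; cases x)
      (simp_all add: mon_weight_add position_def position_weight_def unit_coef_def row_def col_def
        mon_degree_add algebra_simps)
qed

subsection \<open>The isolated points\<close>

type_synonym index = "pluecker \<times> nat \<times> nat \<times> nat \<times> nat"

text \<open>The surface is covered by an affine space with coordinates \<open>X, X', Y, Y'\<close> (smooth case) or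
  \<open>V, S, T\<close> (cone), on which \<open>z\<^bsub>3,1\<^esub>, z\<^bsub>3,-1\<^esub>, z\<^bsub>1,-3\<^esub>, z\<^bsub>-1,-3\<^esub>\<close> are \<open>X'Y', XY', X'Y, XY\<close>, respectively
  \<open>z\<^sub>v, z\<^sub>p, z\<^sub>c, z\<^sub>q\<close> are \<open>V, S\<^sup>2, ST, \<kappa>T\<^sup>2\<close>. The position \<open>(k, i, j)\<close> stands for the monomials
  \<open>X\<^sup>i X'\<^bsup>k-i\<^esup> Y\<^sup>j Y'\<^bsup>k-j\<^esup>\<close> and \<open>V\<^sup>i S\<^sup>j T\<^bsup>2k-2i-j\<^esup>\<close>, and the index \<open>(y, r, r', s, s')\<close> for the curve cut
  out by \<open>X\<^sup>r X'\<^bsup>r'\<^esup> Y\<^sup>s Y'\<^bsup>s'\<^esup>\<close> or \<open>V\<^sup>r S\<^sup>s T\<^bsup>s'\<^esup>\<close>. These have bidegree \<open>(1, 2)\<close> or \<open>(2, 1)\<close>, respectively degree 3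
  if \<open>V\<close> has degree 2.\<close>

definition divisible :: "index \<Rightarrow> nat \<times> nat \<times> nat \<Rightarrow> bool" where
  "divisible = (\<lambda>(y, r, r', s, s') (k, i, j). r \<le> i \<and> s \<le> j \<and>
     (if y = P1_m1 then i + r' \<le> k \<and> j + s' \<le> k else 2 * i + j + s' \<le> 2 * k))"

definition cone_exponents :: "(nat \<times> nat \<times> nat \<times> nat) set" where
  "cone_exponents = {(0,0,0,3), (0,0,1,2), (0,0,2,1), (0,0,3,0), (1,0,0,1), (1,0,1,0)}"

definition smooth_exponents :: "(nat \<times> nat \<times> nat \<times> nat) set" where
  "smooth_exponents = {(1,0,2,0), (1,0,1,1), (1,0,0,2), (0,1,2,0), (0,1,1,1), (0,1,0,2),
     (2,0,1,0), (1,1,1,0), (0,2,1,0), (2,0,0,1), (1,1,0,1), (0,2,0,1)}"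

definition valid_index :: "index \<Rightarrow> bool" where
  "valid_index = (\<lambda>(y, g). y \<in> coords \<and> g \<in> (if y = P1_m1 then smooth_exponents else cone_exponents))"

definition point_coef :: "index \<Rightarrow> (pluecker \<Rightarrow>\<^sub>0 nat) \<Rightarrow> complex" where
  "point_coef g m = coef (fst g) m * (if divisible g (position (fst g) m) then 0 else 1)"

definition point :: "index \<Rightarrow> pluecker cpoly set" where
  "point g = mq (position (fst g)) (point_coef g)"

lemma divisible_mono:
  assumes "divisible g p" shows "divisible g (shift (fst g) x + p)"
proof -
  obtain y r r' s s' where g: "g = (y, r, r', s, s')" by (cases g)
  obtain k i j where p: "p = (k, i, j)" by (cases p)
  have "row y x \<le> 1 \<and> col y x \<le> 1" if "y = P1_m1" using that by (simp add: row_def col_def)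
  moreover have "2 * row y x + col y x \<le> 2" if "y \<noteq> P1_m1"
    using that by (cases y) (auto simp: row_def col_def)
  ultimately show ?thesis using assms
    by (cases "y = P1_m1") (auto simp: g p divisible_def shift_def)
qed

lemma point_monomial_quotient:
  assumes g: "valid_index g"
  shows "monomial_quotient (position (fst g)) (point_coef g) (shift (fst g))
    (\<lambda>x p. unit_coef (fst g) x * (if divisible g (shift (fst g) x + p) then 0 else 1)) fst"
proof
  let ?y = "fst g"
  have y: "?y \<in> coords" using g by (auto simp: valid_index_def split: prod.splits)
  fix m
  show "\<And>i. position ?y (single i 1 + m) = shift ?y i + position ?y m" by (rule position_step)
  show "\<And>i. point_coef g (single i 1 + m)
      = unit_coef ?y i * (if divisible g (shift ?y i + position ?y m) then 0 else 1) * point_coef g m"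
    using divisible_mono[of g "position ?y m"] by (simp add: point_coef_def position_step[unfolded One_nat_def] coef_step[unfolded One_nat_def])
  show "fst (position ?y m) = mon_degree m" by (simp add: position_def)
  assume "point_coef g m \<noteq> 0"
  then have nd: "\<not> divisible g (position ?y m)" by (auto simp: point_coef_def)
  obtain y r r' s s' where gg: "g = (y, r, r', s, s')" by (cases g)
  obtain k i j where p: "position ?y m = (k, i, j)" by (cases "position ?y m")
  have nd': "\<not> divisible (y, r, r', s, s') (k, i, j)" using nd gg p by simp
  \<comment> \<open>One toric exponent is too small for divisibility. It stays too small after
    multiplication by a coordinate free of that factor: \<open>P3_1\<close>, \<open>P3_m1\<close>,
    \<open>P1_m3\<close> are free of X and Y, of X', of Y'; \<open>right y\<close> is a multiple of
    T^2 and \<open>left y\<close> is S^2.\<close>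
  have "\<exists>x. unit_coef y x \<noteq> 0 \<and> \<not> divisible (y, r, r', s, s') (shift y x + (k, i, j))"
  proof (cases "y = P1_m1")
    case True
    then consider "i < r" | "j < s" | "k < i + r'" | "k < j + s'"
      using nd' by (auto simp: divisible_def not_le)
    then show ?thesis
    proof cases
      case 1 then show ?thesis
        using True by (intro exI[of _ P3_1]) (simp add: divisible_def shift_def unit_coef_def row_def)
    next
      case 2 then show ?thesis
        using True by (intro exI[of _ P3_1]) (simp add: divisible_def shift_def unit_coef_def col_def)
    next
      case 3 then show ?thesis
        using True by (intro exI[of _ P3_m1]) (simp add: divisible_def shift_def unit_coef_def row_def)
    next
      case 4 then show ?thesis
        using True by (intro exI[of _ P1_m3]) (simp add: divisible_def shift_def unit_coef_def col_def)
    qed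
  next
    case False
    have u: "unit_coef y (left y) \<noteq> 0" "unit_coef y (right y) \<noteq> 0" "row y (left y) = 0" "col y (left y) = 2"
      "row y (right y) = 0" "col y (right y) = 0"
      using y False by (cases y; simp add: gg coords_def unit_coef_def kappa_def row_def col_def)+
    consider "i < r" | "j < s" | "2 * k < 2 * i + j + s'"
      using nd' False by (auto simp: divisible_def not_le)
    then show ?thesis
    proof cases
      case 1 then show ?thesis
        using u False by (intro exI[of _ "right y"]) (simp add: divisible_def shift_def)
    next
      case 2 then show ?thesis
        using u False by (intro exI[of _ "right y"]) (simp add: divisible_def shift_def)
    next
      case 3 then show ?thesis
        using u False by (intro exI[of _ "left y"]) (simp add: divisible_def shift_def)
    qed
  qed
  then show "\<exists>x. unit_coef ?y x * (if divisible g (shift ?y x + position ?y m) then 0 else 1) \<noteq> 0"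
    using gg p by auto
qed

lemma card_interval: "card {j::nat. s \<le> j \<and> j + s' \<le> l} = l + 1 - (s + s')"
proof -
  have "{j::nat. s \<le> j \<and> j + s' \<le> l} = (if s' \<le> l then {s..l - s'} else {})" by auto
  then show ?thesis by auto
qed

lemma card_row:
  "card {j::nat. j \<le> l \<and> \<not> (P \<and> s \<le> j \<and> j + s' \<le> l)} = l + 1 - (if P then l + 1 - (s + s') else 0)"
proof (cases P)
  case True
  have "{j. j \<le> l \<and> \<not> (P \<and> s \<le> j \<and> j + s' \<le> l)} = {..l} - {j. s \<le> j \<and> j + s' \<le> l}"
    using True by auto
  moreover have "{j. s \<le> j \<and> j + s' \<le> l} \<subseteq> {..l}" by auto
  ultimately show ?thesis using True by (simp add: card_Diff_subset card_interval finite_subset[of _ "{..l}"])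
next
  case False
  then have "{j. j \<le> l \<and> \<not> (P \<and> s \<le> j \<and> j + s' \<le> l)} = {..l}" by auto
  then show ?thesis using False by simp
qed

lemma card_rows:
  fixes L :: "nat \<Rightarrow> nat"
  shows "card {(i, j). i \<le> k \<and> j \<le> L i \<and> \<not> (P i \<and> s \<le> j \<and> j + s' \<le> L i)}
    = (\<Sum>i\<le>k. L i + 1 - (if P i then L i + 1 - (s + s') else 0))"
proof -
  have "{(i, j). i \<le> k \<and> j \<le> L i \<and> \<not> (P i \<and> s \<le> j \<and> j + s' \<le> L i)}
      = (SIGMA i:{..k}. {j. j \<le> L i \<and> \<not> (P i \<and> s \<le> j \<and> j + s' \<le> L i)})" by auto
  moreover have "\<forall>i\<in>{..k}. finite {j. j \<le> L i \<and> \<not> (P i \<and> s \<le> j \<and> j + s' \<le> L i)}" by simp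
  ultimately show ?thesis by (simp only: card_SigmaI[OF finite_atMost] card_row)
qed

text \<open>Put a = r + r' and b = s + s'. Outside the multiples lie a full rows of k + 1 positions
  and b positions in each of the other k + 1 - a rows; the total (a + b)(k + 1) - a b is 3 k +
  1.\<close>

lemma card_smooth_complement:
  assumes "(r + r', s + s') \<in> {(1, 2), (2, 1)}" "k \<ge> 1"
  shows "card {(i, j). i \<le> k \<and> j \<le> k \<and> \<not> ((r \<le> i \<and> i + r' \<le> k) \<and> s \<le> j \<and> j + s' \<le> k)} = 3 * k + 1"
proof -
  have "(\<Sum>i\<le>k. k + 1 - (if r \<le> i \<and> i + r' \<le> k then k + 1 - (s + s') else 0))
      = (\<Sum>i\<le>k. if r \<le> i \<and> i + r' \<le> k then s + s' else k + 1)"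
    using assms by (intro sum.cong) auto
  also have "\<dots> = (s + s') * card ({..k} \<inter> {i. r \<le> i \<and> i + r' \<le> k})
      + (k + 1) * card ({..k} - {i. r \<le> i \<and> i + r' \<le> k})"
    by (simp add: sum.If_cases Diff_eq mult.commute)
  also have "{..k} \<inter> {i. r \<le> i \<and> i + r' \<le> k} = {i. r \<le> i \<and> i + r' \<le> k}" by auto
  also have "card ({..k} - {i. r \<le> i \<and> i + r' \<le> k}) = k + 1 - card {i. r \<le> i \<and> i + r' \<le> k}"
    by (subst card_Diff_subset) (auto intro: finite_subset[of _ "{..k}"])
  finally show ?thesis unfolding card_rows card_interval using assms by auto
qed

text \<open>Row i of the triangle has 2 (k - i) + 1 positions. For r = 0 every row has at most three
  nonmultiples, and only the last row has fewer, namely one. For r = 1 row 0 contains no multiples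
  and each later row has exactly one nonmultiple.\<close>

lemma card_cone_complement:
  assumes "2 * r + s + s' = 3"
  shows "card {(i, j). i \<le> k \<and> j \<le> 2 * (k - i) \<and> \<not> (r \<le> i \<and> s \<le> j \<and> j + s' \<le> 2 * (k - i))} = 3 * k + 1"
proof -
  have "r = 0 \<or> r = 1" using assms by auto
  then have "(\<Sum>i\<le>k. 2 * (k - i) + 1 - (if r \<le> i then 2 * (k - i) + 1 - (s + s') else 0)) = 3 * k + 1"
  proof
    assume r: "r = 0"
    have "(\<Sum>i\<le>k. 2 * (k - i) + 1 - (if r \<le> i then 2 * (k - i) + 1 - (s + s') else 0))
        = (\<Sum>i\<le>k. min 3 (2 * (k - i) + 1))"
      using assms r by (intro sum.cong) auto
    also have "\<dots> = (\<Sum>i\<le>k. min 3 (2 * i + 1))" by (rule sum.nat_diff_reindex[of "\<lambda>i. min 3 (2 * i + 1)" "Suc k", unfolded lessThan_Suc_atMost diff_Suc_Suc])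
    also have "\<dots> = 3 * k + 1" by (induction k) auto
    finally show ?thesis .
  next
    assume r: "r = 1"
    have "(\<Sum>i\<le>k. 2 * (k - i) + 1 - (if r \<le> i then 2 * (k - i) + 1 - (s + s') else 0))
        = (\<Sum>i\<le>k. if i = 0 then 2 * k + 1 else 1)"
      using assms r by (intro sum.cong) auto
    also have "\<dots> = (\<Sum>i\<le>k. 1 + (if i = 0 then 2 * k else 0))" by (intro sum.cong) auto
    also have "\<dots> = 3 * k + 1" by (simp only: sum.distrib) simp
    finally show ?thesis .
  qed
  then show ?thesis unfolding card_rows .
qed

lemma classes_point:
  assumes g: "valid_index g"
  shows "classes (position (fst g)) (point_coef g) (monomials k)
    = Pair k ` {(i, j) \<in> polygon (fst g) k. \<not> divisible g (k, i, j)}"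
proof -
  have y: "fst g \<in> coords" using g by (auto simp: valid_index_def split: prod.splits)
  have "classes (position (fst g)) (point_coef g) (monomials k)
      = {p \<in> classes (position (fst g)) (coef (fst g)) (monomials k). \<not> divisible g p}"
    by (auto simp: classes_def point_coef_def)
  also have "\<dots> = Pair k ` {(i, j) \<in> polygon (fst g) k. \<not> divisible g (k, i, j)}"
    unfolding classes_position[OF y] by auto
  finally show ?thesis .
qed

lemma card_classes_point:
  assumes g: "valid_index g" and k: "k \<ge> 1"
  shows "card (classes (position (fst g)) (point_coef g) (monomials k)) = 3 * k + 1"
proof -
  obtain y r r' s s' where gg: "g = (y, r, r', s, s')" by (cases g)
  have "card {(i, j) \<in> polygon y k. \<not> divisible g (k, i, j)} = 3 * k + 1"
  proof (cases "y = P1_m1")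
    case True
    then have "(r + r', s + s') \<in> {(1, 2), (2, 1)}"
      using g by (auto simp: gg valid_index_def smooth_exponents_def)
    then have "card {(i, j). i \<le> k \<and> j \<le> k \<and> \<not> ((r \<le> i \<and> i + r' \<le> k) \<and> s \<le> j \<and> j + s' \<le> k)} = 3 * k + 1"
      using k by (rule card_smooth_complement)
    moreover have "{(i, j) \<in> polygon y k. \<not> divisible g (k, i, j)}
        = {(i, j). i \<le> k \<and> j \<le> k \<and> \<not> ((r \<le> i \<and> i + r' \<le> k) \<and> s \<le> j \<and> j + s' \<le> k)}"
      using True by (auto simp: gg polygon_def divisible_def)
    ultimately show ?thesis by simp
  next
    case False
    then have "2 * r + s + s' = 3" using g by (auto simp: gg valid_index_def cone_exponents_def)
    then have "card {(i, j). i \<le> k \<and> j \<le> 2 * (k - i) \<and> \<not> (r \<le> i \<and> s \<le> j \<and> j + s' \<le> 2 * (k - i))} = 3 * k + 1"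
      by (rule card_cone_complement)
    moreover have "{(i, j) \<in> polygon y k. \<not> divisible g (k, i, j)}
        = {(i, j). i \<le> k \<and> j \<le> 2 * (k - i) \<and> \<not> (r \<le> i \<and> s \<le> j \<and> j + s' \<le> 2 * (k - i))}"
      using False by (auto simp: gg polygon_def divisible_def)
    ultimately show ?thesis by simp
  qed
  then show ?thesis unfolding classes_point[OF g] by (simp add: card_image inj_on_def gg)
qed

lemma mq_in_fixed_locus:
  assumes mq: "monomial_quotient \<pi> c \<epsilon> \<mu> d" and q: "quadric_ideal \<subseteq> mq \<pi> c"
    and card: "\<And>k. k \<ge> 1 \<Longrightarrow> card (classes \<pi> c (monomials k)) = 3 * k + 1"
    and W: "\<And>m. c m \<noteq> 0 \<Longrightarrow> mon_weight m = W (\<pi> m)"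
  shows "mq \<pi> c \<in> fixed_locus 3"
proof -
  interpret monomial_quotient \<pi> c \<epsilon> \<mu> d by (rule mq)
  have "\<forall>\<^sub>F k in sequentially. hilbert_function (mq \<pi> c) k = 3 * int k + 1"
    using eventually_ge_at_top[of 1] by eventually_elim (simp add: hilbert_function_mq card)
  then show ?thesis
    using homogeneous_mq saturated_mq q torus_act_mq[of c W \<pi>, OF W]
    by (simp add: fixed_locus_def hilb_def)
qed

lemma surface_subset_point: "surface_ideal (fst g) \<subseteq> point g"
  unfolding point_def point_coef_def[abs_def]
  by (rule mq_factor[of _ _ "\<lambda>p. p" "\<lambda>p. if divisible g p then 0 else 1"])

lemma point_in_fixed_locus:
  assumes g: "valid_index g" shows "point g \<in> fixed_locus 3"
proof -
  have y: "fst g \<in> coords" using g by (auto simp: valid_index_def split: prod.splits)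
  show ?thesis
    unfolding point_def
  proof (rule mq_in_fixed_locus[OF point_monomial_quotient[OF g] _ card_classes_point[OF g]])
    show "quadric_ideal \<subseteq> mq (position (fst g)) (point_coef g)"
      using quadric_in_surface[OF y] surface_subset_point[of g] unfolding point_def by blast
    show "mon_weight m = position_weight (fst g) (position (fst g) m)" if "point_coef g m \<noteq> 0" for m
      using that mon_weight_position[OF y, of m] by (simp add: point_coef_def)
  qed
qed

subsection \<open>The two families\<close>

text \<open>On the cone over the conic, the curve cut out by \<open>\<alpha> V T - \<beta> S\<^sup>3\<close>. Modulo its equation all monomials of
  degree \<open>k\<close> with the same value of \<open>3 i + j\<close> become proportional, with the factors \<open>family_factor\<close>.\<close>

definition family_class :: "nat \<times> nat \<times> nat \<Rightarrow> nat \<times> nat \<times> nat" where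
  "family_class = (\<lambda>(k, i, j). (k, 3 * i + j, 0))"

text \<open>Modulo the equation, V T counts as \<beta> and S^3 as \<alpha>. The exponents are the
  largest powers of S^3 and of V T that divide the monomial, as 2 k - (2 i + j) is its exponent of
  T.\<close>

definition family_factor :: "complex \<Rightarrow> complex \<Rightarrow> nat \<times> nat \<times> nat \<Rightarrow> complex" where
  "family_factor \<alpha> \<beta> = (\<lambda>(k, i, j). \<alpha> ^ (j div 3) * \<beta> ^ min i (2 * k - (2 * i + j)))"

definition family_position :: "pluecker \<Rightarrow> (pluecker \<Rightarrow>\<^sub>0 nat) \<Rightarrow> nat \<times> nat \<times> nat" where
  "family_position y m = family_class (position y m)"

definition family_coef :: "pluecker \<Rightarrow> complex \<Rightarrow> complex \<Rightarrow> (pluecker \<Rightarrow>\<^sub>0 nat) \<Rightarrow> complex" where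
  "family_coef y \<alpha> \<beta> m = coef y m * family_factor \<alpha> \<beta> (position y m)"

definition curve :: "pluecker \<Rightarrow> complex \<Rightarrow> complex \<Rightarrow> pluecker cpoly set" where
  "curve y \<alpha> \<beta> = mq (family_position y) (family_coef y \<alpha> \<beta>)"

text \<open>The cones on which V has four times the weight of S, so that V T and S^3 have the same
  weight.\<close>

definition ends :: "pluecker set" where
  "ends = {P3_1, Pm1_m3}"

lemma ends_coords: "y \<in> ends \<Longrightarrow> y \<in> coords \<and> y \<noteq> P1_m1"
  by (auto simp: ends_def coords_def)

text \<open>The multiplier has to be a function of the class (k, t). With w the exponent of T, t div
  3 = i + j div 3, and the truncated t - 2 k equals the truncated i - w, so that min i w = i - (t -
  2 k). The two exponents are the increments of j div 3 and min i w in these terms.\<close>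

definition family_mult :: "pluecker \<Rightarrow> complex \<Rightarrow> complex \<Rightarrow> pluecker \<Rightarrow> nat \<times> nat \<times> nat \<Rightarrow> complex" where
  "family_mult y \<alpha> \<beta> x = (\<lambda>(k, t, _). unit_coef y x
     * \<alpha> ^ ((t + 3 * row y x + col y x) div 3 - row y x - t div 3)
     * \<beta> ^ (row y x + (t - 2 * k) - (t + 3 * row y x + col y x - 2 * (k + 1))))"

lemma family_factor_step:
  assumes y: "y \<in> ends" and p: "2 * i + j \<le> 2 * k"
  shows "unit_coef y x * family_factor \<alpha> \<beta> (shift y x + (k, i, j))
    = family_mult y \<alpha> \<beta> x (family_class (k, i, j)) * family_factor \<alpha> \<beta> (k, i, j)"
proof -
  obtain w where w: "2 * k = 2 * i + j + w" using p le_Suc_ex by blast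
  have e: "2 * k - (2 * i + j) = w" "3 * i + j - 2 * k = i - w" unfolding w by simp_all
  \<comment> \<open>Apart from the vanishing coordinate, a variable contributes either one V, or n
    \<le> 2 factors S and 2 - n factors T.\<close>
  consider "x = y" | "row y x = 1" "col y x = 0" | "row y x = 0" "col y x \<le> 2"
    using y by (cases x) (auto simp: ends_def row_def col_def)
  moreover have ff: "family_factor \<alpha> \<beta> (k, i, j) = \<alpha> ^ (j div 3) * \<beta> ^ min i w"
    by (simp only: family_factor_def prod.case e)
  ultimately show ?thesis
  proof cases
    case 1
    then show ?thesis by (simp add: unit_coef_def family_mult_def family_class_def)
  next
    case 2
    have e': "2 * (k + 1) - (2 * (i + 1) + j) = w" "3 * i + j + 3 - 2 * (k + 1) = i + 1 - w"
      unfolding distrib_left w by simp_all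
    have "\<beta> ^ min (i + 1) w = \<beta> ^ (1 + (i - w) - (i + 1 - w)) * \<beta> ^ min i w"
      unfolding power_add[symmetric] by (rule arg_cong[of _ _ "(^) \<beta>"]) (cases "i < w"; simp)
    moreover have "(3 * i + j + 3) div 3 - 1 - (3 * i + j) div 3 = 0" by simp
    moreover have "family_factor \<alpha> \<beta> (shift y x + (k, i, j)) = \<alpha> ^ (j div 3) * \<beta> ^ min (i + 1) w"
      unfolding family_factor_def shift_def 2 using e'(1) by (simp add: add.commute)
    ultimately show ?thesis
      unfolding family_mult_def family_class_def family_factor_def prod.case 2 using e e'(2)
      by (simp add: add.commute)
  next
    case 3
    define n where "n = col y x"
    have n: "n \<le> 2" using 3 by (simp add: n_def)
    have e': "2 * (k + 1) - (2 * i + (j + n)) = w + 2 - n" "3 * i + j + n - 2 * (k + 1) = i + n - (w + 2)"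
      unfolding distrib_left w by simp_all
    have B: "\<beta> ^ min i (w + 2 - n) = \<beta> ^ (0 + (i - w) - (i + n - (w + 2))) * \<beta> ^ min i w"
      unfolding power_add[symmetric] by (rule arg_cong[of _ _ "(^) \<beta>"]) (use n in \<open>cases "i \<le> w"; simp\<close>)
    have "(3 * i + j + n) div 3 = i + (j + n) div 3" "(3 * i + j) div 3 = i + j div 3"
      "j div 3 \<le> (j + n) div 3" by (simp_all add: add.assoc div_le_mono)
    then have "(j + n) div 3 = (3 * i + j + n) div 3 - 0 - (3 * i + j) div 3 + j div 3" by linarith
    then have A: "\<alpha> ^ ((j + n) div 3) = \<alpha> ^ ((3 * i + j + n) div 3 - 0 - (3 * i + j) div 3) * \<alpha> ^ (j div 3)"
      by (simp only: power_add)
    have fs: "family_factor \<alpha> \<beta> (shift y x + (k, i, j)) = \<alpha> ^ ((j + n) div 3) * \<beta> ^ min i (w + 2 - n)"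
      unfolding family_factor_def shift_def 3(1) n_def[symmetric] using e'(1) by (simp add: add.commute)
    have "family_mult y \<alpha> \<beta> x (family_class (k, i, j)) = unit_coef y x
        * \<alpha> ^ ((3 * i + j + n) div 3 - 0 - (3 * i + j) div 3) * \<beta> ^ (0 + (i - w) - (i + n - (w + 2)))"
      unfolding family_mult_def family_class_def prod.case 3(1) n_def[symmetric] mult_0_right add_0_right e e' ..
    then show ?thesis unfolding fs ff A B by (simp only: mult_ac)
  qed
qed

lemma position_in_polygon:
  assumes "y \<in> ends" "position y m = (k, i, j)" shows "2 * i + j \<le> 2 * k"
  using in_polygon[of y m] assms by (auto simp: polygon_def position_def ends_def)

lemma family_monomial_quotient:
  assumes y: "y \<in> ends" and ab: "\<alpha> \<noteq> 0 \<or> \<beta> \<noteq> 0"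
  shows "monomial_quotient (family_position y) (family_coef y \<alpha> \<beta>) (\<lambda>x. family_class (shift y x))
    (family_mult y \<alpha> \<beta>) fst"
proof
  fix m
  obtain k i j where p: "position y m = (k, i, j)" by (cases "position y m")
  show "\<And>x. family_position y (single x 1 + m) = family_class (shift y x) + family_position y m"
    unfolding family_position_def position_step p by (simp add: family_class_def shift_def)
  show "family_coef y \<alpha> \<beta> (single x 1 + m) = family_mult y \<alpha> \<beta> x (family_position y m) * family_coef y \<alpha> \<beta> m" for x
  proof -
    have "family_coef y \<alpha> \<beta> (single x 1 + m)
        = coef y m * (unit_coef y x * family_factor \<alpha> \<beta> (shift y x + (k, i, j)))"
      unfolding family_coef_def position_step coef_step p by (simp only: mult.assoc mult.left_commute)
    also have "\<dots> = coef y m * (family_mult y \<alpha> \<beta> x (family_class (k, i, j)) * family_factor \<alpha> \<beta> (k, i, j))"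
      using family_factor_step[OF y position_in_polygon[OF y p]] by simp
    finally show ?thesis by (simp add: family_coef_def family_position_def p)
  qed
  show "fst (family_position y m) = mon_degree m"
    by (simp add: family_position_def family_class_def position_def)
  \<comment> \<open>The factor of the apex V contains no \<alpha> and that of S^2 contains no
    \<beta>, so whichever parameter is nonzero, one of the two does not vanish.\<close>
  show "\<exists>x. family_mult y \<alpha> \<beta> x (family_position y m) \<noteq> 0"
  proof (cases "\<beta> = 0")
    case False
    have "unit_coef y (apex y) = 1" "row y (apex y) = 1" "col y (apex y) = 0"
      using y by (auto simp: ends_def unit_coef_def row_def col_def)
    moreover have "(3 * i + j + 3) div 3 - 1 - (3 * i + j) div 3 = 0" by simp
    ultimately show ?thesis using False
      by (intro exI[of _ "apex y"]) (simp add: family_mult_def family_position_def p family_class_def)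
  next
    case True
    have "unit_coef y (left y) = 1" "row y (left y) = 0" "col y (left y) = 2"
      using y by (auto simp: ends_def unit_coef_def row_def col_def)
    then show ?thesis using True ab
      by (intro exI[of _ "left y"]) (simp add: family_mult_def family_position_def p family_class_def)
  qed
qed

lemma classes_family:
  assumes y: "y \<in> ends" and ab: "\<alpha> \<noteq> 0 \<or> \<beta> \<noteq> 0"
  shows "classes (family_position y) (family_coef y \<alpha> \<beta>) (monomials k) = (\<lambda>t. (k, t, 0::nat)) ` {..3 * k}"
proof
  show "classes (family_position y) (family_coef y \<alpha> \<beta>) (monomials k) \<subseteq> (\<lambda>t. (k, t, 0::nat)) ` {..3 * k}"
  proof
    fix p assume "p \<in> classes (family_position y) (family_coef y \<alpha> \<beta>) (monomials k)"
    then obtain m where m: "mon_degree m = k" "p = family_position y m"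
      by (auto simp: classes_def monomials_def)
    obtain k' i j where q: "position y m = (k', i, j)" by (cases "position y m")
    then have "k' = k" using m(1) by (simp add: position_def)
    then have "p = (k, 3 * i + j, 0)" "3 * i + j \<le> 3 * k"
      using position_in_polygon[OF y q] m(2) q by (auto simp: family_position_def family_class_def)
    then show "p \<in> (\<lambda>t. (k, t, 0::nat)) ` {..3 * k}" by auto
  qed
  show "(\<lambda>t. (k, t, 0::nat)) ` {..3 * k} \<subseteq> classes (family_position y) (family_coef y \<alpha> \<beta>) (monomials k)"
  proof
    fix p assume "p \<in> (\<lambda>t. (k, t, 0::nat)) ` {..3 * k}"
    then obtain t where t: "p = (k, t, 0)" "t \<le> 3 * k" by auto
    \<comment> \<open>For \<alpha> nonzero take the representative with the smallest i, which is not
      divisible by V T; for \<alpha> = 0 the one with j \<le> 2, which is not divisible by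
      S^3.\<close>
    have "\<exists>i j. 3 * i + j = t \<and> 2 * i + j \<le> 2 * k \<and> family_factor \<alpha> \<beta> (k, i, j) \<noteq> 0"
    proof (cases "\<alpha> = 0")
      case False
      define i j where "i = t - 2 * k" "j = t - 3 * i"
      have "3 * i + j = t \<and> 2 * i + j \<le> 2 * k \<and> min i (2 * k - (2 * i + j)) = 0"
      proof (cases "t \<le> 2 * k")
        case True
        then show ?thesis by (simp add: i_j_def)
      next
        case False
        then obtain u where "t = 2 * k + u" using le_Suc_ex nat_le_linear by blast
        then show ?thesis using t(2) by (simp add: i_j_def)
      qed
      then show ?thesis using False unfolding family_factor_def by (intro exI[of _ i] exI[of _ j]) auto
    next
      case True
      define i j where "i = t div 3" "j = t mod 3"
      have t': "3 * i + j = t" "j div 3 = 0" unfolding i_j_def by simp_all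
      have "i \<le> k" "j \<le> 2" unfolding i_j_def using t(2) by auto
      with t' t(2) have "2 * i + j \<le> 2 * k" by linarith
      then show ?thesis using True ab t' unfolding family_factor_def by (intro exI[of _ i] exI[of _ j]) auto
    qed
    then obtain i j where ij: "3 * i + j = t" "2 * i + j \<le> 2 * k" "family_factor \<alpha> \<beta> (k, i, j) \<noteq> 0" by blast
    then have "(i, j) \<in> polygon y k" using ends_coords[OF y] by (simp add: polygon_def)
    note n = normal_monomial[OF conjunct1[OF ends_coords[OF y]] this]
    then have "normal_monomial y k i j \<in> monomials k" by (simp add: position_def monomials_def)
    then show "p \<in> classes (family_position y) (family_coef y \<alpha> \<beta>) (monomials k)"
      unfolding classes_def using n t(1) ij
      by (intro image_eqI[of _ _ "normal_monomial y k i j"])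
        (auto simp: family_position_def family_class_def family_coef_def)
  qed
qed

lemma card_classes_family:
  "y \<in> ends \<Longrightarrow> \<alpha> \<noteq> 0 \<or> \<beta> \<noteq> 0 \<Longrightarrow>
    card (classes (family_position y) (family_coef y \<alpha> \<beta>) (monomials k)) = 3 * k + 1"
  by (simp add: classes_family card_image inj_on_def)

lemma surface_subset_curve: "surface_ideal y \<subseteq> curve y \<alpha> \<beta>"
  unfolding curve_def family_coef_def[abs_def] family_position_def[abs_def] by (rule mq_factor)

lemma curve_in_fixed_locus:
  assumes y: "y \<in> ends" and ab: "\<alpha> \<noteq> 0 \<or> \<beta> \<noteq> 0"
  shows "curve y \<alpha> \<beta> \<in> fixed_locus 3"
  unfolding curve_def
proof (rule mq_in_fixed_locus[OF family_monomial_quotient[OF y ab] _ card_classes_family[OF y ab]])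
  show "quadric_ideal \<subseteq> mq (family_position y) (family_coef y \<alpha> \<beta>)"
    using quadric_in_surface[of y] ends_coords[OF y] surface_subset_curve[of y \<alpha> \<beta>] unfolding curve_def by blast
  define W where "W = (\<lambda>(k::nat, t::nat, u::nat). weight (left y) * (int t - int k))"
  show "mon_weight m = W (family_position y m)" if "family_coef y \<alpha> \<beta> m \<noteq> 0" for m
  proof -
    obtain k i j where q: "position y m = (k, i, j)" by (cases "position y m")
    \<comment> \<open>This property of the two end cones makes the weight a function of 3 i +
      j.\<close>
    have a: "weight (apex y) = 2 * weight (left y)" using y by (auto simp: ends_def)
    have "coef y m \<noteq> 0" using that by (simp add: family_coef_def)
    then have "mon_weight m = position_weight y (k, i, j)"
      using mon_weight_position[of y m] ends_coords[OF y] q by simp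
    also have "\<dots> = weight (left y) * (int (3 * i + j) - int k)"
    proof -
      have "y \<noteq> P1_m1" using ends_coords[OF y] by blast
      then have "position_weight y (k, i, j)
          = int i * (2 * weight (left y)) + weight (left y) * (int j + int i - int k)"
        by (simp only: position_weight_def prod.case a if_False)
      then show ?thesis by (simp add: distrib_left right_diff_distrib)
    qed
    finally show ?thesis by (simp add: W_def family_position_def q family_class_def)
  qed
qed

subsection \<open>Classification of the fixed points\<close>

text \<open>Nested ideals with the same Hilbert polynomial agree in large degrees, and saturation
  extends the agreement to all degrees. So every identification below needs only one
  inclusion.\<close>

lemma hilb_eq_of_subset:
  assumes "I \<in> hilb d" "I' \<in> hilb d" "I' \<subseteq> I"
  shows "I' = I"
proof
  have I: "homogeneous_ideal I" "is_ideal I" and I': "is_ideal I'" "saturated I'"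
    using assms by (simp_all add: hilb_def homogeneous_ideal_def)
  note sub = ideal_subspace[OF I(2)] and sub' = ideal_subspace[OF I'(1)]
  have "\<forall>\<^sub>F k in sequentially. hilbert_function I k = int d * int k + 1 \<and> hilbert_function I' k = int d * int k + 1"
    using assms by (auto simp: hilb_def intro: eventually_conj)
  then obtain K where K: "\<And>k. k \<ge> K \<Longrightarrow> hilbert_function I k = hilbert_function I' k"
    unfolding eventually_sequentially by metis
  have eq: "I' \<inter> forms k = I \<inter> forms k" if "k \<ge> K" for k
  proof (rule subspace_eq_of_dim)
    show "I \<inter> forms k \<subseteq> coord_space (monomials k)" by (auto simp: forms_def)
    show "vec.dim (I \<inter> forms k) \<le> vec.dim (I' \<inter> forms k)"
      using K[OF that] by (simp add: hilbert_function_def)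
  qed (use assms(3) finite_monomials vec.subspace_inter[OF sub] vec.subspace_inter[OF sub'] in auto)
  show "I \<subseteq> I'"
  proof
    fix f assume f: "f \<in> I"
    have "g * f \<in> I'" if g: "g \<in> forms K" for g
    proof -
      have gf: "g * f \<in> I" using ring_mod.subspace_scale[OF I(2) f] .
      have "hom_component k (g * f) \<in> I'" if k: "k \<in> mon_degree ` keys (g * f)" for k
      proof -
        obtain m where m: "m \<in> keys (g * f)" "k = mon_degree m" using k by blast
        then obtain a b where "m = a + b" "a \<in> keys g" using keys_mult[of g f] by blast
        then have "k \<ge> K" using g m(2) by (auto simp: forms_def coord_space_def monomials_def mon_degree_add)
        moreover have "hom_component k (g * f) \<in> I" using I(1) gf by (simp add: homogeneous_ideal_def)
        ultimately show ?thesis using eq[of k] hom_component_in_forms[of k "g * f"] by blast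
      qed
      then have "(\<Sum>k\<in>mon_degree ` keys (g * f). hom_component k (g * f)) \<in> I'"
        by (intro vec.subspace_sum[OF sub'])
      then show ?thesis by (simp only: sum_hom_components[symmetric])
    qed
    then show "f \<in> I'" using I'(2) unfolding saturated_def by blast
  qed
qed (rule assms(3))

text \<open>If every basis element is congruent modulo \<open>I\<close> to \<open>c b\<close> times
  a vector that depends only on its class, the quotient map by \<open>I\<close> factors through
  \<open>qmap \<pi> c\<close>.\<close>

lemma mq_subset_of_reduction:
  assumes I: "vec.subspace I"
    and red: "\<And>b. b \<in> B \<Longrightarrow> single b 1 - vscale (c b) (\<eta> (\<pi> b)) \<in> I"
  shows "mq \<pi> c \<inter> coord_space B \<subseteq> I"
proof
  fix f assume "f \<in> mq \<pi> c \<inter> coord_space B"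
  then have f: "qmap \<pi> c f = 0" "keys f \<subseteq> B" by (simp_all add: mq_def coord_space_def)
  let ?h = "\<Sum>b\<in>keys f. vscale (lookup f b) (vscale (c b) (\<eta> (\<pi> b)))"
  have "(\<Sum>b\<in>keys f. vscale (lookup f b) (single b 1 - vscale (c b) (\<eta> (\<pi> b)))) \<in> I"
    using f(2) red by (intro vec.subspace_sum[OF I] vec.subspace_scale[OF I]) blast
  moreover have "(\<Sum>b\<in>keys f. vscale (lookup f b) (single b 1 - vscale (c b) (\<eta> (\<pi> b))))
      = (\<Sum>b\<in>keys f. single b (lookup f b)) - ?h"
    by (simp add: vec.scale_right_diff_distrib sum_subtractf)
  ultimately have "(\<Sum>b\<in>keys f. single b (lookup f b)) - ?h \<in> I" by (simp only:)
  moreover have "?h = 0"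
  proof -
    have "?h = (\<Sum>p\<in>\<pi> ` keys f. \<Sum>b\<in>{b\<in>keys f. \<pi> b = p}. vscale (lookup f b) (vscale (c b) (\<eta> (\<pi> b))))"
      by (rule sum.image_gen) simp
    also have "\<dots> = (\<Sum>p\<in>\<pi> ` keys f. vscale (lookup (qmap \<pi> c f) p) (\<eta> p))"
    proof (rule sum.cong[OF refl])
      fix p
      have "(\<Sum>b\<in>{b\<in>keys f. \<pi> b = p}. vscale (lookup f b) (vscale (c b) (\<eta> (\<pi> b))))
          = (\<Sum>b\<in>{b\<in>keys f. \<pi> b = p}. vscale (c b * lookup f b) (\<eta> p))"
        by (intro sum.cong) (auto simp: mult.commute)
      also have "\<dots> = vscale (\<Sum>b\<in>{b\<in>keys f. \<pi> b = p}. c b * lookup f b) (\<eta> p)"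
        by (simp add: vec.scale_sum_left)
      also have "(\<Sum>b\<in>{b\<in>keys f. \<pi> b = p}. c b * lookup f b) = lookup (qmap \<pi> c f) p"
        unfolding lookup_qmap by (simp add: sum.If_cases Int_def)
      finally show "(\<Sum>b\<in>{b\<in>keys f. \<pi> b = p}. vscale (lookup f b) (vscale (c b) (\<eta> (\<pi> b))))
          = vscale (lookup (qmap \<pi> c f) p) (\<eta> p)" .
    qed
    also have "\<dots> = 0" by (simp add: f(1))
    finally show ?thesis .
  qed
  ultimately show "f \<in> I" by (simp only: diff_0_right sum_singles[symmetric])
qed

lemma position_add: "position y (m + n) = position y m + position y n"
  by (simp add: position_def mon_degree_add)

lemma coef_add: "coef y (m + n) = coef y m * coef y n"
  by (simp add: coef_def)

lemma qmap_times_single: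
  "qmap (position y) (coef y) (single n x * f)
    = vscale (x * coef y n) (single (position y n) 1 * qmap (position y) (coef y) f)"
proof -
  have "qmap (position y) (coef y) (single n x * f)
      = (\<Sum>m\<in>keys f. single (position y n + position y m) (coef y n * coef y m * (x * lookup f m)))"
    by (simp only: single_times qmap_sum qmap_single position_add coef_add)
  also have "\<dots> = (\<Sum>m\<in>keys f. vscale (x * coef y n) (single (position y n) 1 * single (position y m) (coef y m * lookup f m)))"
    by (intro sum.cong refl) (simp only: mult_single vscale_single mult_1_left mult_ac)
  also have "\<dots> = vscale (x * coef y n) (single (position y n) 1 * qmap (position y) (coef y) f)"
    by (simp only: qmap_def[of "position y" "coef y" f] sum_distrib_left vec.scale_sum_right)
  finally show ?thesis .
qed

lemma conic_identities:
  fixes A B C D E Z :: "'a::comm_ring_1"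
  shows "(A * E - B * D + Z * C) - C * (Z - 3 * C) = A * E - B * D + 3 * (C * C)"
    "3 * (C * C) - (A * E - B * D + 3 * (C * C)) = B * D - A * E"
    "- (B * D) - (A * E - B * D + 3 * (C * C)) = - (3 * (C * C)) - A * E"
    "(A * E - B * D + 3 * (C * C)) - A * E = 3 * (C * C) - B * D"
  by (simp_all add: right_diff_distrib mult.left_commute[of C 3] mult.commute[of C Z])

section \<open>Reduction to normal monomials on a toric surface\<close>

locale fixed_cubic_section = fixed_cubic +
  fixes y :: pluecker
  assumes y: "y \<in> coords" "var y \<in> I"
begin

abbreviation eqv :: "pluecker cpoly \<Rightarrow> pluecker cpoly \<Rightarrow> bool" (infix \<open>\<doteq>\<close> 50) where
  "f \<doteq> g \<equiv> f - g \<in> I"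

lemma eqv_trans: "f \<doteq> g \<Longrightarrow> g \<doteq> h \<Longrightarrow> f \<doteq> h"
  using vec.subspace_add[OF sub, of "f - g" "g - h"] by simp

lemma eqv_times: "f \<doteq> g \<Longrightarrow> h * f \<doteq> h * g"
  using times_in[of "f - g" h] by (simp add: right_diff_distrib)

lemma eqv_scale: "f \<doteq> g \<Longrightarrow> vscale x f \<doteq> vscale x g"
  using vec.subspace_scale[OF sub, of "f - g" x] by (simp add: vec.scale_right_diff_distrib)

lemma eqv_refl [simp]: "f = g \<Longrightarrow> f \<doteq> g"
  using vec.subspace_0[OF sub] by simp

lemma z_eqv: "var P3_m3 \<doteq> single (single P1_m1 1) 3"
  using z_rel by (simp only: three_times_var)

lemma conic_rel:
  "var P3_1 * var Pm1_m3 - var P3_m1 * var P1_m3 + 3 * (var P1_m1 * var P1_m1) \<in> I"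
proof -
  have "(var P3_1 * var Pm1_m3 - var P3_m1 * var P1_m3 + var P3_m3 * var P1_m1)
      - var P1_m1 * (var P3_m3 - 3 * var P1_m1) \<in> I"
    by (rule vec.subspace_diff[OF sub q_rel times_in[OF z_rel]])
  then show ?thesis by (simp only: conic_identities)
qed

lemma smooth_eqv: "y = P1_m1 \<Longrightarrow> var P3_m1 * var P1_m3 \<doteq> var P3_1 * var Pm1_m3"
proof -
  assume "y = P1_m1"
  then have "3 * (var P1_m1 * var P1_m1) - (var P3_1 * var Pm1_m3 - var P3_m1 * var P1_m3 + 3 * (var P1_m1 * var P1_m1)) \<in> I"
    using times_in[OF times_in[OF y(2)], of 3 "var P1_m1"] by (intro vec.subspace_diff[OF sub _ conic_rel]) simp
  then show ?thesis by (simp only: conic_identities)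
qed

lemma cone_eqv:
  assumes "y \<noteq> P1_m1"
  shows "var P1_m1 * var P1_m1 \<doteq> vscale (1 / kappa y) (var (left y) * var (right y))"
proof -
  have v3: "vscale 3 f = 3 * f" "vscale (-3) f = - (3 * f)" for f :: "pluecker cpoly"
    by (simp_all add: vscale_eq_times single_uminus)
  have "vscale (kappa y) (var P1_m1 * var P1_m1) - var (left y) * var (right y) \<in> I"
  proof (cases "y \<in> {P1_m3, P3_m1}")
    case True
    then consider "y = P1_m3" | "y = P3_m1" by blast
    then have lr: "var P3_m1 * var P1_m3 \<in> I \<and> var (left y) * var (right y) = (var P3_1 * var Pm1_m3 :: pluecker cpoly)"
    proof cases
      case 1
      have "var P3_m1 * var P1_m3 \<in> I" using times_in[OF y(2), of "var P3_m1"] unfolding 1 .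
      moreover have "var (left y) * var (right y) = (var P3_1 * var Pm1_m3 :: pluecker cpoly)" unfolding 1 left.simps right.simps ..
      ultimately show ?thesis ..
    next
      case 2
      have "var P3_m1 * var P1_m3 \<in> I" using times_in[OF y(2), of "var P1_m3"] unfolding 2 by (subst mult.commute)
      moreover have "var (left y) * var (right y) = (var P3_1 * var Pm1_m3 :: pluecker cpoly)"
        unfolding 2 left.simps right.simps by (rule mult.commute)
      ultimately show ?thesis ..
    qed
    have "- (var P3_m1 * var P1_m3) - (var P3_1 * var Pm1_m3 - var P3_m1 * var P1_m3 + 3 * (var P1_m1 * var P1_m1)) \<in> I"
      by (rule vec.subspace_diff[OF sub vec.subspace_neg[OF sub conjunct1[OF lr]] conic_rel])
    then have "- (3 * (var P1_m1 * var P1_m1)) - var P3_1 * var Pm1_m3 \<in> I" unfolding conic_identities(3) .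
    moreover have "kappa y = -3" using True by (simp add: kappa_def)
    ultimately show ?thesis by (simp only: conjunct2[OF lr] v3)
  next
    case False
    then consider "y = P3_1" | "y = Pm1_m3" using y(1) assms by (auto simp: coords_def)
    then have lr: "var P3_1 * var Pm1_m3 \<in> I \<and> var (left y) * var (right y) = (var P3_m1 * var P1_m3 :: pluecker cpoly)"
    proof cases
      case 1
      have "var P3_1 * var Pm1_m3 \<in> I" using times_in[OF y(2), of "var Pm1_m3"] unfolding 1 by (subst mult.commute)
      moreover have "var (left y) * var (right y) = (var P3_m1 * var P1_m3 :: pluecker cpoly)"
        unfolding 1 left.simps right.simps by (rule mult.commute)
      ultimately show ?thesis ..
    next
      case 2
      have "var P3_1 * var Pm1_m3 \<in> I" using times_in[OF y(2), of "var P3_1"] unfolding 2 .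
      moreover have "var (left y) * var (right y) = (var P3_m1 * var P1_m3 :: pluecker cpoly)" unfolding 2 left.simps right.simps ..
      ultimately show ?thesis ..
    qed
    have "(var P3_1 * var Pm1_m3 - var P3_m1 * var P1_m3 + 3 * (var P1_m1 * var P1_m1)) - var P3_1 * var Pm1_m3 \<in> I"
      by (rule vec.subspace_diff[OF sub conic_rel conjunct1[OF lr]])
    then have "3 * (var P1_m1 * var P1_m1) - var P3_m1 * var P1_m3 \<in> I" unfolding conic_identities(4) .
    moreover have "kappa y = 3" using False by (simp add: kappa_def)
    ultimately show ?thesis by (simp only: conjunct2[OF lr] v3)
  qed
  then have "vscale (1 / kappa y) (vscale (kappa y) (var P1_m1 * var P1_m1) - var (left y) * var (right y)) \<in> I"
    by (rule vec.subspace_scale[OF sub])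
  moreover have "kappa y \<noteq> 0" by (simp add: kappa_def)
  ultimately show ?thesis by (simp add: vec.scale_right_diff_distrib)
qed

definition normal_form :: "nat \<times> nat \<times> nat \<Rightarrow> pluecker cpoly" where
  "normal_form = (\<lambda>(k, i, j). single (normal_monomial y k i j) (1 / coef y (normal_monomial y k i j)))"

text \<open>The product of a normal monomial with a coordinate is normal again unless a second
  factor \<open>P1_m1\<close> appears; then the equation of the cone trades the square for
  \<open>left\<close> times \<open>right\<close>.\<close>

lemma normal_form_step_cone:
  assumes c: "y \<noteq> P1_m1" and ij: "2 * i + j \<le> 2 * k" and x: "x \<noteq> P3_m3"
  shows "var x * normal_form (k, i, j) \<doteq> vscale (unit_coef y x) (normal_form (shift y x + (k, i, j)))"
proof -
  define s e where "s = j div 2" "e = j mod 2"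
  define l where "l = k - i - s - e"
  have j: "j = 2 * s + e" and e: "e = 0 \<or> e = 1" unfolding s_e_def by auto
  then have "i + s + e \<le> k" using ij by auto
  then have sel: "j = 2 * s + e" "k = i + s + e + l" "e = 0 \<or> e = 1" using j e by (simp_all add: l_def)
  have nm: "normal_monomial y k' i' (2 * s' + e') = single (apex y) i' + single (left y) s' + single P1_m1 e' + single (right y) l'"
    if "k' = i' + s' + e' + l'" "e' = 0 \<or> e' = 1" for k' i' s' e' l'
    using that c by (auto simp: normal_monomial_def)
  have d: "apex y \<noteq> y" "left y \<noteq> y" "right y \<noteq> y" "P1_m1 \<noteq> y" "apex y \<noteq> right y" "left y \<noteq> right y"
     "P1_m1 \<noteq> right y" "apex y \<noteq> left y" "P1_m1 \<noteq> apex y" "P1_m1 \<noteq> left y"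
     "apex y \<noteq> P3_m3" "left y \<noteq> P3_m3" "right y \<noteq> P3_m3"
    using y(1) c by (auto simp: coords_def)
  have uc: "unit_coef y (apex y) = 1" "unit_coef y (left y) = 1" "unit_coef y P1_m1 = 1" "unit_coef y (right y) = kappa y" "unit_coef y y = 0"
    using d c by (auto simp: unit_coef_def)
  have cf: "coef y (single (apex y) i' + single (left y) s' + single P1_m1 e' + single (right y) l') = kappa y ^ l'" for i' s' e' l'
    by (simp add: coef_def uc)
  have k0: "kappa y \<noteq> 0" by (simp add: kappa_def)
  have nf: "normal_form (k', i', 2 * s' + e') = single (single (apex y) i' + single (left y) s' + single P1_m1 e' + single (right y) l') (1 / kappa y ^ l')"
    if "k' = i' + s' + e' + l'" "e' = 0 \<or> e' = 1" for k' i' s' e' l'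
    unfolding normal_form_def prod.case nm[OF that] cf ..
  have nf0: "normal_form (k, i, j) = single (single (apex y) i + single (left y) s + single P1_m1 e + single (right y) l) (1 / kappa y ^ l)"
    using nf[of k i s e l] sel by simp
  consider "x = y" | "x = apex y" | "x = left y" | "x = right y" | "x = P1_m1"
    using y(1) c x by (cases x) (auto simp: coords_def)
  then show ?thesis
  proof cases
    case 1
    then show ?thesis using times_in[OF y(2), of "normal_form (k, i, j)"] uc by (simp add: mult.commute)
  next
    case 2
    have "shift y x + (k, i, j) = (k + 1, i + 1, 2 * s + e)"
      using 2 d c sel(1) by (simp add: shift_def row_def col_def)
    then have n1: "normal_form (shift y x + (k, i, j)) = single (single (apex y) (i + 1) + single (left y) s + single P1_m1 e + single (right y) l) (1 / kappa y ^ l)"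
      using nf[of "k + 1" "i + 1" s e l] sel by simp
    show ?thesis unfolding n1 nf0 unfolding 2 uc single_add
      by (intro eqv_refl) (simp add: mult_single add_ac)
  next
    case 3
    have "shift y x + (k, i, j) = (k + 1, i, 2 * (s + 1) + e)"
      using 3 d c sel(1) by (simp add: shift_def row_def col_def)
    then have n1: "normal_form (shift y x + (k, i, j)) = single (single (apex y) i + single (left y) (s + 1) + single P1_m1 e + single (right y) l) (1 / kappa y ^ l)"
      using nf[of "k + 1" i "s + 1" e l] sel by simp
    show ?thesis unfolding n1 nf0 unfolding 3 uc single_add
      by (intro eqv_refl) (simp add: mult_single add_ac)
  next
    case 4
    have "shift y x + (k, i, j) = (k + 1, i, 2 * s + e)"
      using 4 d c sel(1) by (simp add: shift_def row_def col_def)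
    then have n1: "normal_form (shift y x + (k, i, j)) = single (single (apex y) i + single (left y) s + single P1_m1 e + single (right y) (l + 1)) (1 / kappa y ^ (l + 1))"
      using nf[of "k + 1" i s e "l + 1"] sel by simp
    show ?thesis unfolding n1 nf0 unfolding 4 uc single_add using k0
      by (intro eqv_refl) (simp add: mult_single add_ac)
  next
    case 5
    have sh: "shift y x + (k, i, j) = (k + 1, i, 2 * s + e + 1)"
      using 5 d c sel(1) by (simp add: shift_def row_def col_def)
    show ?thesis
    proof (cases "e = 0")
      case True
      have n1: "normal_form (shift y x + (k, i, j)) = single (single (apex y) i + single (left y) s + single P1_m1 1 + single (right y) l) (1 / kappa y ^ l)"
        using sh True nf[of "k + 1" i s 1 l] sel by simp
      show ?thesis unfolding n1 nf0 unfolding 5 uc True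
        by (intro eqv_refl) (simp add: mult_single add_ac)
    next
      case False
      then have e: "e = 1" using sel by simp
      define rest where "rest = single (apex y) i + single (left y) s + single (right y) l"
      have n1: "normal_form (shift y x + (k, i, j)) = single (single (apex y) i + single (left y) (s + 1) + single P1_m1 0 + single (right y) (l + 1)) (1 / kappa y ^ (l + 1))"
        using sh e nf[of "k + 1" i "s + 1" 0 "l + 1"] sel by simp
      have "var x * normal_form (k, i, j) = single rest (1 / kappa y ^ l) * (var P1_m1 * var P1_m1)"
        unfolding nf0 unfolding e 5 by (simp add: mult_single rest_def add_ac)
      moreover have "single rest (1 / kappa y ^ l) * (var P1_m1 * var P1_m1)
          \<doteq> single rest (1 / kappa y ^ l) * vscale (1 / kappa y) (var (left y) * var (right y))"
        by (rule eqv_times[OF cone_eqv[OF c]])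
      moreover have "single rest (1 / kappa y ^ l) * vscale (1 / kappa y) (var (left y) * var (right y))
          = vscale (unit_coef y x) (normal_form (shift y x + (k, i, j)))"
        unfolding n1 unfolding 5 uc single_add
        by (simp add: mult_single rest_def add_ac mult.commute[of _ "kappa y"])
      ultimately show ?thesis by simp
    qed
  qed
qed

text \<open>The only product to rewrite is that of \<open>P3_m1\<close> and \<open>P1_m3\<close>,
  which becomes \<open>P3_1\<close> times \<open>Pm1_m3\<close>. In \<open>M e b d a\<close> the
  letters are the exponents of \<open>Pm1_m3\<close>, \<open>P3_m1\<close>, \<open>P1_m3\<close>,
  \<open>P3_1\<close>.\<close>

lemma normal_form_step_smooth:
  assumes c: "y = P1_m1" and ij: "i \<le> k" "j \<le> k" and x: "x \<noteq> P3_m3"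
  shows "var x * normal_form (k, i, j) \<doteq> vscale (unit_coef y x) (normal_form (shift y x + (k, i, j)))"
proof -
  have uc: "unit_coef y P3_1 = 1" "unit_coef y P3_m1 = 1" "unit_coef y P1_m3 = 1" "unit_coef y Pm1_m3 = 1" "unit_coef y P1_m1 = 0"
    using c by (simp_all add: unit_coef_def)
  define M where "M e b d a = single Pm1_m3 e + single P3_m1 b + single P1_m3 d + single P3_1 (a::nat)" for e b d a
  have cM: "coef y (M e b d a) = 1" for e b d a by (simp add: M_def coef_def uc)
  have nf: "normal_form (e + b + d + a, e + b, e + d) = single (M e b d a) 1" if "b = 0 \<or> d = 0" for e b d a
  proof -
    have "normal_monomial y (e + b + d + a) (e + b) (e + d) = M e b d a"
      using that c by (auto simp: normal_monomial_def M_def)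
    then show ?thesis by (simp add: normal_form_def cM)
  qed
  obtain e b d a where k: "k = e + b + d + a" "i = e + b" "j = e + d" "b = 0 \<or> d = 0"
  proof (rule that[of "min i j" "i - min i j" "j - min i j" "k - max i j"])
  qed (use ij in \<open>auto simp: min_def max_def\<close>)
  have nf0: "normal_form (k, i, j) = single (M e b d a) 1" using nf k by simp
  have sM: "var P3_1 * single (M e b d a) 1 = single (M e b d (a + 1)) 1"
    "var Pm1_m3 * single (M e b d a) 1 = single (M (e + 1) b d a) 1"
    "var P3_m1 * single (M e b d a) 1 = single (M e (b + 1) d a) 1"
    "var P1_m3 * single (M e b d a) 1 = single (M e b (d + 1) a) 1" for e b d a
    unfolding M_def single_add by (simp_all add: mult_single add_ac)
  have swap: "single (M e (b + 1) (d + 1) a) 1 \<doteq> single (M (e + 1) b d (a + 1)) 1" for e b d a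
  proof -
    have "single (M e b d a) 1 * (var P3_m1 * var P1_m3) \<doteq> single (M e b d a) 1 * (var P3_1 * var Pm1_m3)"
      by (rule eqv_times[OF smooth_eqv[OF c]])
    moreover have "single (M e b d a) 1 * (var P3_m1 * var P1_m3) = var P3_m1 * (var P1_m3 * single (M e b d a) 1)"
      by (simp only: mult_ac)
    moreover have "single (M e b d a) 1 * (var P3_1 * var Pm1_m3) = var P3_1 * (var Pm1_m3 * single (M e b d a) 1)"
      by (simp only: mult_ac)
    ultimately show ?thesis unfolding sM by simp
  qed
  show ?thesis
  proof (cases x)
    case P3_1
    have "shift y x + (k, i, j) = (e + b + d + (a + 1), e + b, e + d)" using P3_1 c k by (simp add: shift_def row_def col_def)
    then show ?thesis unfolding nf0 using P3_1 nf[of b d e "a + 1"] k(4) sM(1) uc by (intro eqv_refl) simp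
  next
    case Pm1_m3
    have "shift y x + (k, i, j) = ((e + 1) + b + d + a, (e + 1) + b, (e + 1) + d)" using Pm1_m3 c k by (simp add: shift_def row_def col_def)
    then show ?thesis unfolding nf0 using Pm1_m3 nf[of b d "e + 1" a] k(4) sM(2) uc by (intro eqv_refl) simp
  next
    case P3_m1
    have sh: "shift y x + (k, i, j) = (k + 1, i + 1, j)" using P3_m1 c by (simp add: shift_def row_def col_def)
    show ?thesis
    proof (cases d)
      case 0
      then have "normal_form (shift y x + (k, i, j)) = single (M e (b + 1) d a) 1"
        using sh nf[of "b + 1" d e a] k by simp
      then show ?thesis unfolding nf0 using P3_m1 sM(3) uc by (intro eqv_refl) simp
    next
      case (Suc d')
      then have "b = 0" using k by simp
      then have "normal_form (shift y x + (k, i, j)) = single (M (e + 1) b d' (a + 1)) 1"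
        using sh nf[of b d' "e + 1" "a + 1"] k Suc by simp
      then show ?thesis unfolding nf0 using P3_m1 sM(3) uc swap[of e b d' a] Suc by simp
    qed
  next
    case P1_m3
    have sh: "shift y x + (k, i, j) = (k + 1, i, j + 1)" using P1_m3 c by (simp add: shift_def row_def col_def)
    show ?thesis
    proof (cases b)
      case 0
      then have "normal_form (shift y x + (k, i, j)) = single (M e b (d + 1) a) 1"
        using sh nf[of b "d + 1" e a] k by simp
      then show ?thesis unfolding nf0 using P1_m3 sM(4) uc by (intro eqv_refl) simp
    next
      case (Suc b')
      then have "d = 0" using k by simp
      then have "normal_form (shift y x + (k, i, j)) = single (M (e + 1) b' d (a + 1)) 1"
        using sh nf[of b' d "e + 1" "a + 1"] k Suc by simp
      then show ?thesis unfolding nf0 using P1_m3 sM(4) uc swap[of e b' d a] Suc by simp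
    qed
  next
    case P1_m1
    then show ?thesis using times_in[OF y(2), of "normal_form (k, i, j)"] uc c by (simp add: mult.commute)
  qed (use x in simp)
qed

lemma normal_form_step:
  assumes "(i, j) \<in> polygon y k"
  shows "var x * normal_form (k, i, j) \<doteq> vscale (unit_coef y x) (normal_form (shift y x + (k, i, j)))"
proof -
  have st: "var x * normal_form (k, i, j) \<doteq> vscale (unit_coef y x) (normal_form (shift y x + (k, i, j)))"
    if "x \<noteq> P3_m3" for x
    using that assms normal_form_step_smooth normal_form_step_cone
    by (cases "y = P1_m1") (auto simp: polygon_def)
  show ?thesis
  proof (cases "x = P3_m3")
    case True
    have "normal_form (k, i, j) * var P3_m3 \<doteq> normal_form (k, i, j) * single (single P1_m1 1) 3"
      by (rule eqv_times[OF z_eqv])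
    moreover have "normal_form (k, i, j) * single (single P1_m1 1) 3 = vscale 3 (var P1_m1 * normal_form (k, i, j))"
    proof -
      have "single (single P1_m1 1) 3 = vscale 3 (var P1_m1 :: pluecker cpoly)" by simp
      then show ?thesis by (simp only: mult_vscale mult.commute)
    qed
    moreover have "vscale 3 (var P1_m1 * normal_form (k, i, j))
        \<doteq> vscale 3 (vscale (unit_coef y P1_m1) (normal_form (shift y P1_m1 + (k, i, j))))"
      by (rule eqv_scale[OF st]) simp
    moreover have "shift y P1_m1 = shift y P3_m3" "3 * unit_coef y P1_m1 = unit_coef y P3_m3"
      using y(1) by (auto simp: shift_def row_def col_def unit_coef_def coords_def kappa_def)
    then have "vscale 3 (vscale (unit_coef y P1_m1) (normal_form (shift y P1_m1 + (k, i, j))))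
        = vscale (unit_coef y x) (normal_form (shift y x + (k, i, j)))"
      using True by simp
    ultimately show ?thesis using True eqv_trans by (metis mult.commute)
  qed (rule st)
qed

lemma reduce_monomial: "single m 1 \<doteq> vscale (coef y m) (normal_form (position y m))"
proof (induction m rule: monomial_induct)
  case zero
  have "normal_monomial y 0 0 0 = 0" by (simp add: normal_monomial_def)
  then have "normal_form (position y 0) = 1" by (simp add: normal_form_def position_def coef_def)
  then show ?case by (intro eqv_refl) (simp add: coef_def vscale_eq_times)
next
  case (step x m)
  obtain k i j where p: "position y m = (k, i, j)" by (cases "position y m")
  have ij: "(i, j) \<in> polygon y k" using in_polygon[of y m] p by (simp add: position_def)
  have "var x * single m 1 \<doteq> var x * vscale (coef y m) (normal_form (k, i, j))"
    using eqv_times[OF step.IH] p by simp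
  moreover have "var x * vscale (coef y m) (normal_form (k, i, j)) = vscale (coef y m) (var x * normal_form (k, i, j))"
    by (simp only: mult_vscale)
  moreover have "vscale (coef y m) (var x * normal_form (k, i, j))
      \<doteq> vscale (coef y m) (vscale (unit_coef y x) (normal_form (shift y x + (k, i, j))))"
    by (rule eqv_scale[OF normal_form_step[OF ij]])
  moreover have "vscale (coef y m) (vscale (unit_coef y x) (normal_form (shift y x + (k, i, j))))
      = vscale (coef y (single x 1 + m)) (normal_form (position y (single x 1 + m)))"
    unfolding coef_step position_step p by (simp only: vec.scale_scale mult.commute)
  ultimately show ?case unfolding single_step using eqv_trans by metis
qed

lemma surface_subset: "surface_ideal y \<subseteq> I"
proof -
  have "mq (position y) (coef y) \<inter> coord_space UNIV \<subseteq> I"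
    by (rule mq_subset_of_reduction[OF sub, of _ _ normal_form]) (rule reduce_monomial)
  then show ?thesis by (simp add: coord_space_def)
qed

end

section \<open>The ideal in the lattice-point algebra of the surface\<close>

lemma card_polygon:
  assumes "y \<in> coords" shows "finite (polygon y k)" "card (polygon y k) = (k + 1)\<^sup>2"
proof -
  have c: "card {(i, j). i \<le> k \<and> j \<le> L i} = (\<Sum>i\<le>k. L i + 1)" for L :: "nat \<Rightarrow> nat"
    using card_rows[of k L "\<lambda>_. False" 0 0] by simp
  have "polygon y k = {(i, j). i \<le> k \<and> j \<le> (if y = P1_m1 then k else 2 * (k - i))}"
    by (auto simp: polygon_def)
  moreover have "(\<Sum>i\<le>k. (if y = P1_m1 then k else 2 * (k - i)) + 1) = (k + 1)\<^sup>2"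
  proof (cases "y = P1_m1")
    case True
    then show ?thesis by (simp add: power2_eq_square)
  next
    case False
    have "(\<Sum>i\<le>k. 2 * (k - i) + 1) = (\<Sum>i\<le>k. 2 * i + 1)"
      by (rule sum.nat_diff_reindex[of "\<lambda>i. 2 * i + 1" "Suc k", unfolded lessThan_Suc_atMost diff_Suc_Suc])
    also have "\<dots> = (k + 1)\<^sup>2" by (induction k) (auto simp: power2_eq_square)
    finally show ?thesis using False by simp
  qed
  ultimately show card: "card (polygon y k) = (k + 1)\<^sup>2" by (simp only: c)
  then show "finite (polygon y k)" using card_ge_0_finite[of "polygon y k"] by simp
qed

text \<open>Up to degree 3 the entry j is at most 6, so the factor 7 makes the numbering injective
  and lexicographic. Its additivity lets leading positions be translated.\<close>

definition slot :: "nat \<times> nat \<times> nat \<Rightarrow> nat" where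
  "slot = (\<lambda>(k, i, j). 7 * i + j)"

lemma inj_on_slot:
  assumes "k \<le> 3" shows "inj_on slot (Pair k ` polygon y k)"
proof (rule inj_onI)
  fix p q assume p: "p \<in> Pair k ` polygon y k" and q: "q \<in> Pair k ` polygon y k" and s: "slot p = slot q"
  obtain i j where ij: "p = (k, i, j)" "(i, j) \<in> polygon y k" using p by auto
  obtain i' j' where ij': "q = (k, i', j')" "(i', j') \<in> polygon y k" using q by auto
  have "j < 7" "j' < 7" using ij(2) ij'(2) assms by (auto simp: polygon_def split: if_splits)
  moreover have "7 * i + j = 7 * i' + j'" using s ij(1) ij'(1) by (simp add: slot_def)
  ultimately have "i = i' \<and> j = j'" by presburger
  then show "p = q" using ij(1) ij'(1) by simp
qed

lemma slot_add: "slot (p + q) = slot p + slot q"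
  by (cases p; cases q) (simp add: slot_def)

lemma keys_single_times:
  fixes p :: "'p::cancel_comm_monoid_add"
  assumes "x \<noteq> (0::complex)" shows "keys (single p x * F) = (+) p ` keys F"
proof
  show "keys (single p x * F) \<subseteq> (+) p ` keys F" using keys_mult[of "single p x" F] assms by auto
  show "(+) p ` keys F \<subseteq> keys (single p x * F)"
    using assms by (auto simp: in_keys_iff lookup_single_times)
qed

context fixed_cubic_section
begin

text \<open>The degree k part of the ideal of the curve inside the coordinate ring of the surface,
  with lattice points as basis.\<close>

definition image_space :: "nat \<Rightarrow> (nat \<times> nat \<times> nat \<Rightarrow>\<^sub>0 complex) set" where
  "image_space k = qmap (position y) (coef y) ` (I \<inter> forms k)"

lemma subspace_image_space: "vec.subspace (image_space k)"
proof -
  interpret Vector_Spaces.linear vscale vscale "qmap (position y) (coef y)" by simp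
  show ?thesis unfolding image_space_def
    by (intro subspace_image vec.subspace_inter sub subspace_forms)
qed

lemma image_space_coord: "image_space k \<subseteq> coord_space (Pair k ` polygon y k)"
proof -
  have "image_space k \<subseteq> qmap (position y) (coef y) ` coord_space (monomials k)"
    unfolding image_space_def forms_def by auto
  then show ?thesis by (simp only: qmap_image classes_position[OF y(1)])
qed

lemma finite_positions: "finite (Pair k ` polygon y k)"
  using card_polygon(1)[OF y(1)] by simp

text \<open>The kernel of the restriction to the surface lies in \<open>I\<close>, so the dimension
  is the difference of the two Hilbert functions: 2 in degree 2 and 6 in degree 3.\<close>

lemma dim_image_space:
  assumes "k \<ge> 1" shows "vec.dim (image_space k) + (3 * k + 1) = (k + 1)\<^sup>2"
proof -
  define N where "N = (k + 1)\<^sup>2"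
  have s: "I \<inter> forms k \<subseteq> coord_space (monomials k)" by (auto simp: forms_def)
  have "vec.dim (I \<inter> forms k) = vec.dim (image_space k) + vec.dim {v \<in> I \<inter> forms k. qmap (position y) (coef y) v = 0}"
    unfolding image_space_def
    by (rule rank_nullity[OF linear_qmap vec.subspace_inter[OF sub subspace_forms] s finite_monomials])
  moreover have "{v \<in> I \<inter> forms k. qmap (position y) (coef y) v = 0} = surface_ideal y \<inter> forms k"
    using surface_subset by (auto simp: mq_def)
  then have "vec.dim {v \<in> I \<inter> forms k. qmap (position y) (coef y) v = 0} = vec.dim (surface_ideal y \<inter> forms k)"
    by simp
  moreover have "hilbert_function (surface_ideal y) k = int N"
    unfolding hilbert_function_mq classes_position[OF y(1)]
    using card_polygon(2)[OF y(1), of k] by (simp add: card_image inj_on_def N_def)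
  ultimately show ?thesis
    using hilbert_function_eq[OF assms] unfolding hilbert_function_def N_def[symmetric] by linarith
qed

lemma image_space_times:
  assumes "F \<in> image_space k" "coef y n \<noteq> 0" "mon_degree n = l"
  shows "single (position y n) 1 * F \<in> image_space (l + k)"
proof -
  obtain f where f: "f \<in> I" "f \<in> forms k" "F = qmap (position y) (coef y) f"
    using assms(1) unfolding image_space_def by blast
  have "qmap (position y) (coef y) (single n (1 / coef y n) * f) = single (position y n) 1 * F"
    unfolding qmap_times_single f(3) using assms(2) by simp
  moreover have "single n (1 / coef y n) * f \<in> I \<inter> forms (l + k)"
    using times_in[OF f(1)] forms_mult[OF single_in_forms[OF assms(3)] f(2)] by blast
  ultimately show ?thesis unfolding image_space_def by (metis imageI)
qed

lemma image_space_translate: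
  assumes "F \<in> image_space k" "(i, j) \<in> polygon y l"
  shows "single (l, i, j) 1 * F \<in> image_space (l + k)"
  using image_space_times[OF assms(1) normal_monomial(2)[OF y(1) assms(2)], of l]
    normal_monomial(1)[OF y(1) assms(2)]
  by (simp add: position_def)

lemma image_space_weight:
  assumes "F \<in> image_space k"
  shows "vproj {p. position_weight y p = w} F \<in> image_space k"
proof -
  obtain f where f: "f \<in> I" "f \<in> forms k" "F = qmap (position y) (coef y) f"
    using assms(1) unfolding image_space_def by blast
  have "qmap (position y) (coef y) (wcomp w f) = vproj {p. position_weight y p = w} F"
  proof (rule poly_mapping_eqI)
    fix p
    show "lookup (qmap (position y) (coef y) (wcomp w f)) p = lookup (vproj {p. position_weight y p = w} F) p"
      using qmap_vproj[of "coef y" "{m. mon_weight m = w}" "\<lambda>p. position_weight y p = w" "position y" f p]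
        mon_weight_position[OF y(1)]
      by (simp add: f(3))
  qed
  moreover have "wcomp w f \<in> I \<inter> forms k"
    using wcomp_in[OF f(1)] f(2) by (auto simp: forms_def in_coord_space)
  ultimately show ?thesis unfolding image_space_def by (metis imageI)
qed

text \<open>Elements with the same image differ by an element of the surface ideal, which lies in
  \<open>I\<close>. Membership can therefore be tested on lattice points.\<close>

lemma in_ideal_of_image:
  assumes "qmap (position y) (coef y) g \<in> image_space k" shows "g \<in> I"
proof -
  obtain f where f: "f \<in> I" "qmap (position y) (coef y) g = qmap (position y) (coef y) f"
    using assms(1) unfolding image_space_def by blast
  then have "g - f \<in> surface_ideal y" by (simp add: mq_def qmap_minus)
  then have "(g - f) + f \<in> I" using surface_subset f(1) by (intro vec.subspace_add[OF sub]) auto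
  then show ?thesis by simp
qed

definition lead_positions :: "nat \<Rightarrow> (nat \<times> nat \<times> nat) set" where
  "lead_positions k = leads slot (image_space k)"

lemma card_lead_positions:
  assumes "k \<in> {2, 3}" shows "card (lead_positions k) + (3 * k + 1) = (k + 1)\<^sup>2"
proof -
  have "card (lead_positions k) = vec.dim (image_space k)"
    unfolding lead_positions_def
    using assms dim_leads[OF subspace_image_space image_space_coord finite_positions inj_on_slot] by auto
  then show ?thesis using dim_image_space[of k] assms by auto
qed

lemma lead_positions_subset: "lead_positions k \<subseteq> Pair k ` polygon y k"
  unfolding lead_positions_def by (rule leads_subset[OF image_space_coord])

lemma finite_lead_positions: "finite (lead_positions k)"
  by (rule finite_subset[OF lead_positions_subset finite_positions])

lemma lead_positions_translate:
  assumes "p \<in> lead_positions k" "(i, j) \<in> polygon y l"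
  shows "(l, i, j) + p \<in> lead_positions (l + k)"
proof -
  obtain F where F: "F \<in> image_space k" "p \<in> keys F" "\<forall>q\<in>keys F. slot q \<le> slot p"
    using assms(1) unfolding lead_positions_def leads_def by blast
  let ?G = "single (l, i, j) 1 * F"
  have "?G \<in> image_space (l + k)" by (rule image_space_translate[OF F(1) assms(2)])
  moreover have k: "keys ?G = (+) (l, i, j) ` keys F" by (rule keys_single_times) simp
  moreover have "(l, i, j) + p \<in> keys ?G" unfolding k using F(2) by blast
  moreover have "\<forall>q\<in>keys ?G. slot q \<le> slot ((l, i, j) + p)" unfolding k using F(3) by (auto simp: slot_add)
  ultimately show ?thesis unfolding lead_positions_def leads_def by blast
qed

text \<open>Projection to the weight of the leading position keeps the leading term, so a leading
  position is realized by an element homogeneous for the torus.\<close>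

lemma lead_witness:
  assumes p: "p \<in> lead_positions k"
  shows "\<exists>F\<in>image_space k. lookup F p = 1 \<and>
    (\<forall>q. lookup F q \<noteq> 0 \<longrightarrow> q \<in> Pair k ` polygon y k \<and> position_weight y q = position_weight y p \<and> slot q \<le> slot p)"
proof -
  obtain F where F: "F \<in> image_space k" "p \<in> keys F" "\<forall>q\<in>keys F. slot q \<le> slot p"
    using p unfolding lead_positions_def leads_def by blast
  let ?G = "vscale (1 / lookup F p) (vproj {q. position_weight y q = position_weight y p} F)"
  have "?G \<in> image_space k"
    by (rule vec.subspace_scale[OF subspace_image_space image_space_weight[OF F(1)]])
  moreover have "lookup F p \<noteq> 0" using F(2) by (simp add: in_keys_iff)
  moreover have "q \<in> Pair k ` polygon y k" if "lookup F q \<noteq> 0" for q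
    using image_space_coord[of k] F(1) that unfolding in_coord_space by (meson in_coord_space subsetD)
  moreover have "slot q \<le> slot p" if "lookup F q \<noteq> 0" for q
    using F(3) that by (simp add: in_keys_iff)
  ultimately show ?thesis by (intro bexI[of _ ?G]) (auto split: if_splits)
qed

end

section \<open>Adjacency of the two leading positions in degree 2\<close>

definition unit_positions :: "pluecker \<Rightarrow> (nat \<times> nat \<times> nat) list" where
  "unit_positions y = (if y = P1_m1 then [(1,0,0), (1,1,0), (1,0,1), (1,1,1)] else [(1,0,0), (1,0,1), (1,0,2), (1,1,0)])"

definition quadric_positions :: "pluecker \<Rightarrow> (nat \<times> nat) list" where
  "quadric_positions y = (if y = P1_m1 then [(0,0), (0,1), (0,2), (1,0), (1,1), (1,2), (2,0), (2,1), (2,2)]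
     else [(0,0), (0,1), (0,2), (0,3), (0,4), (1,0), (1,1), (1,2), (2,0)])"

lemma polygon_2: "polygon y 2 = set (quadric_positions y)"
proof
  show "polygon y 2 \<subseteq> set (quadric_positions y)"
  proof
    fix p assume "p \<in> polygon y 2"
    then obtain i j where p: "p = (i, j)" "if y = P1_m1 then i \<le> 2 \<and> j \<le> 2 else 2 * i + j \<le> 4"
      by (cases p; cases "y = P1_m1") (auto simp: polygon_def)
    then have "i = 0 \<or> i = 1 \<or> i = 2" by (auto split: if_splits)
    moreover have "j = 0 \<or> j = 1 \<or> j = 2 \<or> j = 3 \<or> j = 4" using p(2) by (auto split: if_splits)
    ultimately show "p \<in> set (quadric_positions y)"
      using p by (elim disjE; simp add: quadric_positions_def split: if_splits)
  qed
  show "set (quadric_positions y) \<subseteq> polygon y 2"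
    by (cases "y = P1_m1") (simp_all add: quadric_positions_def polygon_def)
qed

lemma unit_positions_polygon: "(k, i, j) \<in> set (unit_positions y) \<Longrightarrow> k = 1 \<and> (i, j) \<in> polygon y 1"
  by (auto simp: unit_positions_def polygon_def split: if_splits)

text \<open>Two translates of a set of four positions fit into the six leading positions of degree 3
  only if they share at least two elements. For the square this happens for neighbours in a row or a
  column, for the triangle only for neighbours with equal first entry.\<close>

lemma adjacent_smooth:
  "\<forall>p\<in>set (quadric_positions P1_m1). \<forall>q\<in>set (quadric_positions P1_m1). p \<noteq> q \<longrightarrow>
     length (remdups (map (\<lambda>s. s + Pair 2 p) (unit_positions P1_m1) @ map (\<lambda>s. s + Pair 2 q) (unit_positions P1_m1))) \<le> 6 \<longrightarrow>
     (fst p = fst q \<and> (snd q = snd p + 1 \<or> snd p = snd q + 1)) \<or> (snd p = snd q \<and> (fst q = fst p + 1 \<or> fst p = fst q + 1))"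
  by code_simp

lemma adjacent_cone:
  "\<forall>p\<in>set (quadric_positions P3_1). \<forall>q\<in>set (quadric_positions P3_1). p \<noteq> q \<longrightarrow>
     length (remdups (map (\<lambda>s. s + Pair 2 p) (unit_positions P3_1) @ map (\<lambda>s. s + Pair 2 q) (unit_positions P3_1))) \<le> 6 \<longrightarrow>
     fst p = fst q \<and> (snd q = snd p + 1 \<or> snd p = snd q + 1)"
  by code_simp

context fixed_cubic_section
begin

lemma lead_pair:
  obtains p q where "lead_positions 2 = {(2, p), (2, q)}" "p \<in> polygon y 2" "q \<in> polygon y 2"
    "(fst p = fst q \<and> snd q = snd p + 1) \<or> (y = P1_m1 \<and> snd p = snd q \<and> fst q = fst p + 1)"
proof -
  have "card (lead_positions 2) = 2" using card_lead_positions[of 2] by (simp add: power2_eq_square)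
  then obtain P Q where PQ: "lead_positions 2 = {P, Q}" "P \<noteq> Q" by (meson card_2_iff)
  then have "P \<in> Pair 2 ` polygon y 2" "Q \<in> Pair 2 ` polygon y 2" using lead_positions_subset[of 2] by auto
  then obtain p q where pq: "P = (2, p)" "p \<in> polygon y 2" "Q = (2, q)" "q \<in> polygon y 2" by blast
  let ?l = "map (\<lambda>s. s + Pair 2 p) (unit_positions y) @ map (\<lambda>s. s + Pair 2 q) (unit_positions y)"
  have "set ?l \<subseteq> lead_positions 3"
  proof
    fix s assume "s \<in> set ?l"
    then have "s \<in> (\<lambda>u. u + (2, p)) ` set (unit_positions y) \<union> (\<lambda>u. u + (2, q)) ` set (unit_positions y)"
      by (simp only: set_append set_map)
    then obtain u r where u: "u \<in> set (unit_positions y)" "s = u + r" "r \<in> {(2, p), (2, q)}" by blast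
    obtain k i j where kij: "u = (k, i, j)" by (cases u)
    then have "u = (1, i, j)" "(i, j) \<in> polygon y 1"
      using unit_positions_polygon[of k i j y] u(1) by simp_all
    then show "s \<in> lead_positions 3"
      using lead_positions_translate[of r 2 i j 1] u PQ(1) pq by (auto simp: numeral_3_eq_3 numeral_2_eq_2)
  qed
  then have "length (remdups ?l) \<le> card (lead_positions 3)"
    using card_mono[OF finite_lead_positions[of 3]] by (simp add: length_remdups_card_conv)
  also have "card (lead_positions 3) = 6" using card_lead_positions[of 3] by (simp add: power2_eq_square)
  finally have len: "length (remdups ?l) \<le> 6" .
  have "p \<noteq> q" using PQ(2) pq by auto
  show thesis
  proof (cases "y = P1_m1")
    case True
    have "(fst p = fst q \<and> (snd q = snd p + 1 \<or> snd p = snd q + 1)) \<or> (snd p = snd q \<and> (fst q = fst p + 1 \<or> fst p = fst q + 1))"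
      using adjacent_smooth len pq \<open>p \<noteq> q\<close> unfolding polygon_2 True by blast
    then show ?thesis using that[of p q] that[of q p] PQ(1) pq True by (auto simp: insert_commute)
  next
    case False
    then have e: "quadric_positions y = quadric_positions P3_1" "unit_positions y = unit_positions P3_1"
      by (simp_all add: quadric_positions_def unit_positions_def)
    have "fst p = fst q \<and> (snd q = snd p + 1 \<or> snd p = snd q + 1)"
      using adjacent_cone len pq \<open>p \<noteq> q\<close> unfolding polygon_2 e by blast
    then show ?thesis using that[of p q] that[of q p] PQ(1) pq by (auto simp: insert_commute)
  qed
qed

text \<open>A polynomial in \<open>point g\<close> splits into monomials at positions divisible by
  the equation, each a translate of one of the two given positions and so in \<open>I\<close>, and a
  rest that already vanishes on the surface.\<close>

lemma point_subset:
  assumes g: "g = (y, r, r', s, s')"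
    and M: "single (2, p) 1 \<in> image_space 2" "single (2, q) 1 \<in> image_space 2"
    and decomp: "\<And>k i j. (i, j) \<in> polygon y k \<Longrightarrow> divisible g (k, i, j) \<Longrightarrow>
      \<exists>l i' j'. (i', j') \<in> polygon y l \<and> ((k, i, j) = (l, i', j') + (2, p) \<or> (k, i, j) = (l, i', j') + (2, q))"
  shows "point g \<subseteq> I"
proof
  have mon: "single m x \<in> I" if m: "divisible g (position y m)" for m x
  proof -
    obtain k i j where pm: "position y m = (k, i, j)" by (cases "position y m")
    have "(i, j) \<in> polygon y k" using in_polygon[of y m] pm by (simp add: position_def)
    then obtain l i' j' where d: "(i', j') \<in> polygon y l"
      "(k, i, j) = (l, i', j') + (2, p) \<or> (k, i, j) = (l, i', j') + (2, q)"
      using decomp m pm by metis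
    have "single (k, i, j) 1 \<in> image_space (l + 2)"
      using image_space_translate[OF M(1) d(1)] image_space_translate[OF M(2) d(1)] d(2)
      by (auto simp: mult_single)
    then have "vscale (coef y m * x) (single (k, i, j) 1) \<in> image_space (l + 2)"
      by (rule vec.subspace_scale[OF subspace_image_space])
    then have "qmap (position y) (coef y) (single m x) \<in> image_space (l + 2)" by (simp add: pm)
    then show ?thesis by (rule in_ideal_of_image)
  qed
  fix f assume f: "f \<in> point g"
  let ?S = "{m. divisible g (position y m)}"
  have "(\<Sum>m\<in>keys (vproj ?S f). single m (lookup (vproj ?S f) m)) \<in> I"
    by (intro vec.subspace_sum[OF sub] mon) (auto simp: in_keys_iff split: if_splits)
  then have f1: "vproj ?S f \<in> I" by (simp only: sum_singles[symmetric])
  have f2: "vproj (- ?S) f \<in> surface_ideal y"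
  proof -
    have "lookup (qmap (position y) (coef y) (vproj (- ?S) f)) t = 0" for t
    proof -
      have "lookup (qmap (position y) (coef y) (vproj (- ?S) f)) t
          = (if \<not> divisible g t then lookup (qmap (position y) (coef y) f) t else 0)"
        by (rule qmap_vproj) auto
      also have "\<dots> = lookup (qmap (position y) (point_coef g) f) t"
      proof (cases "divisible g t")
        case True
        then have "lookup (qmap (position y) (point_coef g) f) t = 0"
          unfolding lookup_qmap by (intro sum.neutral) (auto simp: point_coef_def g)
        then show ?thesis using True by simp
      next
        case False
        then show ?thesis unfolding lookup_qmap by (auto simp: point_coef_def g intro!: sum.cong)
      qed
      also have "\<dots> = 0" using f by (simp add: point_def mq_def g)
      finally show ?thesis .
    qed
    then show ?thesis by (simp add: mq_def poly_mapping_eqI)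
  qed
  have "vproj ?S f + vproj (- ?S) f = f" by (rule poly_mapping_eqI) (simp add: lookup_add)
  then show "f \<in> I" using vec.subspace_add[OF sub f1] f2 surface_subset by (metis subsetD)
qed

lemma eq_point:
  assumes "valid_index g" "point g \<subseteq> I" shows "I = point g"
  using hilb_eq_of_subset[of I 3 "point g"] point_in_fixed_locus[OF assms(1)] fixed assms(2)
  by (simp add: fixed_locus_def)

section \<open>Curves on the smooth surface\<close>

lemma smooth_case:
  assumes c: "y = P1_m1" shows "\<exists>g. valid_index g \<and> fst g = y \<and> I = point g"
proof -
  obtain p q where pq: "lead_positions 2 = {(2, p), (2, q)}" "p \<in> polygon y 2" "q \<in> polygon y 2"
    "(fst p = fst q \<and> snd q = snd p + 1) \<or> (snd p = snd q \<and> fst q = fst p + 1)"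
    by (rule lead_pair) blast
  \<comment> \<open>In a fixed degree the weight determines i + 3 j, hence the position, as i is at
    most 2. So an element of one weight is a single monomial.\<close>
  have single: "single P 1 \<in> image_space 2" if P: "P \<in> lead_positions 2" for P
  proof -
    obtain F where F: "F \<in> image_space 2" "lookup F P = 1"
      "\<And>Q. lookup F Q \<noteq> 0 \<Longrightarrow> Q \<in> Pair 2 ` polygon y 2 \<and> position_weight y Q = position_weight y P \<and> slot Q \<le> slot P"
      using lead_witness[OF P] by blast
    have "Q = P" if "lookup F Q \<noteq> 0" for Q
    proof -
      have PQ: "P \<in> Pair 2 ` polygon y 2" "Q \<in> Pair 2 ` polygon y 2" "position_weight y Q = position_weight y P"
        using F(3)[OF that] lead_positions_subset P by auto
      obtain i j i' j' where "P = (2, i, j)" "Q = (2, i', j')" "i \<le> 2" "j \<le> 2" "i' \<le> 2" "j' \<le> 2"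
        using PQ(1,2) c by (auto simp: polygon_def)
      moreover from this have "i + 3 * j = i' + 3 * j'" using PQ(3) c by (simp add: position_weight_def)
      ultimately show ?thesis by (simp, presburger)
    qed
    then have "F = single P 1" using F(2) by (intro poly_mapping_eqI) (metis lookup_single_eq lookup_single_not_eq)
    then show ?thesis using F(1) by simp
  qed
  have M: "single (2, p) 1 \<in> image_space 2" "single (2, q) 1 \<in> image_space 2"
    using single pq(1) by auto
  obtain i j where p: "p = (i, j)" by (cases p)
  have ij: "i \<le> 2" "j \<le> 2" using pq(2) p c by (auto simp: polygon_def)
  from pq(4) show ?thesis
  proof
    assume a: "fst p = fst q \<and> snd q = snd p + 1"
    then have q: "q = (i, j + 1)" using p by (cases q) simp
    then have j: "j \<le> 1" using pq(3) c by (simp add: polygon_def)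
    \<comment> \<open>The common factor of the two leading monomials: p and q are its products with
      Y' and Y.\<close>
    let ?g = "(y, i, 2 - i, j, 1 - j)"
    have "i = 0 \<or> i = 1 \<or> i = 2" "j = 0 \<or> j = 1" using ij j by auto
    then have v: "valid_index ?g"
      using y(1) unfolding c by (elim disjE; simp add: valid_index_def smooth_exponents_def)
    have "point ?g \<subseteq> I"
    proof (rule point_subset[OF refl M])
      fix k i1 j1 assume "(i1, j1) \<in> polygon y k" "divisible ?g (k, i1, j1)"
      then have h: "i \<le> i1" "i1 + (2 - i) \<le> k" "j \<le> j1" "j1 + (1 - j) \<le> k"
        by (auto simp: divisible_def c)
      obtain i' where i': "i1 = i + i'" using h(1) le_Suc_ex by blast
      obtain j' where j': "j1 = j + j'" using h(3) le_Suc_ex by blast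
      have b: "i' + 2 \<le> k" "j' + 1 \<le> k" using h(2,4) ij j i' j' by auto
      then have "2 \<le> k" by simp
      then obtain l where l: "k = 2 + l" using le_Suc_ex by blast
      \<comment> \<open>The cofactor has bidegree (l, l + 1). It contains Y' if j' \<le> l and Y
        otherwise; joining this factor to the equation yields p or q.\<close>
      show "\<exists>l i' j'. (i', j') \<in> polygon y l \<and> ((k, i1, j1) = (l, i', j') + (2, p) \<or> (k, i1, j1) = (l, i', j') + (2, q))"
      proof (cases "j' \<le> l")
        case True
        then show ?thesis using i' j' l b
          by (intro exI[of _ l] exI[of _ i'] exI[of _ j']) (simp add: polygon_def c p)
      next
        case False
        then obtain u where "j' = Suc u" "u \<le> l" using b l by (cases j') auto
        then show ?thesis using i' j' l b
          by (intro exI[of _ l] exI[of _ i'] exI[of _ u]) (simp add: polygon_def c q)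
      qed
    qed
    then show ?thesis using eq_point[OF v] v by (intro exI[of _ ?g]) auto
  next
    assume a: "snd p = snd q \<and> fst q = fst p + 1"
    then have q: "q = (i + 1, j)" using p by (cases q) simp
    then have i: "i \<le> 1" using pq(3) c by (simp add: polygon_def)
    let ?g = "(y, i, 1 - i, j, 2 - j)"
    have "j = 0 \<or> j = 1 \<or> j = 2" "i = 0 \<or> i = 1" using ij i by auto
    then have v: "valid_index ?g"
      using y(1) unfolding c by (elim disjE; simp add: valid_index_def smooth_exponents_def)
    have "point ?g \<subseteq> I"
    proof (rule point_subset[OF refl M])
      fix k i1 j1 assume "(i1, j1) \<in> polygon y k" "divisible ?g (k, i1, j1)"
      then have h: "i \<le> i1" "i1 + (1 - i) \<le> k" "j \<le> j1" "j1 + (2 - j) \<le> k"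
        by (auto simp: divisible_def c)
      obtain i' where i': "i1 = i + i'" using h(1) le_Suc_ex by blast
      obtain j' where j': "j1 = j + j'" using h(3) le_Suc_ex by blast
      have b: "i' + 1 \<le> k" "j' + 2 \<le> k" using h(2,4) ij i i' j' by auto
      then have "2 \<le> k" by simp
      then obtain l where l: "k = 2 + l" using le_Suc_ex by blast
      show "\<exists>l i' j'. (i', j') \<in> polygon y l \<and> ((k, i1, j1) = (l, i', j') + (2, p) \<or> (k, i1, j1) = (l, i', j') + (2, q))"
      proof (cases "i' \<le> l")
        case True
        then show ?thesis using i' j' l b
          by (intro exI[of _ l] exI[of _ i'] exI[of _ j']) (simp add: polygon_def c p)
      next
        case False
        then obtain u where "i' = Suc u" "u \<le> l" using b l by (cases i') auto
        then show ?thesis using i' j' l b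
          by (intro exI[of _ l] exI[of _ u] exI[of _ j']) (simp add: polygon_def c q)
      qed
    qed
    then show ?thesis using eq_point[OF v] v by (intro exI[of _ ?g]) auto
  qed
qed

section \<open>Curves on the cones\<close>

text \<open>The two positions are the products of V^r S^s T^(3 - 2 r - s) with T and with S.\<close>

lemma cone_point:
  assumes c: "y \<noteq> P1_m1" and r: "2 * r + s + 1 \<le> 4"
    and M: "single (2, r, s) 1 \<in> image_space 2" "single (2, r, s + 1) 1 \<in> image_space 2"
  shows "valid_index (y, r, 0, s, 3 - 2 * r - s) \<and> I = point (y, r, 0, s, 3 - 2 * r - s)"
proof -
  let ?g = "(y, r, 0, s, 3 - 2 * r - s)"
  have "(r = 0 \<and> s \<in> {0, 1, 2, 3}) \<or> (r = 1 \<and> s \<in> {0, 1})" using r by auto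
  then have v: "valid_index ?g" using c y(1) by (auto simp: valid_index_def cone_exponents_def)
  have "point ?g \<subseteq> I"
  proof (rule point_subset[OF refl M])
    fix k i1 j1 assume "(i1, j1) \<in> polygon y k" "divisible ?g (k, i1, j1)"
    then have h: "r \<le> i1" "s \<le> j1" "2 * i1 + j1 + (3 - 2 * r - s) \<le> 2 * k"
      using c by (auto simp: divisible_def)
    then have k: "2 * i1 + j1 + 3 \<le> 2 * k + 2 * r + s" using r by linarith
    then have k2: "k \<ge> 2" using h(1,2) by linarith
    obtain i' where i': "i1 = r + i'" using h(1) le_Suc_ex by blast
    obtain j' where j': "j1 = s + j'" using h(2) le_Suc_ex by blast
    obtain l where l: "k = 2 + l" using k2 le_Suc_ex by blast
    have b: "2 * i' + j' \<le> 2 * l + 1" using k i' j' l by simp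
    show "\<exists>l i' j'. (i', j') \<in> polygon y l \<and> ((k, i1, j1) = (l, i', j') + (2, r, s) \<or> (k, i1, j1) = (l, i', j') + (2, r, s + 1))"
    proof (cases "2 * i' + j' \<le> 2 * l")
      case True
      then show ?thesis using c i' j' l
        by (intro exI[of _ l] exI[of _ i'] exI[of _ j']) (simp add: polygon_def)
    next
      case False
      \<comment> \<open>The cofactor contains no T, and its odd degree forces a factor S, so the
        second position applies.\<close>
      then have e: "2 * i' + j' = 2 * l + 1" using b by simp
      then have "odd (2 * i' + j')" by simp
      then have "j' \<noteq> 0" by (intro notI) simp
      then obtain j'' where "j' = Suc j''" using not0_implies_Suc by blast
      then show ?thesis using c i' j' l e
        by (intro exI[of _ l] exI[of _ i'] exI[of _ j'']) (simp add: polygon_def)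
    qed
  qed
  then show ?thesis using eq_point[OF v] v by auto
qed

end

context fixed_cubic_section
begin

lemma lead_position_of_single:
  assumes "single P x \<in> image_space k" "x \<noteq> 0" shows "P \<in> lead_positions k"
  unfolding lead_positions_def leads_def using assms by force

text \<open>The translates of the two leading positions already fill all six places in degree 3, and
  all of them involve V. A monomial without V would be a seventh.\<close>

lemma seven_leads:
  assumes "lead_positions 2 = {(2, 1, s), (2, 1, s + 1)}" "single (3, 0, j) x \<in> image_space 3" and y1: "y \<noteq> P1_m1"
  shows "x = 0"
proof (rule ccontr)
  assume "x \<noteq> 0"
  have T: "(3, i + 1, j' + t) \<in> lead_positions 3" if "t = s \<or> t = s + 1" "2 * i + j' \<le> 2" for i j' t
  proof -
    have "(2, 1, t) \<in> lead_positions 2" using that(1) assms(1) by auto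
    then have "(1, i, j') + (2, 1, t) \<in> lead_positions (1 + 2)"
      using that(2) y1 by (intro lead_positions_translate) (simp_all add: polygon_def)
    then show ?thesis by (simp add: numeral_3_eq_3)
  qed
  have "(3, 0, j) \<in> lead_positions 3" using lead_position_of_single[OF assms(2) \<open>x \<noteq> 0\<close>] .
  moreover have "(3, 1, s) \<in> lead_positions 3" "(3, 1, s + 1) \<in> lead_positions 3" "(3, 1, s + 2) \<in> lead_positions 3"
    "(3, 1, s + 3) \<in> lead_positions 3" "(3, 2, s) \<in> lead_positions 3" "(3, 2, s + 1) \<in> lead_positions 3"
    using T[of s 0 0] T[of s 0 1] T[of s 0 2] T[of "s + 1" 0 2] T[of s 1 0] T[of "s + 1" 1 0]
    by (simp_all add: eval_nat_numeral)
  ultimately have "{(3, 0, j), (3, 1, s), (3, 1, s + 1), (3, 1, s + 2), (3, 1, s + 3), (3, 2, s), (3, 2, s + 1)} \<subseteq> lead_positions 3"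
    by blast
  then have "card {(3::nat, 0::nat, j), (3, 1, s), (3, 1, s + 1), (3, 1, s + 2), (3, 1, s + 3), (3, 2, s), (3, 2, s + 1)} \<le> card (lead_positions 3)"
    by (rule card_mono[OF finite_lead_positions])
  moreover have "card (lead_positions 3) = 6" using card_lead_positions[of 3] by (simp add: power2_eq_square)
  ultimately show False by simp
qed

end

text \<open>The two excluded exponents stand for V T and S^3, the members of the pencil with \<beta>
  = 0 and \<alpha> = 0.\<close>

definition isolated_indices :: "index set" where
  "isolated_indices = {g. valid_index g \<and> \<not> (fst g \<in> ends \<and> snd g \<in> {(1, 0, 0, 1), (0, 0, 3, 0)})}"

context fixed_cubic_section
begin

text \<open>The hypotheses are the products of \<alpha> V T - \<beta> S^3 with T and with S. Their
  translates give all its multiples, and these reduce each class to one representative.\<close>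

lemma curve_subset:
  assumes yE: "y \<in> ends" and ab: "\<alpha> \<noteq> 0 \<or> \<beta> \<noteq> 0"
    and F: "single (2, 1, 0) \<alpha> - single (2, 0, 3) \<beta> \<in> image_space 2"
      "single (2, 1, 1) \<alpha> - single (2, 0, 4) \<beta> \<in> image_space 2"
  shows "curve y \<alpha> \<beta> \<subseteq> I"
proof
  have y1: "y \<noteq> P1_m1" using ends_coords[OF yE] by blast
  have pol: "(i, j) \<in> polygon y k \<longleftrightarrow> 2 * i + j \<le> 2 * k" for i j k using y1 by (simp add: polygon_def)
  have chain: "single (k, i + 1, j) \<alpha> - single (k, i, j + 3) \<beta> \<in> image_space k" if "2 * i + j + 3 \<le> 2 * k" for k i j
  proof -
    have "2 \<le> k" using that by linarith
    then obtain l where l: "k = 2 + l" using le_Suc_ex by blast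
    have b: "2 * i + j \<le> 2 * l + 1" using that l by simp
    show ?thesis
    proof (cases "2 * i + j \<le> 2 * l")
      case True
      then have "single (l, i, j) 1 * (single (2, 1, 0) \<alpha> - single (2, 0, 3) \<beta>) \<in> image_space (l + 2)"
        by (intro image_space_translate[OF F(1)]) (simp add: pol)
      then show ?thesis by (simp add: right_diff_distrib mult_single l add.commute)
    next
      case False
      then have e: "2 * i + j = 2 * l + 1" using b by simp
      then have "odd (2 * i + j)" by simp
      then have "j \<noteq> 0" by (intro notI) simp
      then obtain u where u: "j = Suc u" using not0_implies_Suc by blast
      then have "single (l, i, u) 1 * (single (2, 1, 1) \<alpha> - single (2, 0, 4) \<beta>) \<in> image_space (l + 2)"
        using e by (intro image_space_translate[OF F(2)]) (simp add: pol)
      then show ?thesis by (simp add: right_diff_distrib mult_single l u add.commute)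
    qed
  qed
  note subM = subspace_image_space
  \<comment> \<open>The representative of a class has the smallest i if \<alpha> is nonzero and the
    smallest j otherwise; there \<open>family_factor\<close> is nonzero and is divided out.\<close>
  define \<eta> :: "nat \<times> nat \<times> nat \<Rightarrow> (nat \<times> nat \<times> nat \<Rightarrow>\<^sub>0 complex)" where
    "\<eta> = (\<lambda>(k, t, _). if \<alpha> \<noteq> 0
       then single (k, t - 2 * k, t - 3 * (t - 2 * k)) (1 / \<alpha> ^ ((t - 3 * (t - 2 * k)) div 3))
       else single (k, t div 3, t mod 3) (1 / \<beta> ^ min (t div 3) (2 * k - (2 * (t div 3) + t mod 3))))"
  \<comment> \<open>For \<alpha> nonzero, induction on i replaces V T by (\<beta> / \<alpha>) S^3
    until V or T is used up. For \<alpha> = 0 the multiples of S^3 lie in the image space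
    outright.\<close>
  have red: "single (k, i, j) 1 - vscale (family_factor \<alpha> \<beta> (k, i, j)) (\<eta> (family_class (k, i, j))) \<in> image_space k"
    if ij: "2 * i + j \<le> 2 * k" for k i j
  proof (cases "\<alpha> = 0")
    case False
    show ?thesis
      using ij
    proof (induction i arbitrary: j)
      case 0
      then show ?case using False vec.subspace_0[OF subM]
        by (simp add: family_factor_def family_class_def \<eta>_def)
    next
      case (Suc i)
      show ?case
      proof (cases "2 * Suc i + j = 2 * k")
        case True
        then have "3 * Suc i + j - 2 * k = Suc i" "3 * Suc i + j - 3 * Suc i = j" "2 * k - (2 * Suc i + j) = 0" by simp_all
        then show ?thesis using False vec.subspace_0[OF subM]
          by (simp only: family_factor_def family_class_def \<eta>_def prod.case) simp
      next
        case F: False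
        then obtain w where w: "2 * k = 2 * Suc i + j + Suc w"
          using Suc.prems by (metis le_Suc_ex add.right_neutral not0_implies_Suc)
        have IH: "single (k, i, j + 3) 1 - vscale (family_factor \<alpha> \<beta> (k, i, j + 3)) (\<eta> (family_class (k, i, j + 3))) \<in> image_space k"
          using w by (intro Suc.IH) simp
        have cl: "family_class (k, i, j + 3) = family_class (k, Suc i, j)" by (simp add: family_class_def)
        have "2 * k - (2 * Suc i + j) = Suc w" "2 * k - (2 * i + (j + 3)) = w" unfolding w by simp_all
        moreover have "(j + 3) div 3 = Suc (j div 3)" by simp
        ultimately have ff: "family_factor \<alpha> \<beta> (k, Suc i, j) = \<beta> / \<alpha> * family_factor \<alpha> \<beta> (k, i, j + 3)"
          using False by (simp only: family_factor_def prod.case) simp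
        have "single (k, i + 1, j) \<alpha> - single (k, i, j + 3) \<beta> \<in> image_space k" using w by (intro chain) simp
        then have "vscale (1 / \<alpha>) (single (k, i + 1, j) \<alpha> - single (k, i, j + 3) \<beta>)
            + vscale (\<beta> / \<alpha>) (single (k, i, j + 3) 1 - vscale (family_factor \<alpha> \<beta> (k, i, j + 3)) (\<eta> (family_class (k, i, j + 3)))) \<in> image_space k"
          by (intro vec.subspace_add[OF subM] vec.subspace_scale[OF subM] IH)
        then show ?thesis using False
          by (simp add: vec.scale_right_diff_distrib ff cl)
      qed
    qed
  next
    case True
    then have b: "\<beta> \<noteq> 0" using ab by simp
    show ?thesis
    proof (cases "j < 3")
      case j: True
      then have "(3 * i + j) div 3 = i" "(3 * i + j) mod 3 = j" by simp_all
      then show ?thesis using True b j vec.subspace_0[OF subM]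
        by (simp add: family_factor_def family_class_def \<eta>_def)
    next
      case False
      then obtain u where u: "j = u + 3" by (metis le_Suc_ex not_less add.commute)
      then have "vscale (- 1 / \<beta>) (single (k, i + 1, u) \<alpha> - single (k, i, u + 3) \<beta>) \<in> image_space k"
        using ij by (intro vec.subspace_scale[OF subM] chain) simp
      then have "single (k, i, j) 1 \<in> image_space k"
        using True b u by (simp add: vec.scale_right_diff_distrib single_uminus)
      moreover have "family_factor \<alpha> \<beta> (k, i, j) = 0" using True u by (simp add: family_factor_def)
      ultimately show ?thesis by simp
    qed
  qed
  fix f assume f: "f \<in> curve y \<alpha> \<beta>"
  interpret fam: monomial_quotient "family_position y" "family_coef y \<alpha> \<beta>" "\<lambda>x. family_class (shift y x)" "family_mult y \<alpha> \<beta>" fst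
    by (rule family_monomial_quotient[OF yE ab])
  have "hom_component k f \<in> I" for k
  proof (rule in_ideal_of_image)
    let ?f = "hom_component k f"
    let ?F = "qmap (position y) (coef y) ?f"
    have "?f \<in> curve y \<alpha> \<beta>" using f fam.homogeneous_mq unfolding curve_def homogeneous_ideal_def by blast
    then have "qmap (family_position y) (family_coef y \<alpha> \<beta>) ?f = 0" by (simp add: curve_def mq_def)
    moreover have "qmap (family_position y) (family_coef y \<alpha> \<beta>) ?f = qmap family_class (family_factor \<alpha> \<beta>) ?F"
      unfolding family_position_def[abs_def] family_coef_def[abs_def] by (rule qmap_factor)
    ultimately have "?F \<in> mq family_class (family_factor \<alpha> \<beta>)" by (simp add: mq_def)
    moreover have "?F \<in> coord_space (Pair k ` polygon y k)"
      using hom_component_in_forms[of k f] unfolding forms_def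
      by (simp only: classes_position[OF y(1), symmetric] qmap_image[symmetric]) (rule imageI)
    moreover have "mq family_class (family_factor \<alpha> \<beta>) \<inter> coord_space (Pair k ` polygon y k) \<subseteq> image_space k"
      by (rule mq_subset_of_reduction[OF subM, of _ _ \<eta>]) (use red pol in auto)
    ultimately show "?F \<in> image_space k" by blast
  qed
  then have "(\<Sum>k\<in>mon_degree ` keys f. hom_component k f) \<in> I" by (intro vec.subspace_sum[OF sub])
  then show "f \<in> I" by (simp only: sum_hom_components[symmetric])
qed

lemma eq_curve:
  assumes "y \<in> ends" "\<alpha> \<noteq> 0 \<or> \<beta> \<noteq> 0" "curve y \<alpha> \<beta> \<subseteq> I" shows "I = curve y \<alpha> \<beta>"
  using hilb_eq_of_subset[of I 3 "curve y \<alpha> \<beta>"] curve_in_fixed_locus[OF assms(1,2)] fixed assms(3)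
  by (simp add: fixed_locus_def)

lemma cone_case:
  assumes c: "y \<noteq> P1_m1"
  shows "(\<exists>g\<in>isolated_indices. I = point g) \<or> (y \<in> ends \<and> (\<exists>\<alpha> \<beta>. (\<alpha> \<noteq> 0 \<or> \<beta> \<noteq> 0) \<and> I = curve y \<alpha> \<beta>))"
proof -
  obtain p q where pq: "lead_positions 2 = {(2, p), (2, q)}" "p \<in> polygon y 2" "q \<in> polygon y 2"
    "fst p = fst q \<and> snd q = snd p + 1"
    using c by (rule_tac lead_pair) blast
  obtain r s where p: "p = (r, s)" by (cases p)
  have q: "q = (r, s + 1)" using pq(4) p by (cases q) simp
  have L: "lead_positions 2 = {(2, r, s), (2, r, s + 1)}" using pq(1) p q by simp
  have rs: "2 * r + s + 1 \<le> 4" using pq(3) q c by (simp add: polygon_def)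
  have wt: "position_weight y (2, i, j) = position_weight y (2, i', j') \<longleftrightarrow>
      (if y \<in> ends then 3 * i + j = 3 * i' + j' else 3 * i + 2 * j = 3 * i' + 2 * j')" for i j i' j'
    using y(1) c by (rule_tac coords_cases[OF y(1)]) (auto simp: position_weight_def ends_def)
  \<comment> \<open>A second term has the same weight and a smaller slot. As r \<le> 1 this leaves
    only V replaced by S^3 / T, which requires a cone in \<open>ends\<close>; on the other cones a
    parity argument excludes it.\<close>
  have wit: "\<exists>x. single (2, r, t) 1 + single (2, 0, t + 3) x \<in> image_space 2 \<and> (x \<noteq> 0 \<longrightarrow> y \<in> ends \<and> r = 1 \<and> t \<le> 1)"
    if t: "(2, r, t) \<in> lead_positions 2" for t
  proof -
    obtain F where F: "F \<in> image_space 2" "lookup F (2, r, t) = 1"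
      "\<And>Q. lookup F Q \<noteq> 0 \<Longrightarrow> Q \<in> Pair 2 ` polygon y 2 \<and> position_weight y Q = position_weight y (2, r, t) \<and> slot Q \<le> slot (2, r, t)"
      using lead_witness[OF t] by blast
    have rt: "2 * r + t \<le> 4" using lead_positions_subset[of 2] t c by (auto simp: polygon_def)
    have Q: "Q = (2, r, t) \<or> (Q = (2, 0, t + 3) \<and> y \<in> ends \<and> r = 1 \<and> t \<le> 1)" if "lookup F Q \<noteq> 0" for Q
    proof -
      have FQ: "Q \<in> Pair 2 ` polygon y 2" "position_weight y Q = position_weight y (2, r, t)" "slot Q \<le> slot (2, r, t)"
        using F(3)[OF that] by auto
      then obtain i j where ij: "Q = (2, i, j)" "2 * i + j \<le> 4" using c by (auto simp: polygon_def)
      have w: "if y \<in> ends then 3 * i + j = 3 * r + t else 3 * i + 2 * j = 3 * r + 2 * t"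
        using FQ(2) ij(1) wt by simp
      have sl: "7 * i + j \<le> 7 * r + t" using FQ(3) ij(1) by (simp add: slot_def)
      have r: "r \<le> 1" using rs by simp
      have ir: "i \<le> r" using sl ij(2) rt by linarith
      show ?thesis
      proof (cases "i = r")
        case True
        then show ?thesis using w ij(1) by (auto split: if_splits)
      next
        case False
        then have i: "i = 0" "r = 1" using ir r by auto
        have "y \<in> ends"
        proof (rule ccontr)
          assume "y \<notin> ends"
          then have "2 * j = 3 + 2 * t" using w i by simp
          then show False by presburger
        qed
        then show ?thesis using w i ij by auto
      qed
    qed
    show ?thesis
    proof (cases "y \<in> ends \<and> r = 1 \<and> t \<le> 1")
      case True
      have "F = single (2, r, t) 1 + single (2, 0, t + 3) (lookup F (2, 0, t + 3))"
      proof (rule poly_mapping_eqI)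
        fix Q show "lookup F Q = lookup (single (2, r, t) 1 + single (2, 0, t + 3) (lookup F (2, 0, t + 3))) Q"
          using Q[of Q] F(2) True by (auto simp: lookup_add lookup_single when_def)
      qed
      then show ?thesis using F(1) True by (intro exI[of _ "lookup F (2, 0, t + 3)"]) auto
    next
      case False
      have "F = single (2, r, t) 1 + single (2, 0, t + 3) 0"
      proof (rule poly_mapping_eqI)
        fix Q show "lookup F Q = lookup (single (2, r, t) 1 + single (2, 0, t + 3) 0) Q"
          using Q[of Q] F(2) False by (auto simp: lookup_single when_def)
      qed
      then show ?thesis using F(1) by (intro exI[of _ 0]) auto
    qed
  qed
  obtain x where x: "single (2, r, s) 1 + single (2, 0, s + 3) x \<in> image_space 2" "x \<noteq> 0 \<longrightarrow> y \<in> ends \<and> r = 1 \<and> s \<le> 1"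
    using wit[of s] L by blast
  obtain x' where x': "single (2, r, s + 1) 1 + single (2, 0, s + 1 + 3) x' \<in> image_space 2" "x' \<noteq> 0 \<longrightarrow> y \<in> ends \<and> r = 1 \<and> s + 1 \<le> 1"
    using wit[of "s + 1"] L by blast
  note subM = subspace_image_space
  show ?thesis
  proof (cases "y \<in> ends \<and> r = 1 \<and> s = 0")
    case True
    \<comment> \<open>The leading terms cancel: S T (V T^2 + x S^3 T) - T^2 (V S T + x' S^4) = (x -
      x') S^4 T^2. By \<open>seven_leads\<close> the coefficient is 0, so both elements are
      multiples of V T + x S^3.\<close>
    have "single (1, 0, 1) 1 * (single (2, r, s) 1 + single (2, 0, s + 3) x) \<in> image_space (1 + 2)"
      using c by (intro image_space_translate[OF x(1)]) (simp add: polygon_def)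
    moreover have "single (1, 0, 0) 1 * (single (2, r, s + 1) 1 + single (2, 0, s + 1 + 3) x') \<in> image_space (1 + 2)"
      using c by (intro image_space_translate[OF x'(1)]) (simp add: polygon_def)
    ultimately have "single (1, 0, 1) 1 * (single (2, r, s) 1 + single (2, 0, s + 3) x)
        - single (1, 0, 0) 1 * (single (2, r, s + 1) 1 + single (2, 0, s + 1 + 3) x') \<in> image_space (1 + 2)"
      by (rule vec.subspace_diff[OF subM])
    then have "single (3, 0, 4) (x - x') \<in> image_space 3"
      using True by (simp add: distrib_left mult_single single_diff numeral_3_eq_3 numeral_2_eq_2 eval_nat_numeral)
    then have "x - x' = 0" using L True c by (intro seven_leads[of s 4]) auto
    then have xx: "x' = x" by simp
    have "curve y 1 (- x) \<subseteq> I"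
      using x(1) x'(1) True xx by (intro curve_subset) (auto simp: single_uminus)
    then show ?thesis using eq_curve[of 1 "- x"] True by (intro disjI2) (metis zero_neq_one)
  next
    case False
    have "x' = 0" using x'(2) False by auto
    then have M2: "single (2, r, s + 1) 1 \<in> image_space 2" using x'(1) by simp
    \<comment> \<open>For r = s = 1, S^2 (V S T + x S^4) - S T (V S^2) = x S^6, which
      \<open>seven_leads\<close> again excludes.\<close>
    have "x = 0"
    proof (rule ccontr)
      assume "x \<noteq> 0"
      then have rs1: "r = 1" "s = 1" "y \<in> ends" using x(2) False by auto
      have "single (1, 0, 2) 1 * (single (2, r, s) 1 + single (2, 0, s + 3) x) \<in> image_space (1 + 2)"
        using c by (intro image_space_translate[OF x(1)]) (simp add: polygon_def)
      moreover have "single (1, 0, 1) 1 * single (2, r, s + 1) 1 \<in> image_space (1 + 2)"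
        using c by (intro image_space_translate[OF M2]) (simp add: polygon_def)
      ultimately have "single (1, 0, 2) 1 * (single (2, r, s) 1 + single (2, 0, s + 3) x)
          - single (1, 0, 1) 1 * single (2, r, s + 1) 1 \<in> image_space (1 + 2)"
        by (rule vec.subspace_diff[OF subM])
      then have "single (3, 0, 6) x \<in> image_space 3"
        using rs1 by (simp add: distrib_left mult_single eval_nat_numeral)
      then have "x = 0" using L rs1 c by (intro seven_leads[of s 6]) auto
      then show False using \<open>x \<noteq> 0\<close> by simp
    qed
    then have M1: "single (2, r, s) 1 \<in> image_space 2" using x(1) by simp
    show ?thesis
    \<comment> \<open>Here the leading monomials are S^3 T and S^4, and the curve is the member S^3
      of the pencil.\<close>
    proof (cases "y \<in> ends \<and> r = 0 \<and> s = 3")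
      case T: True
      have "curve y 0 (- 1) \<subseteq> I"
        using M1 M2 T by (intro curve_subset) (auto simp: single_uminus)
      then show ?thesis using eq_curve[of 0 "- 1"] T by (intro disjI2) (metis neg_equal_0_iff_equal zero_neq_one)
    next
      case F: False
      let ?g = "(y, r, 0, s, 3 - 2 * r - s)"
      have "valid_index ?g \<and> I = point ?g" by (rule cone_point[OF c rs M1 M2])
      moreover have "?g \<in> isolated_indices"
        using calculation F False rs by (auto simp: isolated_indices_def)
      ultimately show ?thesis by blast
    qed
  qed
qed

end

theorem fixed_locus_cases:
  assumes "I \<in> fixed_locus 3"
  shows "(\<exists>g\<in>isolated_indices. I = point g) \<or> (\<exists>y\<in>ends. \<exists>\<alpha> \<beta>. (\<alpha> \<noteq> 0 \<or> \<beta> \<noteq> 0) \<and> I = curve y \<alpha> \<beta>)"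
proof -
  interpret fixed_cubic I by standard (rule assms)
  obtain y where y: "y \<in> coords" "var y \<in> I" using ex_var by blast
  interpret fixed_cubic_section I y by standard (rule y)+
  show ?thesis
  proof (cases "y = P1_m1")
    case True
    then obtain g where "valid_index g" "fst g = y" "I = point g" using smooth_case by blast
    moreover have "g \<in> isolated_indices" using calculation True by (simp add: isolated_indices_def ends_def)
    ultimately show ?thesis by blast
  next
    case False
    then show ?thesis using cone_case by blast
  qed
qed

text \<open>As a rewrite rule, this reassociates every product and makes associativity loop.\<close>

declare ring_mod.scale_scale [simp del]

subsection \<open>Rational functions in chart coordinates\<close>

lemma peval_superset:
  assumes "finite S" "keys p \<subseteq> S"
  shows "peval p a = (\<Sum>m\<in>S. lookup p m * mon_prod a m)"
  unfolding peval_def mon_prod_def using assms by (intro sum.mono_neutral_left) (auto simp: in_keys_iff)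

lemma peval_eq: "peval p a = (\<Sum>m\<in>keys p. lookup p m * mon_prod a m)"
  by (rule peval_superset) simp_all

lemma peval_add: "peval (p + q) a = peval p a + peval q a"
proof -
  have "keys (p + q) \<subseteq> keys p \<union> keys q" by (rule keys_add)
  then show ?thesis
    by (simp add: peval_superset[of "keys p \<union> keys q"] lookup_add distrib_right sum.distrib)
qed

lemma peval_single [simp]: "peval (single m x) a = x * mon_prod a m"
  by (simp add: peval_eq)

lemma peval_0 [simp]: "peval 0 a = 0"
  by (simp add: peval_eq)

lemma peval_sum: "peval (\<Sum>x\<in>A. f x) a = (\<Sum>x\<in>A. peval (f x) a)"
  by (induction A rule: infinite_finite_induct) (simp_all add: peval_add)

lemma peval_single_mult: "peval (single m x * q) a = x * mon_prod a m * peval q a"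
  unfolding single_times peval_sum peval_eq[of q] sum_distrib_left
  by (intro sum.cong refl) (simp add: mult_ac)

lemma peval_mult: "peval (p * q) a = peval p a * peval q a"
proof -
  have "p * q = (\<Sum>m\<in>keys p. single m (lookup p m)) * q" by (rule arg_cong[OF sum_singles])
  then have "peval (p * q) a = (\<Sum>m\<in>keys p. peval (single m (lookup p m) * q) a)"
    by (simp only: sum_distrib_right peval_sum)
  then show ?thesis by (simp only: peval_single_mult peval_eq[of p] sum_distrib_right)
qed

lemma peval_1 [simp]: "peval 1 a = 1"
  using peval_single[of 0 1 a] by simp

text \<open>A single quotient on all of N; locality is left to the choice of N.\<close>

definition rational_on :: "('x \<Rightarrow> 'i \<Rightarrow> complex) \<Rightarrow> 'x set \<Rightarrow> ('x \<Rightarrow> complex) \<Rightarrow> bool" where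
  "rational_on u N f \<longleftrightarrow> (\<exists>p q. \<forall>x\<in>N. peval q (u x) \<noteq> 0 \<and> f x = peval p (u x) / peval q (u x))"

lemma rational_on_subset: "rational_on u N f \<Longrightarrow> M \<subseteq> N \<Longrightarrow> rational_on u M f"
  unfolding rational_on_def by blast

lemma rational_on_cong: "(\<And>x. x \<in> N \<Longrightarrow> f x = g x) \<Longrightarrow> rational_on u N f \<longleftrightarrow> rational_on u N g"
  unfolding rational_on_def by simp

lemma rational_on_const: "rational_on u N (\<lambda>x. a)"
  unfolding rational_on_def by (intro exI[of _ "single 0 a"] exI[of _ 1]) simp

lemma rational_on_coord: "rational_on u N (\<lambda>x. u x i)"
  unfolding rational_on_def by (intro exI[of _ "single (single i 1) 1"] exI[of _ 1]) simp

lemma rational_on_add: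
  assumes "rational_on u N f" "rational_on u N g" shows "rational_on u N (\<lambda>x. f x + g x)"
proof -
  obtain p q p' q' where "\<forall>x\<in>N. peval q (u x) \<noteq> 0 \<and> f x = peval p (u x) / peval q (u x)"
    "\<forall>x\<in>N. peval q' (u x) \<noteq> 0 \<and> g x = peval p' (u x) / peval q' (u x)"
    using assms unfolding rational_on_def by metis
  then show ?thesis unfolding rational_on_def
    by (intro exI[of _ "p * q' + p' * q"] exI[of _ "q * q'"]) (simp add: peval_add peval_mult add_frac_eq)
qed

lemma rational_on_mult:
  assumes "rational_on u N f" "rational_on u N g" shows "rational_on u N (\<lambda>x. f x * g x)"
proof -
  obtain p q p' q' where "\<forall>x\<in>N. peval q (u x) \<noteq> 0 \<and> f x = peval p (u x) / peval q (u x)"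
    "\<forall>x\<in>N. peval q' (u x) \<noteq> 0 \<and> g x = peval p' (u x) / peval q' (u x)"
    using assms unfolding rational_on_def by metis
  then show ?thesis unfolding rational_on_def
    by (intro exI[of _ "p * p'"] exI[of _ "q * q'"]) (simp add: peval_mult)
qed

lemma rational_on_divide:
  assumes "rational_on u N f" "rational_on u N g" "\<And>x. x \<in> N \<Longrightarrow> g x \<noteq> 0"
  shows "rational_on u N (\<lambda>x. f x / g x)"
proof -
  obtain p q p' q' where "\<forall>x\<in>N. peval q (u x) \<noteq> 0 \<and> f x = peval p (u x) / peval q (u x)"
    "\<forall>x\<in>N. peval q' (u x) \<noteq> 0 \<and> g x = peval p' (u x) / peval q' (u x)"
    using assms(1,2) unfolding rational_on_def by metis
  then show ?thesis using assms(3) unfolding rational_on_def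
    by (intro exI[of _ "p * q'"] exI[of _ "q * p'"]) (auto simp: peval_mult)
qed

lemma rational_on_power: "rational_on u N f \<Longrightarrow> rational_on u N (\<lambda>x. f x ^ n)"
  by (induction n) (simp_all add: rational_on_const rational_on_mult)

lemma rational_on_sum:
  "(\<And>i. i \<in> A \<Longrightarrow> rational_on u N (f i)) \<Longrightarrow> rational_on u N (\<lambda>x. \<Sum>i\<in>A. f i x)"
  by (induction A rule: infinite_finite_induct) (simp_all add: rational_on_const rational_on_add)

lemma rational_on_prod:
  "(\<And>i. i \<in> A \<Longrightarrow> rational_on u N (f i)) \<Longrightarrow> rational_on u N (\<lambda>x. \<Prod>i\<in>A. f i x)"
  by (induction A rule: infinite_finite_induct) (simp_all add: rational_on_const rational_on_mult)

lemma rational_on_peval: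
  assumes "\<And>i. rational_on u N (\<lambda>x. v x i)" shows "rational_on u N (\<lambda>x. peval p (v x))"
  unfolding peval_def
  by (intro rational_on_sum rational_on_mult rational_on_const rational_on_prod rational_on_power assms)

subsection \<open>Morphisms between subvarieties of Grassmannians\<close>

abbreviation emb_topology :: "'b set \<Rightarrow> nat \<Rightarrow> 'a set \<Rightarrow> ('a \<Rightarrow> ('b \<Rightarrow>\<^sub>0 complex) set) \<Rightarrow> 'a topology" where
  "emb_topology B c X e \<equiv> pullback_topology X e (gr_zariski B c)"

lemma Top_embedded: "Top (embedded_variety B c X e) = emb_topology B c X e"
  by (simp add: embedded_variety_def Let_def)

lemma Reg_embedded:
  "f \<in> Reg (embedded_variety B c X e) U \<longleftrightarrow> (\<forall>x\<in>U. \<exists>N J. openin (emb_topology B c X e) N \<and> x \<in> N \<and> N \<subseteq> U \<and>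
     J \<in> gr_index B c \<and> (\<forall>y\<in>N. e y \<in> gr_chart B c J) \<and> rational_on (\<lambda>y. gr_coord B J (e y)) N f)"
proof -
  have "(\<exists>N J p q. A N \<and> B' N \<and> C N \<and> D J \<and> (\<forall>y\<in>N. E J y \<and> P J p q y)) \<longleftrightarrow>
      (\<exists>N J. A N \<and> B' N \<and> C N \<and> D J \<and> (\<forall>y\<in>N. E J y) \<and> (\<exists>p q. \<forall>y\<in>N. P J p q y))"
    for A B' C :: "'a set \<Rightarrow> bool" and D :: "'b set \<Rightarrow> bool" and E :: "'b set \<Rightarrow> 'a \<Rightarrow> bool"
      and P :: "'b set \<Rightarrow> ('b \<times> 'b) cpoly \<Rightarrow> ('b \<times> 'b) cpoly \<Rightarrow> 'a \<Rightarrow> bool"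
    by blast
  then show ?thesis
    by (simp add: embedded_variety_def Let_def rational_on_def)
qed

lemma openin_gr_basic:
  "J \<in> gr_index B c \<Longrightarrow> openin (gr_zariski B c) {W \<in> gr_chart B c J. peval p (gr_coord B J W) \<noteq> 0}"
  unfolding gr_zariski_def by (intro topology_generated_by_Basis) blast

lemma openin_chart: "J \<in> gr_index B c \<Longrightarrow> openin (emb_topology B c X e) {x \<in> X. e x \<in> gr_chart B c J}"
  using openin_gr_basic[of J B c 1] unfolding openin_pullback_topology
  by (intro exI[of _ "{W \<in> gr_chart B c J. peval 1 (gr_coord B J W) \<noteq> 0}"]) auto

lemma topspace_emb: "topspace (emb_topology B c X e) = {x \<in> X. \<exists>J\<in>gr_index B c. e x \<in> gr_chart B c J}"
proof -
  have "(\<Union>{{W \<in> gr_chart B c J. peval p (gr_coord B J W) \<noteq> 0} |J p. J \<in> gr_index B c})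
      = {W. \<exists>J\<in>gr_index B c. W \<in> gr_chart B c J}"
  proof
    show "{W. \<exists>J\<in>gr_index B c. W \<in> gr_chart B c J}
        \<subseteq> (\<Union>{{W \<in> gr_chart B c J. peval p (gr_coord B J W) \<noteq> 0} |J p. J \<in> gr_index B c})"
    proof
      fix W assume "W \<in> {W. \<exists>J\<in>gr_index B c. W \<in> gr_chart B c J}"
      then obtain J where "J \<in> gr_index B c" "W \<in> {W \<in> gr_chart B c J. peval 1 (gr_coord B J W) \<noteq> 0}" by auto
      then show "W \<in> (\<Union>{{W \<in> gr_chart B c J. peval p (gr_coord B J W) \<noteq> 0} |J p. J \<in> gr_index B c})" by blast
    qed
  qed auto
  then show ?thesis
    unfolding topspace_pullback_topology gr_zariski_def topology_generated_by_topspace by auto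
qed

lemma openin_rational:
  assumes N: "openin (emb_topology B c X e) N" "\<And>x. x \<in> N \<Longrightarrow> e x \<in> gr_chart B c J" and J: "J \<in> gr_index B c"
    and f: "rational_on (\<lambda>x. gr_coord B J (e x)) N f"
  shows "openin (emb_topology B c X e) {x \<in> N. f x \<noteq> 0}"
proof -
  obtain p q where pq: "\<And>x. x \<in> N \<Longrightarrow> peval q (gr_coord B J (e x)) \<noteq> 0 \<and>
      f x = peval p (gr_coord B J (e x)) / peval q (gr_coord B J (e x))"
    using f unfolding rational_on_def by blast
  have NX: "N \<subseteq> X" using openin_subset[OF N(1)] unfolding topspace_emb by auto
  have "openin (emb_topology B c X e) (e -` {W \<in> gr_chart B c J. peval p (gr_coord B J W) \<noteq> 0} \<inter> X)"
    using openin_gr_basic[OF J] unfolding openin_pullback_topology by blast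
  then have "openin (emb_topology B c X e) (N \<inter> (e -` {W \<in> gr_chart B c J. peval p (gr_coord B J W) \<noteq> 0} \<inter> X))"
    by (rule openin_Int[OF N(1)])
  moreover have "N \<inter> (e -` {W \<in> gr_chart B c J. peval p (gr_coord B J W) \<noteq> 0} \<inter> X) = {x \<in> N. f x \<noteq> 0}"
    using pq N(2) NX by auto
  ultimately show ?thesis by simp
qed

text \<open>Basic open sets and regular functions of the target are made from chart coordinates, so
  it suffices that these pull back to locally rational functions of chart coordinates of the
  source.\<close>

lemma is_morphismI:
  assumes top: "\<And>x. x \<in> topspace (emb_topology B c X e) \<Longrightarrow> \<phi> x \<in> topspace (emb_topology B' c' X' e')"
    and loc: "\<And>x J'. x \<in> topspace (emb_topology B c X e) \<Longrightarrow> J' \<in> gr_index B' c' \<Longrightarrow> e' (\<phi> x) \<in> gr_chart B' c' J' \<Longrightarrow>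
      \<exists>N J. openin (emb_topology B c X e) N \<and> x \<in> N \<and> J \<in> gr_index B c \<and>
        (\<forall>y\<in>N. e y \<in> gr_chart B c J \<and> e' (\<phi> y) \<in> gr_chart B' c' J') \<and>
        (\<forall>i. rational_on (\<lambda>y. gr_coord B J (e y)) N (\<lambda>y. gr_coord B' J' (e' (\<phi> y)) i))"
  shows "is_morphism (embedded_variety B c X e) (embedded_variety B' c' X' e') \<phi>"
proof -
  let ?T = "emb_topology B c X e"
  let ?S = "{{W \<in> gr_chart B' c' J. peval p (gr_coord B' J W) \<noteq> 0} |J p. J \<in> gr_index B' c'}"
  have "continuous_map ?T (topology_generated_by ?S) (e' \<circ> \<phi>)"
  proof (rule continuous_on_generated_topo)
    fix U assume "U \<in> ?S"
    then obtain J' p where U: "J' \<in> gr_index B' c'" "U = {W \<in> gr_chart B' c' J'. peval p (gr_coord B' J' W) \<noteq> 0}" by blast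
    show "openin ?T ((e' \<circ> \<phi>) -` U \<inter> topspace ?T)"
    proof (rule openin_subopen[THEN iffD2], rule ballI)
      fix x assume "x \<in> (e' \<circ> \<phi>) -` U \<inter> topspace ?T"
      then have x: "x \<in> topspace ?T" "e' (\<phi> x) \<in> gr_chart B' c' J'" "peval p (gr_coord B' J' (e' (\<phi> x))) \<noteq> 0"
        using U(2) by auto
      then obtain N J where N: "openin ?T N" "x \<in> N" "J \<in> gr_index B c"
        "\<And>y. y \<in> N \<Longrightarrow> e y \<in> gr_chart B c J" "\<And>y. y \<in> N \<Longrightarrow> e' (\<phi> y) \<in> gr_chart B' c' J'"
        "\<And>i. rational_on (\<lambda>y. gr_coord B J (e y)) N (\<lambda>y. gr_coord B' J' (e' (\<phi> y)) i)"
        using loc[OF x(1) U(1) x(2)] by blast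
      have "openin ?T {y \<in> N. peval p (gr_coord B' J' (e' (\<phi> y))) \<noteq> 0}"
        using N by (intro openin_rational rational_on_peval)
      moreover have "{y \<in> N. peval p (gr_coord B' J' (e' (\<phi> y))) \<noteq> 0} \<subseteq> (e' \<circ> \<phi>) -` U \<inter> topspace ?T"
        using N(5) openin_subset[OF N(1)] U(2) by auto
      ultimately show "\<exists>V. openin ?T V \<and> x \<in> V \<and> V \<subseteq> (e' \<circ> \<phi>) -` U \<inter> topspace ?T"
        using N(2) x(3) by blast
    qed
  next
    show "(e' \<circ> \<phi>) ` topspace ?T \<subseteq> \<Union> ?S"
      using top unfolding topspace_pullback_topology[of X'] gr_zariski_def[of B' c'] topology_generated_by_topspace by auto
  qed
  then have "continuous_map ?T (gr_zariski B' c') (e' \<circ> \<phi>)" unfolding gr_zariski_def[of B' c'] .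
  then have cont: "continuous_map ?T (emb_topology B' c' X' e') \<phi>"
    by (rule continuous_map_pullback') (use top in \<open>auto simp: topspace_emb\<close>)
  have "f \<circ> \<phi> \<in> Reg (embedded_variety B c X e) {x \<in> topspace ?T. \<phi> x \<in> V}"
    if V: "openin (emb_topology B' c' X' e') V" "f \<in> Reg (embedded_variety B' c' X' e') V" for V f
    unfolding Reg_embedded
  proof
    fix x assume "x \<in> {x \<in> topspace ?T. \<phi> x \<in> V}"
    then have x: "x \<in> topspace ?T" "\<phi> x \<in> V" by auto
    from V(2)[unfolded Reg_embedded, THEN bspec, OF x(2)]
    obtain N' J' where N': "openin (emb_topology B' c' X' e') N'" "\<phi> x \<in> N'" "N' \<subseteq> V" "J' \<in> gr_index B' c'"
      "\<And>y. y \<in> N' \<Longrightarrow> e' y \<in> gr_chart B' c' J'" "rational_on (\<lambda>y. gr_coord B' J' (e' y)) N' f"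
      by blast
    obtain N J where N: "openin ?T N" "x \<in> N" "J \<in> gr_index B c"
        "\<And>y. y \<in> N \<Longrightarrow> e y \<in> gr_chart B c J"
        "\<And>i. rational_on (\<lambda>y. gr_coord B J (e y)) N (\<lambda>y. gr_coord B' J' (e' (\<phi> y)) i)"
      using loc[OF x(1) N'(4) N'(5)[OF N'(2)]] by blast
    let ?M = "N \<inter> {x \<in> topspace ?T. \<phi> x \<in> N'}"
    have M: "openin ?T ?M" by (intro openin_Int N(1) openin_continuous_map_preimage[OF cont N'(1)])
    obtain p q where pq: "\<And>y. y \<in> N' \<Longrightarrow> peval q (gr_coord B' J' (e' y)) \<noteq> 0 \<and>
        f y = peval p (gr_coord B' J' (e' y)) / peval q (gr_coord B' J' (e' y))"
      using N'(6) unfolding rational_on_def by blast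
    have "rational_on (\<lambda>y. gr_coord B J (e y)) ?M
        (\<lambda>y. peval p (gr_coord B' J' (e' (\<phi> y))) / peval q (gr_coord B' J' (e' (\<phi> y))))"
      using pq by (intro rational_on_divide rational_on_peval rational_on_subset[OF N(5)]) auto
    then have "rational_on (\<lambda>y. gr_coord B J (e y)) ?M (f \<circ> \<phi>)"
      by (rule iffD1[OF rational_on_cong, rotated]) (use pq in auto)
    then show "\<exists>N J. openin ?T N \<and> x \<in> N \<and> N \<subseteq> {x \<in> topspace ?T. \<phi> x \<in> V} \<and> J \<in> gr_index B c \<and>
        (\<forall>y\<in>N. e y \<in> gr_chart B c J) \<and> rational_on (\<lambda>y. gr_coord B J (e y)) N (f \<circ> \<phi>)"
      using M N N'(2,3) x(1) by (intro exI[of _ ?M] exI[of _ J]) auto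
  qed
  then show ?thesis unfolding is_morphism_def Top_embedded using cont by blast
qed

subsection \<open>Charts and coordinates of monomial quotients\<close>

lemma mq_grassmannian:
  assumes "finite B" "card (classes \<pi> c B) = n"
  shows "mq \<pi> c \<inter> coord_space B \<in> grassmannian B n"
  using dim_mq_Int[OF assms(1), of \<pi> c] assms(2)
  by (simp add: grassmannian_def vec.subspace_inter)

text \<open>A vector supported on \<open>J\<close> lies in the kernel iff its weighted coefficients
  cancel within each class. So the charts that contain the kernel are the transversals of its
  classes.\<close>

lemma mq_chart:
  assumes B: "finite B" "card (classes \<pi> c B) = n" and J: "J \<in> gr_index B n"
  shows "mq \<pi> c \<inter> coord_space B \<in> gr_chart B n J \<longleftrightarrow> inj_on \<pi> J \<and> (\<forall>j\<in>J. c j \<noteq> 0)"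
proof
  have JB: "J \<subseteq> B" using J by (simp add: gr_index_def)
  assume "mq \<pi> c \<inter> coord_space B \<in> gr_chart B n J"
  then have z: "f = 0" if "f \<in> mq \<pi> c" "f \<in> coord_space J" for f
    using that coord_space_mono[OF JB] unfolding gr_chart_def by blast
  have c: "c j \<noteq> 0" if "j \<in> J" for j
  proof
    assume "c j = 0"
    then have "single j 1 = (0 :: 'a \<Rightarrow>\<^sub>0 complex)" using that by (intro z) (auto simp: mq_def single_in_coord_space)
    then show False by (metis lookup_single_eq lookup_zero one_neq_zero)
  qed
  moreover have "inj_on \<pi> J"
  proof (rule inj_onI, rule ccontr)
    fix i j assume ij: "i \<in> J" "j \<in> J" "\<pi> i = \<pi> j" "i \<noteq> j"
    let ?f = "single i (c j) - single j (c i)"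
    have "?f = 0"
      using ij by (intro z vec.subspace_diff[OF subspace_coord_space] single_in_coord_space)
        (simp_all add: mq_def qmap_minus mult.commute)
    then have "lookup ?f i = 0" by simp
    then show False using ij c by (simp add: lookup_minus lookup_single)
  qed
  ultimately show "inj_on \<pi> J \<and> (\<forall>j\<in>J. c j \<noteq> 0)" by blast
next
  have JB: "J \<subseteq> B" using J by (simp add: gr_index_def)
  assume *: "inj_on \<pi> J \<and> (\<forall>j\<in>J. c j \<noteq> 0)"
  have "f = 0" if f: "f \<in> mq \<pi> c" "f \<in> coord_space J" for f
  proof (rule poly_mapping_eqI, rule ccontr)
    fix j assume "lookup f j \<noteq> lookup 0 j"
    then have j: "lookup f j \<noteq> 0" "j \<in> J" using f(2) by (auto simp: in_coord_space)
    have kJ: "keys f \<subseteq> J" using f(2) by (simp add: coord_space_def)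
    have "finite J" using JB B(1) finite_subset by blast
    then have "lookup (qmap \<pi> c f) (\<pi> j) = (\<Sum>b\<in>J. if \<pi> b = \<pi> j then c b * lookup f b else 0)"
      using kJ by (rule lookup_qmap_superset)
    also have "\<dots> = (\<Sum>b\<in>J. if b = j then c j * lookup f j else 0)"
      using * j(2) by (intro sum.cong) (auto dest: inj_onD)
    also have "\<dots> = c j * lookup f j" using \<open>finite J\<close> j(2) by simp
    finally show False using f(1) * j by (simp add: mq_def)
  qed
  then have "(mq \<pi> c \<inter> coord_space B) \<inter> coord_space J = {0}"
    by (auto simp: mq_def in_coord_space)
  then show "mq \<pi> c \<inter> coord_space B \<in> gr_chart B n J"
    unfolding gr_chart_def using mq_grassmannian[OF B] by blast
qed

text \<open>Modulo the kernel, b is \<open>c b / c j\<close> times the element j of \<open>J\<close>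
  in its class, or zero.\<close>

lemma mq_coord:
  assumes B: "finite B" "card (classes \<pi> c B) = n" and J: "J \<in> gr_index B n"
    and ch: "mq \<pi> c \<inter> coord_space B \<in> gr_chart B n J"
  shows "gr_coord B J (mq \<pi> c \<inter> coord_space B) (b, j) = (if b \<in> B \<and> j \<in> J \<and> \<pi> b = \<pi> j then c b / c j else 0)"
proof (cases "b \<in> B \<and> j \<in> J")
  case True
  have JB: "J \<subseteq> B" "card J = n" using J by (simp_all add: gr_index_def)
  have inj: "inj_on \<pi> J" and c: "\<And>j. j \<in> J \<Longrightarrow> c j \<noteq> 0" using ch mq_chart[OF B J] by auto
  let ?W = "mq \<pi> c \<inter> coord_space B"
  have W: "vec.subspace ?W" by (simp add: vec.subspace_inter)
  have uniq: "r = r'" if "r \<in> coord_space J \<and> single b 1 - r \<in> ?W" "r' \<in> coord_space J \<and> single b 1 - r' \<in> ?W" for r r'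
  proof -
    have "(single b 1 - r') - (single b 1 - r) \<in> ?W"
      by (rule vec.subspace_diff[OF W conjunct2[OF that(2)] conjunct2[OF that(1)]])
    moreover have "(single b 1 - r') - (single b 1 - r) = r - r'" by simp
    ultimately have "r - r' \<in> ?W \<inter> coord_space J"
      using vec.subspace_diff[OF subspace_coord_space conjunct1[OF that(1)] conjunct1[OF that(2)]] by simp
    moreover have "?W \<inter> coord_space J = {0}" using ch by (simp add: gr_chart_def)
    ultimately have "r - r' = 0" by blast
    then show ?thesis by simp
  qed
  define r where "r = (if c b = 0 then 0 else single (the_inv_into J \<pi> (\<pi> b)) (c b / c (the_inv_into J \<pi> (\<pi> b))))"
  have surj: "the_inv_into J \<pi> (\<pi> b) \<in> J \<and> \<pi> (the_inv_into J \<pi> (\<pi> b)) = \<pi> b" if "c b \<noteq> 0"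
  proof -
    have "\<pi> ` J \<subseteq> classes \<pi> c B" using JB c by (auto simp: classes_def)
    moreover have "card (\<pi> ` J) = card (classes \<pi> c B)" using inj JB(2) B(2) by (simp add: card_image)
    ultimately have "\<pi> ` J = classes \<pi> c B" by (intro card_subset_eq finite_classes B(1))
    then have "\<pi> b \<in> \<pi> ` J" using that True by (auto simp: classes_def)
    then show ?thesis using inj by (simp add: the_inv_into_into f_the_inv_into_f)
  qed
  have r: "r \<in> coord_space J \<and> single b 1 - r \<in> ?W"
  proof (cases "c b = 0")
    case T: True
    then show ?thesis using True
      by (simp add: r_def mq_def single_in_coord_space vec.subspace_0)
  next
    case False
    note s = surj[OF False]
    have "r \<in> coord_space J" using s False by (simp add: r_def single_in_coord_space)
    moreover have "single b 1 - r \<in> coord_space B"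
      using coord_space_mono[OF JB(1)] calculation True
      by (intro vec.subspace_diff[OF subspace_coord_space] single_in_coord_space) auto
    moreover have "qmap \<pi> c (single b 1 - r) = 0" using s False c[of "the_inv_into J \<pi> (\<pi> b)"]
      by (simp add: qmap_minus r_def)
    ultimately show ?thesis by (simp add: mq_def)
  qed
  then have "(THE r. r \<in> coord_space J \<and> single b 1 - r \<in> ?W) = r" using uniq by (intro the_equality) auto
  then have "gr_coord B J ?W (b, j) = lookup r j" using True by (simp add: gr_coord_def)
  also have "\<dots> = (if \<pi> b = \<pi> j then c b / c j else 0)"
  proof (cases "c b = 0")
    case False
    have "the_inv_into J \<pi> (\<pi> b) = j \<longleftrightarrow> \<pi> b = \<pi> j"
      using surj[OF False] inj True by (metis inj_onD)
    then show ?thesis using False by (auto simp: r_def lookup_single when_def)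
  qed (simp add: r_def)
  finally show ?thesis using True by simp
qed (auto simp: gr_coord_def)

text \<open>A partial transversal extends to a full one: representatives are taken from
  \<open>S\<close> where \<open>S\<close> meets the class and arbitrarily elsewhere.\<close>

lemma ex_chart:
  assumes B: "finite B" "card (classes \<pi> c B) = n"
    and S: "S \<subseteq> B" "inj_on \<pi> S" "\<And>s. s \<in> S \<Longrightarrow> c s \<noteq> 0"
  shows "\<exists>J\<in>gr_index B n. S \<subseteq> J \<and> mq \<pi> c \<inter> coord_space B \<in> gr_chart B n J"
proof -
  have "\<exists>b\<in>B. c b \<noteq> 0 \<and> \<pi> b = p \<and> (p \<in> \<pi> ` S \<longrightarrow> b \<in> S)" if p: "p \<in> classes \<pi> c B" for p
  proof (cases "p \<in> \<pi> ` S")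
    case True
    then show ?thesis using S(1,3) by blast
  next
    case False
    then show ?thesis using p unfolding classes_def by auto
  qed
  then obtain g where g: "\<And>p. p \<in> classes \<pi> c B \<Longrightarrow> g p \<in> B \<and> c (g p) \<noteq> 0 \<and> \<pi> (g p) = p \<and> (p \<in> \<pi> ` S \<longrightarrow> g p \<in> S)"
    by metis
  let ?J = "g ` classes \<pi> c B"
  have inj: "inj_on g (classes \<pi> c B)" using g by (metis inj_onI)
  have J: "?J \<in> gr_index B n" using g inj B(2) by (auto simp: gr_index_def card_image)
  have "inj_on \<pi> ?J" using g by (auto intro!: inj_onI)
  moreover have "\<forall>j\<in>?J. c j \<noteq> 0" using g by auto
  ultimately have "mq \<pi> c \<inter> coord_space B \<in> gr_chart B n ?J" using mq_chart[OF B J] by blast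
  moreover have "S \<subseteq> ?J"
  proof
    fix s assume s: "s \<in> S"
    then have "\<pi> s \<in> classes \<pi> c B" using S(1) S(3)[of s] unfolding classes_def by auto
    moreover from g[OF this] have "g (\<pi> s) = s" using s S(2) by (auto dest: inj_onD)
    ultimately show "s \<in> ?J" by (metis imageI)
  qed
  ultimately show ?thesis using J by blast
qed

subsection \<open>Separating the components\<close>

abbreviation degree_4_part :: "pluecker cpoly set \<Rightarrow> pluecker cpoly set" where
  "degree_4_part I \<equiv> I \<inter> forms 4"

abbreviation fixed_topology :: "pluecker cpoly set topology" where
  "fixed_topology \<equiv> emb_topology (monomials 4) 13 (fixed_locus 3) degree_4_part"

definition curves :: "pluecker \<Rightarrow> pluecker cpoly set set" where
  "curves y = {curve y \<alpha> \<beta> | \<alpha> \<beta>. \<alpha> \<noteq> 0 \<or> \<beta> \<noteq> 0}"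

definition separable :: "pluecker cpoly set \<Rightarrow> pluecker cpoly set set \<Rightarrow> bool" where
  "separable I Y \<longleftrightarrow> (\<exists>U. openin fixed_topology U \<and> I \<in> U \<and> U \<inter> Y = {})"

definition thirteen_classes :: "((pluecker \<Rightarrow>\<^sub>0 nat) \<Rightarrow> 'p) \<Rightarrow> ((pluecker \<Rightarrow>\<^sub>0 nat) \<Rightarrow> complex) \<Rightarrow> bool" where
  "thirteen_classes \<pi> c \<longleftrightarrow> card (classes \<pi> c (monomials 4)) = 13"

lemma thirteen_point: "valid_index g \<Longrightarrow> thirteen_classes (position (fst g)) (point_coef g)"
  by (simp add: thirteen_classes_def card_classes_point)

lemma thirteen_curve:
  "y \<in> ends \<Longrightarrow> \<alpha> \<noteq> 0 \<or> \<beta> \<noteq> 0 \<Longrightarrow> thirteen_classes (family_position y) (family_coef y \<alpha> \<beta>)"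
  by (simp add: thirteen_classes_def card_classes_family)

text \<open>No chart whose pivots include \<open>S\<close> contains \<open>I\<close>. Curves carry a
  dummy third entry in their classes, so that points and curves share one class type.\<close>

definition misses :: "(pluecker \<Rightarrow>\<^sub>0 nat) set \<Rightarrow> pluecker cpoly set \<Rightarrow> bool" where
  "misses S I \<longleftrightarrow> (\<exists>(\<pi> :: (pluecker \<Rightarrow>\<^sub>0 nat) \<Rightarrow> nat \<times> nat \<times> nat) c.
     I = mq \<pi> c \<and> thirteen_classes \<pi> c \<and> \<not> (inj_on \<pi> S \<and> (\<forall>s\<in>S. c s \<noteq> 0)))"

text \<open>Extend \<open>S\<close> to the pivots of a chart around the given ideal; this chart is
  an open neighbourhood that no member of \<open>Y\<close> can enter.\<close>

lemma separableI:
  assumes I: "mq \<pi> c \<in> fixed_locus 3" "thirteen_classes \<pi> c"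
    and S: "S \<subseteq> monomials 4" "inj_on \<pi> S" "\<And>s. s \<in> S \<Longrightarrow> c s \<noteq> 0"
    and Y: "\<And>I'. I' \<in> Y \<Longrightarrow> misses S I'"
  shows "separable (mq \<pi> c) Y"
proof -
  obtain J where J: "J \<in> gr_index (monomials 4) 13" "S \<subseteq> J"
    "mq \<pi> c \<inter> coord_space (monomials 4) \<in> gr_chart (monomials 4) 13 J"
    using ex_chart[OF finite_monomials I(2)[unfolded thirteen_classes_def] S] by blast
  let ?U = "{I \<in> fixed_locus 3. degree_4_part I \<in> gr_chart (monomials 4) 13 J}"
  have "openin fixed_topology ?U" by (rule openin_chart[OF J(1)])
  moreover have "mq \<pi> c \<in> ?U" using J(3) I(1) by (simp add: forms_def)
  moreover have "I' \<notin> ?U" if I': "I' \<in> Y" for I'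
  proof
    assume U: "I' \<in> ?U"
    obtain \<pi>' :: "(pluecker \<Rightarrow>\<^sub>0 nat) \<Rightarrow> nat \<times> nat \<times> nat" and c' where
      *: "I' = mq \<pi>' c'" "thirteen_classes \<pi>' c'" "\<not> (inj_on \<pi>' S \<and> (\<forall>s\<in>S. c' s \<noteq> 0))"
      using Y[OF I'] unfolding misses_def by blast
    have "mq \<pi>' c' \<inter> coord_space (monomials 4) \<in> gr_chart (monomials 4) 13 J"
      using U *(1) by (simp add: forms_def)
    then have "inj_on \<pi>' J \<and> (\<forall>j\<in>J. c' j \<noteq> 0)"
      using mq_chart[OF finite_monomials *(2)[unfolded thirteen_classes_def] J(1)] by simp
    then show False using *(3) J(2) inj_on_subset by blast
  qed
  ultimately show ?thesis unfolding separable_def by blast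
qed

lemma unit_coef_nonzero: "y \<in> coords \<Longrightarrow> x \<in> coords \<Longrightarrow> x \<noteq> y \<Longrightarrow> unit_coef y x \<noteq> 0"
  by (auto simp: unit_coef_def kappa_def coords_def)

lemma coef_killed: "y \<in> keys m \<Longrightarrow> coef y m = 0"
proof -
  assume "y \<in> keys m"
  then have "coef y (single y 1 + (m - single y 1)) = 0" unfolding coef_step by (simp add: unit_coef_def)
  then show ?thesis using monomial_split[OF \<open>y \<in> keys m\<close>] by simp
qed

text \<open>With x the coordinate that vanishes on another surface, such a monomial lies in the
  ideal of every curve on that surface and so separates curves on different surfaces.\<close>

lemma ex_monomial_point:
  assumes g: "valid_index g" and x: "x \<in> coords" "x \<noteq> fst g"
  shows "\<exists>m\<in>monomials 4. point_coef g m \<noteq> 0 \<and> x \<in> keys m"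
proof -
  interpret monomial_quotient "position (fst g)" "point_coef g" "shift (fst g)"
    "\<lambda>x p. unit_coef (fst g) x * (if divisible g (shift (fst g) x + p) then 0 else 1)" fst
    by (rule point_monomial_quotient[OF g])
  obtain y r r' s s' where gg: "g = (y, r, r', s, s')" by (cases g)
  have y: "y \<in> coords" using g gg by (auto simp: valid_index_def split: prod.splits)
  have "\<not> divisible g (1, i, j)" for i j
    using g by (auto simp: gg divisible_def valid_index_def smooth_exponents_def cone_exponents_def split: if_splits)
  then have "point_coef g (single x 1) \<noteq> 0"
    using unit_coef_nonzero[OF y x(1)] x(2) by (simp add: point_coef_def position_def coef_def gg)
  then obtain n where n: "mon_degree n = 3" "point_coef g (n + single x 1) \<noteq> 0" using extend_monomial by blast
  moreover have "x \<in> keys (n + single x 1)" by (simp add: in_keys_iff lookup_add)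
  ultimately show ?thesis by (intro bexI[of _ "n + single x 1"]) (auto simp: monomials_def mon_degree_add)
qed

lemma ex_monomial_curve:
  assumes y: "y \<in> ends" and ab: "\<alpha> \<noteq> 0 \<or> \<beta> \<noteq> 0" and x: "x \<in> coords" "x \<noteq> y"
  shows "\<exists>m\<in>monomials 4. family_coef y \<alpha> \<beta> m \<noteq> 0 \<and> x \<in> keys m"
proof -
  interpret monomial_quotient "family_position y" "family_coef y \<alpha> \<beta>" "\<lambda>x. family_class (shift y x)" "family_mult y \<alpha> \<beta>" fst
    by (rule family_monomial_quotient[OF y ab])
  have "family_factor \<alpha> \<beta> (1, row y x, col y x) = 1"
    using y by (auto simp: family_factor_def row_def col_def ends_def)
  then have "family_coef y \<alpha> \<beta> (single x 1) \<noteq> 0"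
    using unit_coef_nonzero[OF _ x] ends_coords[OF y] by (simp add: family_coef_def position_def coef_def)
  then obtain n where n: "mon_degree n = 3" "family_coef y \<alpha> \<beta> (n + single x 1) \<noteq> 0" using extend_monomial by blast
  moreover have "x \<in> keys (n + single x 1)" by (simp add: in_keys_iff lookup_add)
  ultimately show ?thesis by (intro bexI[of _ "n + single x 1"]) (auto simp: monomials_def mon_degree_add)
qed

lemma normal_monomial_4:
  assumes "y \<in> coords" "(i, j) \<in> polygon y 4"
  shows "normal_monomial y 4 i j \<in> monomials 4" "position y (normal_monomial y 4 i j) = (4, i, j)"
    "coef y (normal_monomial y 4 i j) \<noteq> 0"
  using normal_monomial[OF assms] by (simp_all add: position_def monomials_def)

definition smooth_list :: "(nat \<times> nat \<times> nat \<times> nat) list" where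
  "smooth_list = [(1,0,2,0), (1,0,1,1), (1,0,0,2), (0,1,2,0), (0,1,1,1), (0,1,0,2),
     (2,0,1,0), (1,1,1,0), (0,2,1,0), (2,0,0,1), (1,1,0,1), (0,2,0,1)]"

definition cone_list :: "(nat \<times> nat \<times> nat \<times> nat) list" where
  "cone_list = [(0,0,0,3), (0,0,1,2), (0,0,2,1), (0,0,3,0), (1,0,0,1), (1,0,1,0)]"

lemma distinguish_smooth:
  "list_all (\<lambda>g. list_all (\<lambda>g'. g = g' \<or> list_ex (\<lambda>i. list_ex (\<lambda>j.
      \<not> divisible (P1_m1, g) (4, i, j) \<and> divisible (P1_m1, g') (4, i, j)) [0..<5]) [0..<5])
    smooth_list) smooth_list"
  by code_simp

lemma distinguish_cone:
  "list_all (\<lambda>g. list_all (\<lambda>g'. g = g' \<or> list_ex (\<lambda>i. list_ex (\<lambda>j.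
      \<not> divisible (P3_1, g) (4, i, j) \<and> divisible (P3_1, g') (4, i, j)) [0..<9 - 2 * i]) [0..<5])
    cone_list) cone_list"
  by code_simp

text \<open>In degree 4 each equation has 25 - 13 = 12 multiples. Different equations have different
  sets of multiples, so neither set contains the other.\<close>

lemma distinguish:
  assumes "valid_index (y, g)" "valid_index (y, g')" "g \<noteq> g'"
  shows "\<exists>i j. (i, j) \<in> polygon y 4 \<and> \<not> divisible (y, g) (4, i, j) \<and> divisible (y, g') (4, i, j)"
proof (cases "y = P1_m1")
  case True
  then have "g \<in> set smooth_list" "g' \<in> set smooth_list"
    using assms(1,2) by (auto simp: valid_index_def smooth_exponents_def smooth_list_def)
  then obtain i j where "i < 5" "j < 5" "\<not> divisible (P1_m1, g) (4, i, j)" "divisible (P1_m1, g') (4, i, j)"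
    using distinguish_smooth assms(3) unfolding list_all_iff list_ex_iff by fastforce
  then show ?thesis using True by (intro exI[of _ i] exI[of _ j]) (simp add: polygon_def)
next
  case False
  then have "g \<in> set cone_list" "g' \<in> set cone_list"
    using assms(1,2) by (auto simp: valid_index_def cone_exponents_def cone_list_def)
  then obtain i j where "i < 5" "j < 9 - 2 * i" "\<not> divisible (P3_1, g) (4, i, j)" "divisible (P3_1, g') (4, i, j)"
    using distinguish_cone assms(3) unfolding list_all_iff list_ex_iff by fastforce
  \<comment> \<open>Divisibility depends on the surface only through its kind, so one evaluation
    covers all four cones.\<close>
  moreover have "divisible (y, h) = divisible (P3_1, h)" for h
    using False by (cases h) (simp add: divisible_def fun_eq_iff)
  ultimately show ?thesis using False by (intro exI[of _ i] exI[of _ j]) (simp add: polygon_def)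
qed

lemma valid_of_isolated: "g \<in> isolated_indices \<Longrightarrow> valid_index g \<and> fst g \<in> coords"
  by (auto simp: isolated_indices_def valid_index_def split: prod.splits)

lemma separable_points:
  assumes g: "g \<in> isolated_indices" and g': "g' \<in> isolated_indices" and ne: "g \<noteq> g'"
  shows "separable (point g) {point g'}"
proof -
  note v = conjunct1[OF valid_of_isolated[OF g]] and v' = conjunct1[OF valid_of_isolated[OF g']]
  have "\<exists>m\<in>monomials 4. point_coef g m \<noteq> 0 \<and> point_coef g' m = 0"
  proof (cases "fst g = fst g'")
    case True
    obtain y h h' where gg: "g = (y, h)" "g' = (y, h')" using True by (metis prod.collapse)
    obtain i j where ij: "(i, j) \<in> polygon y 4" "\<not> divisible g (4, i, j)" "divisible g' (4, i, j)"
      using distinguish v v' ne unfolding gg by blast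
    have "y \<in> coords" using valid_of_isolated[OF g] gg by simp
    note n = normal_monomial_4[OF this ij(1)]
    show ?thesis using n ij(2,3) gg by (intro bexI[of _ "normal_monomial y 4 i j"]) (auto simp: point_coef_def)
  next
    case False
    then show ?thesis
      using ex_monomial_point[OF v, of "fst g'"] valid_of_isolated[OF g'] coef_killed
      unfolding point_coef_def by fastforce
  qed
  then obtain m where m: "m \<in> monomials 4" "point_coef g m \<noteq> 0" "point_coef g' m = 0" by blast
  show ?thesis
    unfolding point_def[of g]
  proof (rule separableI[where S = "{m}"])
    show "mq (position (fst g)) (point_coef g) \<in> fixed_locus 3"
      using point_in_fixed_locus[OF v] by (simp add: point_def)
    show "misses {m} I'" if "I' \<in> {point g'}" for I'
      unfolding misses_def
      using that m(3) thirteen_point[OF v']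
      by (intro exI[of _ "position (fst g')"] exI[of _ "point_coef g'"]) (simp add: point_def)
  qed (use m thirteen_point[OF v] in auto)
qed

text \<open>One neighbourhood has to avoid the whole pencil. On the same cone it comes from two
  monomials that fall in one class for every member of the pencil but are independent at the
  point.\<close>

lemma separable_point_curves:
  assumes g: "g \<in> isolated_indices" and y: "y \<in> ends"
  shows "separable (point g) (curves y)"
proof -
  note v = conjunct1[OF valid_of_isolated[OF g]]
  have "\<exists>S\<subseteq>monomials 4. inj_on (position (fst g)) S \<and> (\<forall>s\<in>S. point_coef g s \<noteq> 0) \<and>
      (\<not> inj_on (family_position y) S \<or> (\<exists>s\<in>S. coef y s = 0))"
  proof (cases "fst g = y")
    case True
    obtain r r' s s' where gg: "g = (y, r, r', s, s')" using True by (cases g) auto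
    have "(r, r', s, s') \<in> {(0,0,0,3), (0,0,1,2), (0,0,2,1), (1,0,1,0)}"
      using g ends_coords[OF y] y by (auto simp: gg isolated_indices_def valid_index_def cone_exponents_def)
    \<comment> \<open>The pair is V T^6, S^3 T^5 for the equation V S, and V^3 S T, V^2 S^4 for T^3,
      S T^2, S^2 T; no monomial of the pair is a multiple of the equation.\<close>
    then have "\<exists>i j. 2 * i + j \<le> 5 \<and> \<not> divisible g (4, i + 1, j) \<and> \<not> divisible g (4, i, j + 3)"
      using ends_coords[OF y] unfolding gg
      by (intro exI[of _ "if r = 1 then 0 else 2"] exI[of _ "if r = 1 then 0 else 1"]) (auto simp: divisible_def)
    then obtain i j where ij: "2 * i + j \<le> 5" "\<not> divisible g (4, i + 1, j)" "\<not> divisible g (4, i, j + 3)" by blast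
    have y4: "y \<in> coords" "(i + 1, j) \<in> polygon y 4" "(i, j + 3) \<in> polygon y 4"
      using ij(1) ends_coords[OF y] by (simp_all add: polygon_def)
    let ?a = "normal_monomial y 4 (i + 1) j" and ?b = "normal_monomial y 4 i (j + 3)"
    note na = normal_monomial_4[OF y4(1,2)] and nb = normal_monomial_4[OF y4(1,3)]
    have "?a \<noteq> ?b" using na(2) nb(2) by auto
    moreover have "family_position y ?a = family_position y ?b"
      unfolding family_position_def na(2) nb(2) family_class_def by simp
    ultimately have "\<not> inj_on (family_position y) {?a, ?b}" by (meson inj_onD insertCI)
    moreover have "inj_on (position y) {?a, ?b}" using na(2) nb(2) by (auto simp: inj_on_def)
    ultimately show ?thesis using na nb ij(2,3) True
      by (intro exI[of _ "{?a, ?b}"]) (auto simp: point_coef_def)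
  next
    case False
    then obtain m where "m \<in> monomials 4" "point_coef g m \<noteq> 0" "y \<in> keys m"
      using ex_monomial_point[OF v, of y] ends_coords[OF y] by blast
    then show ?thesis using coef_killed by (intro exI[of _ "{m}"]) auto
  qed
  then obtain S where S: "S \<subseteq> monomials 4" "inj_on (position (fst g)) S" "\<And>s. s \<in> S \<Longrightarrow> point_coef g s \<noteq> 0"
    "\<not> inj_on (family_position y) S \<or> (\<exists>s\<in>S. coef y s = 0)" by blast
  show ?thesis
    unfolding point_def[of g]
  proof (rule separableI[OF _ _ S(1-3)])
    show "mq (position (fst g)) (point_coef g) \<in> fixed_locus 3"
      using point_in_fixed_locus[OF v] by (simp add: point_def)
    fix I' assume "I' \<in> curves y"
    then obtain \<alpha> \<beta> where ab: "\<alpha> \<noteq> 0 \<or> \<beta> \<noteq> 0" "I' = curve y \<alpha> \<beta>" by (auto simp: curves_def)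
    have "\<not> (inj_on (family_position y) S \<and> (\<forall>s\<in>S. family_coef y \<alpha> \<beta> s \<noteq> 0))"
      using S(4) by (auto simp: family_coef_def)
    then show "misses S I'"
      unfolding misses_def
      using ab thirteen_curve[OF y ab(1)]
      by (intro exI[of _ "family_position y"] exI[of _ "family_coef y \<alpha> \<beta>"]) (simp add: curve_def)
  qed (use thirteen_point[OF v] in auto)
qed

lemma separable_curve_point:
  assumes y: "y \<in> ends" and ab: "\<alpha> \<noteq> 0 \<or> \<beta> \<noteq> 0" and g: "g \<in> isolated_indices"
  shows "separable (curve y \<alpha> \<beta>) {point g}"
proof -
  note v = conjunct1[OF valid_of_isolated[OF g]]
  have "\<exists>m\<in>monomials 4. family_coef y \<alpha> \<beta> m \<noteq> 0 \<and> point_coef g m = 0"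
  proof (cases "fst g = y")
    case True
    obtain r r' s s' where gg: "g = (y, r, r', s, s')" using True by (cases g) auto
    have "(r, r', s, s') \<in> {(0,0,0,3), (0,0,1,2), (0,0,2,1), (1,0,1,0)}"
      using g ends_coords[OF y] y by (auto simp: gg isolated_indices_def valid_index_def cone_exponents_def)
    \<comment> \<open>For \<alpha> nonzero the monomials are V^2 S^4 and S^4 T^4, with factor
      \<alpha>; for \<alpha> = 0 they are V S T^5 and S^2 T^6, with factors \<beta> and 1. The first
      of each two serves the equation V S.\<close>
    then have "\<exists>i j. (i, j) \<in> polygon y 4 \<and> divisible g (4, i, j) \<and> family_factor \<alpha> \<beta> (4, i, j) \<noteq> 0"
      using ends_coords[OF y] ab unfolding gg
      by (intro exI[of _ "if r = 1 then if \<alpha> \<noteq> 0 then 2 else 1 else 0"]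
          exI[of _ "if \<alpha> \<noteq> 0 then 4 else if r = 1 then 1 else 2"])
        (auto simp: divisible_def polygon_def family_factor_def)
    then obtain i j where ij: "(i, j) \<in> polygon y 4" "divisible g (4, i, j)" "family_factor \<alpha> \<beta> (4, i, j) \<noteq> 0" by blast
    note n = normal_monomial_4[OF conjunct1[OF ends_coords[OF y]] ij(1)]
    show ?thesis using n ij(2,3) True
      by (intro bexI[of _ "normal_monomial y 4 i j"]) (auto simp: point_coef_def family_coef_def)
  next
    case False
    then obtain m where "m \<in> monomials 4" "family_coef y \<alpha> \<beta> m \<noteq> 0" "fst g \<in> keys m"
      using ex_monomial_curve[OF y ab, of "fst g"] valid_of_isolated[OF g] by blast
    then show ?thesis using coef_killed by (intro bexI[of _ m]) (auto simp: point_coef_def)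
  qed
  then obtain m where m: "m \<in> monomials 4" "family_coef y \<alpha> \<beta> m \<noteq> 0" "point_coef g m = 0" by blast
  show ?thesis
    unfolding curve_def[of y]
  proof (rule separableI[where S = "{m}"])
    show "mq (family_position y) (family_coef y \<alpha> \<beta>) \<in> fixed_locus 3"
      using curve_in_fixed_locus[OF y ab] by (simp add: curve_def)
    show "misses {m} I'" if "I' \<in> {point g}" for I'
      unfolding misses_def
      using that m(3) thirteen_point[OF v]
      by (intro exI[of _ "position (fst g)"] exI[of _ "point_coef g"]) (simp add: point_def)
  qed (use m thirteen_curve[OF y ab] in auto)
qed

lemma separable_curve_curves:
  assumes y: "y \<in> ends" "y' \<in> ends" "y \<noteq> y'" and ab: "\<alpha> \<noteq> 0 \<or> \<beta> \<noteq> 0"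
  shows "separable (curve y \<alpha> \<beta>) (curves y')"
proof -
  obtain m where m: "m \<in> monomials 4" "family_coef y \<alpha> \<beta> m \<noteq> 0" "y' \<in> keys m"
    using ex_monomial_curve[OF y(1) ab, of y'] ends_coords[OF y(2)] y(3) by blast
  show ?thesis
    unfolding curve_def[of y]
  proof (rule separableI[where S = "{m}"])
    show "mq (family_position y) (family_coef y \<alpha> \<beta>) \<in> fixed_locus 3"
      using curve_in_fixed_locus[OF y(1) ab] by (simp add: curve_def)
    fix I' assume "I' \<in> curves y'"
    then obtain a b where "a \<noteq> 0 \<or> b \<noteq> 0" "I' = curve y' a b" by (auto simp: curves_def)
    then show "misses {m} I'"
      unfolding misses_def
      using thirteen_curve[OF y(2), of a b] coef_killed[OF m(3)]
      by (intro exI[of _ "family_position y'"] exI[of _ "family_coef y' a b"]) (simp add: curve_def family_coef_def)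
  qed (use m thirteen_curve[OF y(1) ab] in auto)
qed

section \<open>The 34 components are open\<close>

definition components :: "pluecker cpoly set set set" where
  "components = (\<lambda>a. {a}) ` point ` isolated_indices \<union> {curves P3_1, curves Pm1_m3}"

lemma finite_isolated_indices: "finite isolated_indices" and card_isolated_indices: "card isolated_indices = 32"
proof -
  let ?C = "cone_exponents - {(1,0,0,1), (0,0,3,0)}"
  have "(y, g) \<in> isolated_indices \<longleftrightarrow> (y, g) \<in> {P1_m1} \<times> smooth_exponents \<union> {P3_m1, P1_m3} \<times> cone_exponents
      \<union> {P3_1, Pm1_m3} \<times> ?C" for y g
    by (cases y) (auto simp: isolated_indices_def valid_index_def coords_def ends_def)
  then have e: "isolated_indices = {P1_m1} \<times> smooth_exponents \<union> {P3_m1, P1_m3} \<times> cone_exponents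
      \<union> {P3_1, Pm1_m3} \<times> ?C" by auto
  have f: "finite smooth_exponents" "finite cone_exponents" "card smooth_exponents = 12" "card cone_exponents = 6" "card ?C = 4"
    by (simp_all add: smooth_exponents_def cone_exponents_def)
  show "finite isolated_indices" unfolding e using f by simp
  have "card ({P1_m1} \<times> smooth_exponents \<union> {P3_m1, P1_m3} \<times> cone_exponents) = 12 + 12"
    using f by (subst card_Un_disjoint) (auto simp: card_cartesian_product)
  moreover have "card ({P3_1, Pm1_m3} \<times> ?C) = 8" using f by (simp add: card_cartesian_product)
  ultimately show "card isolated_indices = 32"
    unfolding e using f by (subst card_Un_disjoint) auto
qed

lemma separableD: "separable I Y \<Longrightarrow> I \<notin> Y"
  unfolding separable_def by blast

lemma inj_on_point: "inj_on point isolated_indices"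
  using separable_points separableD by (metis inj_onI singletonI)

lemma curves_disjoint: "curves P3_1 \<inter> curves Pm1_m3 = {}"
  using separable_curve_curves[of P3_1 Pm1_m3] separableD unfolding curves_def[of P3_1] by (auto simp: ends_def)

lemma points_curves_disjoint: "point ` isolated_indices \<inter> (curves P3_1 \<union> curves Pm1_m3) = {}"
  using separable_point_curves separableD by (auto simp: ends_def)

lemma Union_components: "\<Union> components = fixed_locus 3"
proof
  show "\<Union> components \<subseteq> fixed_locus 3"
    using point_in_fixed_locus curve_in_fixed_locus valid_of_isolated
    by (auto simp: components_def curves_def ends_def)
  show "fixed_locus 3 \<subseteq> \<Union> components"
    using fixed_locus_cases by (fastforce simp: components_def curves_def ends_def)
qed

lemma separable_components:
  assumes "Y \<in> components" "Y' \<in> components" "Y \<noteq> Y'" "I \<in> Y" shows "separable I Y'"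
proof -
  have cases: "(\<exists>g\<in>isolated_indices. Y = {point g}) \<or> (\<exists>y\<in>ends. Y = curves y)" if "Y \<in> components" for Y
    using that by (auto simp: components_def ends_def)
  show ?thesis
    using cases[OF assms(1)] cases[OF assms(2)]
  proof (elim disjE bexE)
    fix g g' assume "g \<in> isolated_indices" "Y = {point g}" "g' \<in> isolated_indices" "Y' = {point g'}"
    then show ?thesis using assms(3,4) separable_points[of g g'] by auto
  next
    fix g y' assume "g \<in> isolated_indices" "Y = {point g}" "y' \<in> ends" "Y' = curves y'"
    then show ?thesis using assms(4) separable_point_curves by simp
  next
    fix y g' assume "y \<in> ends" "Y = curves y" "g' \<in> isolated_indices" "Y' = {point g'}"
    moreover from this assms(4) obtain \<alpha> \<beta> where "\<alpha> \<noteq> 0 \<or> \<beta> \<noteq> 0" "I = curve y \<alpha> \<beta>"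
      unfolding curves_def by blast
    ultimately show ?thesis using separable_curve_point by simp
  next
    fix y y' assume "y \<in> ends" "Y = curves y" "y' \<in> ends" "Y' = curves y'"
    moreover from this assms(4) obtain \<alpha> \<beta> where "\<alpha> \<noteq> 0 \<or> \<beta> \<noteq> 0" "I = curve y \<alpha> \<beta>"
      unfolding curves_def by blast
    moreover have "y \<noteq> y'" using calculation(2,4) assms(3) by blast
    ultimately show ?thesis using separable_curve_curves by simp
  qed
qed

text \<open>Finitely many separating neighbourhoods intersect in one that meets no other
  component.\<close>

lemma openin_component:
  assumes Y: "Y \<in> components" shows "openin fixed_topology Y"
proof (rule openin_subopen[THEN iffD2], rule ballI)
  fix I assume I: "I \<in> Y"
  have fin: "finite components" by (simp add: components_def finite_isolated_indices)
  have "\<forall>Y'\<in>components - {Y}. \<exists>U. openin fixed_topology U \<and> I \<in> U \<and> U \<inter> Y' = {}"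
    using separable_components[OF Y _ _ I] unfolding separable_def by blast
  then obtain U where U: "\<And>Y'. Y' \<in> components - {Y} \<Longrightarrow> openin fixed_topology (U Y') \<and> I \<in> U Y' \<and> U Y' \<inter> Y' = {}"
    by metis
  have "P3_1 \<in> ends" "Pm1_m3 \<in> ends" by (simp_all add: ends_def)
  then have "\<exists>Y'\<in>components. Y' \<noteq> Y"
    using curves_disjoint unfolding components_def curves_def by fastforce
  then have ne: "U ` (components - {Y}) \<noteq> {}" by blast
  let ?V = "\<Inter> (U ` (components - {Y}))"
  have V: "openin fixed_topology ?V" using U fin ne by (intro openin_Inter) auto
  moreover have "I \<in> ?V" using U by blast
  moreover have "?V \<subseteq> Y"
  proof
    fix I' assume I': "I' \<in> ?V"
    have "I' \<in> fixed_locus 3" using openin_subset[OF V] I' unfolding topspace_emb by blast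
    then obtain Y' where "Y' \<in> components" "I' \<in> Y'" using Union_components by blast
    then show "I' \<in> Y" using U[of Y'] I' by blast
  qed
  ultimately show "\<exists>T. openin fixed_topology T \<and> I \<in> T \<and> T \<subseteq> Y" by blast
qed

subsection \<open>Monomial quotients parametrized by the projective line\<close>

lemma mq_scale:
  assumes "\<And>m. c' m = s (\<pi> m) * c m" "\<And>p. s p \<noteq> 0" shows "mq \<pi> c' = mq \<pi> c"
proof -
  have "lookup (qmap \<pi> c' f) p = s p * lookup (qmap \<pi> c f) p" for f p
    unfolding lookup_qmap sum_distrib_left by (intro sum.cong) (auto simp: assms(1))
  then show ?thesis using assms(2) by (auto simp: mq_def poly_mapping_eq_iff fun_eq_iff)
qed

lemma mq_eq_ratio:
  assumes "mq \<pi> c \<inter> coord_space B = mq \<pi> c' \<inter> coord_space B" "\<pi> m = \<pi> n" "m \<in> B" "n \<in> B"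
  shows "c m * c' n = c n * c' m"
proof -
  have "single m (c n) - single n (c m) \<in> mq \<pi> c"
    using assms(2) by (simp add: mq_def qmap_minus mult.commute)
  moreover have "single m (c n) - single n (c m) \<in> coord_space B"
    using assms(3,4) by (intro vec.subspace_diff[OF subspace_coord_space] single_in_coord_space)
  ultimately have "qmap \<pi> c' (single m (c n) - single n (c m)) = 0"
    using assms(1) unfolding mq_def by blast
  then have "single (\<pi> n) (c' m * c n) = single (\<pi> n) (c' n * c m)"
    using assms(2) by (simp add: qmap_minus)
  then have "lookup (single (\<pi> n) (c' m * c n)) (\<pi> n) = lookup (single (\<pi> n) (c' n * c m)) (\<pi> n)" by simp
  then show ?thesis by (simp add: mult.commute)
qed

lemma mq_eq_zero:
  assumes "mq \<pi> c \<inter> coord_space B = mq \<pi> c' \<inter> coord_space B" "m \<in> B"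
  shows "c m = 0 \<longleftrightarrow> c' m = 0"
proof -
  have "single m 1 \<in> mq \<pi> d \<inter> coord_space B \<longleftrightarrow> d m = 0" for d
  proof -
    have "single (\<pi> m) (d m) = 0 \<longleftrightarrow> d m = 0" by (metis lookup_single_eq lookup_zero single_zero)
    then show ?thesis using assms(2) by (simp add: mq_def single_in_coord_space)
  qed
  then show ?thesis using assms(1) by metis
qed

text \<open>The point with parameters \<open>\<alpha>, \<beta>\<close> is \<open>G (mq \<pi> c)\<close>, where \<open>c b = K b * \<alpha> ^ p b * \<beta> ^ q b\<close>. The basis
  elements \<open>u\<close>, \<open>u'\<close> give the coordinate \<open>\<beta> / \<alpha>\<close> where \<open>\<alpha> \<noteq> 0\<close>, and \<open>v\<close>, \<open>v'\<close> give \<open>\<alpha> / \<beta>\<close>.\<close>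

locale binary_family =
  fixes B :: "'b set" and n :: nat and \<pi> :: "'b \<Rightarrow> 'p" and K :: "'b \<Rightarrow> complex" and p q :: "'b \<Rightarrow> nat"
    and e :: "'a \<Rightarrow> ('b \<Rightarrow>\<^sub>0 complex) set" and G :: "('b \<Rightarrow>\<^sub>0 complex) set \<Rightarrow> 'a" and u u' v v' :: 'b
  assumes B: "finite B"
    and card: "\<And>\<alpha> \<beta>. \<alpha> \<noteq> 0 \<or> \<beta> \<noteq> 0 \<Longrightarrow> card (classes \<pi> (\<lambda>b. K b * \<alpha> ^ p b * \<beta> ^ q b) B) = n"
    and hom: "\<And>b b'. K b \<noteq> 0 \<Longrightarrow> K b' \<noteq> 0 \<Longrightarrow> \<pi> b = \<pi> b' \<Longrightarrow> p b + q b = p b' + q b'"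
    and e: "\<And>M. e (G M) = M \<inter> coord_space B"
    and uv: "{u, u', v, v'} \<subseteq> B" "K u \<noteq> 0" "K u' \<noteq> 0" "K v \<noteq> 0" "K v' \<noteq> 0" "\<pi> u = \<pi> u'" "\<pi> v = \<pi> v'"
      "q u = 0" "p u = Suc (p u')" "q u' = 1" "p v = 0" "q v = Suc (q v')" "p v' = 1"
begin

definition fcoef :: "complex \<Rightarrow> complex \<Rightarrow> 'b \<Rightarrow> complex" where
  "fcoef \<alpha> \<beta> b = K b * \<alpha> ^ p b * \<beta> ^ q b"

definition member :: "complex \<Rightarrow> complex \<Rightarrow> 'a" where
  "member \<alpha> \<beta> = G (mq \<pi> (fcoef \<alpha> \<beta>))"

definition members :: "'a set" where
  "members = {member \<alpha> \<beta> | \<alpha> \<beta>. \<alpha> \<noteq> 0 \<or> \<beta> \<noteq> 0}"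

lemma card_fcoef: "\<alpha> \<noteq> 0 \<or> \<beta> \<noteq> 0 \<Longrightarrow> card (classes \<pi> (fcoef \<alpha> \<beta>) B) = n"
  using card unfolding fcoef_def[abs_def] .

text \<open>The parameters enter homogeneously, with a degree that by \<open>hom\<close> depends
  only on the class; a common factor t only rescales each class.\<close>

lemma member_scale: assumes "t \<noteq> 0" shows "member (t * \<alpha>) (t * \<beta>) = member \<alpha> \<beta>"
proof -
  define s where "s x = t ^ (p (SOME b. \<pi> b = x \<and> K b \<noteq> 0) + q (SOME b. \<pi> b = x \<and> K b \<noteq> 0))" for x
  have "fcoef (t * \<alpha>) (t * \<beta>) b = s (\<pi> b) * fcoef \<alpha> \<beta> b" for b
  proof (cases "K b = 0")
    case False
    then have "\<pi> (SOME b'. \<pi> b' = \<pi> b \<and> K b' \<noteq> 0) = \<pi> b \<and> K (SOME b'. \<pi> b' = \<pi> b \<and> K b' \<noteq> 0) \<noteq> 0"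
      by (intro someI[of "\<lambda>b'. \<pi> b' = \<pi> b \<and> K b' \<noteq> 0" b]) simp
    then have "s (\<pi> b) = t ^ (p b + q b)"
      unfolding s_def using hom[of b "SOME b'. \<pi> b' = \<pi> b \<and> K b' \<noteq> 0"] False by simp
    then show ?thesis by (simp add: fcoef_def power_mult_distrib power_add)
  qed (simp add: fcoef_def)
  then have "mq \<pi> (fcoef (t * \<alpha>) (t * \<beta>)) = mq \<pi> (fcoef \<alpha> \<beta>)"
    using assms by (intro mq_scale[of _ s]) (auto simp: s_def)
  then show ?thesis by (simp add: member_def)
qed

text \<open>The ratio of the parameters can be read off from u, u' where \<alpha> does not vanish
  and from v, v' where \<beta> does not vanish; which parameters vanish is visible at u and
  v.\<close>

lemma member_eq:
  assumes "\<alpha> \<noteq> 0 \<or> \<beta> \<noteq> 0" "\<alpha>' \<noteq> 0 \<or> \<beta>' \<noteq> 0"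
  shows "member \<alpha> \<beta> = member \<alpha>' \<beta>' \<longleftrightarrow> \<alpha> * \<beta>' = \<alpha>' * \<beta>"
proof
  assume *: "\<alpha> * \<beta>' = \<alpha>' * \<beta>"
  define t where "t = (if \<alpha> \<noteq> 0 then \<alpha>' / \<alpha> else \<beta>' / \<beta>)"
  have "t \<noteq> 0 \<and> \<alpha>' = t * \<alpha> \<and> \<beta>' = t * \<beta>"
    using assms * by (auto simp: t_def field_simps)
  then show "member \<alpha> \<beta> = member \<alpha>' \<beta>'" using member_scale by metis
next
  assume "member \<alpha> \<beta> = member \<alpha>' \<beta>'"
  then have *: "mq \<pi> (fcoef \<alpha> \<beta>) \<inter> coord_space B = mq \<pi> (fcoef \<alpha>' \<beta>') \<inter> coord_space B"
    unfolding member_def using e by metis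
  note r = mq_eq_ratio[OF *]
  have 1: "\<alpha> ^ p u' * \<alpha>' ^ p u' * (\<alpha> * \<beta>' - \<alpha>' * \<beta>) = 0"
    using r[of u u'] uv by (auto simp: fcoef_def field_simps)
  have 2: "\<beta> ^ q v' * \<beta>' ^ q v' * (\<alpha> * \<beta>' - \<alpha>' * \<beta>) = 0"
    using r[of v v'] uv by (auto simp: fcoef_def field_simps)
  show "\<alpha> * \<beta>' = \<alpha>' * \<beta>"
  proof (rule ccontr)
    assume ne: "\<alpha> * \<beta>' \<noteq> \<alpha>' * \<beta>"
    have "\<alpha> = 0 \<longleftrightarrow> \<alpha>' = 0"
      using mq_eq_zero[OF *, of u] uv by (auto simp: fcoef_def)
    moreover have "\<beta> = 0 \<longleftrightarrow> \<beta>' = 0"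
      using mq_eq_zero[OF *, of v] uv by (auto simp: fcoef_def)
    ultimately show False using 1 2 ne assms by auto
  qed
qed


abbreviation members_topology :: "'a topology" where
  "members_topology \<equiv> emb_topology B n members e"

lemma ex_member_chart:
  assumes "\<alpha> \<noteq> 0 \<or> \<beta> \<noteq> 0" "b \<in> B" "fcoef \<alpha> \<beta> b \<noteq> 0"
  shows "\<exists>J\<in>gr_index B n. b \<in> J \<and> e (member \<alpha> \<beta>) \<in> gr_chart B n J"
  using ex_chart[OF B card_fcoef[OF assms(1)], of "{b}"] assms(2,3) unfolding member_def e by auto

lemma member_chart:
  "\<alpha> \<noteq> 0 \<or> \<beta> \<noteq> 0 \<Longrightarrow> J \<in> gr_index B n \<Longrightarrow>
    e (member \<alpha> \<beta>) \<in> gr_chart B n J \<longleftrightarrow> inj_on \<pi> J \<and> (\<forall>j\<in>J. fcoef \<alpha> \<beta> j \<noteq> 0)"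
  unfolding member_def e by (rule mq_chart[OF B card_fcoef])

lemma member_coord:
  "\<alpha> \<noteq> 0 \<or> \<beta> \<noteq> 0 \<Longrightarrow> J \<in> gr_index B n \<Longrightarrow> e (member \<alpha> \<beta>) \<in> gr_chart B n J \<Longrightarrow>
    gr_coord B J (e (member \<alpha> \<beta>)) (b, j) = (if b \<in> B \<and> j \<in> J \<and> \<pi> b = \<pi> j then fcoef \<alpha> \<beta> b / fcoef \<alpha> \<beta> j else 0)"
  unfolding member_def e by (rule mq_coord[OF B card_fcoef])

lemma member_in_chart: assumes "\<alpha> \<noteq> 0 \<or> \<beta> \<noteq> 0" shows "\<exists>J\<in>gr_index B n. e (member \<alpha> \<beta>) \<in> gr_chart B n J"
proof -
  have "fcoef \<alpha> \<beta> u \<noteq> 0 \<or> fcoef \<alpha> \<beta> v \<noteq> 0" using assms uv by (auto simp: fcoef_def)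
  then show ?thesis using ex_member_chart[OF assms] uv(1) by blast
qed

lemma topspace_members: "topspace members_topology = members"
  unfolding topspace_emb using member_in_chart by (auto simp: members_def)

text \<open>On a chart with pivot u the parameter \<alpha> is nonzero and can be normalized to 1;
  then \<beta> is the coordinate at \<open>(u', u)\<close> up to a constant. The pivot v serves the
  other case.\<close>

lemma local_parameters:
  assumes "x \<in> members"
  shows "\<exists>J N f g. J \<in> gr_index B n \<and> openin members_topology N \<and> x \<in> N \<and>
    (\<forall>x\<in>N. e x \<in> gr_chart B n J \<and> (f x \<noteq> 0 \<or> g x \<noteq> 0) \<and> x = member (f x) (g x)) \<and>
    rational_on (\<lambda>x. gr_coord B J (e x)) N f \<and> rational_on (\<lambda>x. gr_coord B J (e x)) N g"
proof -
  obtain \<alpha> \<beta> where ab: "\<alpha> \<noteq> 0 \<or> \<beta> \<noteq> 0" "x = member \<alpha> \<beta>" using assms unfolding members_def by blast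
  show ?thesis
  proof (cases "\<alpha> = 0")
    case False
    then have "fcoef \<alpha> \<beta> u \<noteq> 0" using uv by (simp add: fcoef_def)
    then obtain J where J: "J \<in> gr_index B n" "u \<in> J" "e x \<in> gr_chart B n J"
      using ex_member_chart[OF ab(1)] uv(1) ab(2) by blast
    let ?N = "{x \<in> members. e x \<in> gr_chart B n J}"
    let ?r = "\<lambda>x. gr_coord B J (e x) (u', u) * (K u / K u')"
    have "y = member 1 (?r y)" if y: "y \<in> ?N" for y
    proof -
      obtain a b where ab: "a \<noteq> 0 \<or> b \<noteq> 0" "y = member a b" using y unfolding members_def by blast
      have "fcoef a b u \<noteq> 0" using y member_chart[OF ab(1) J(1)] J(2) unfolding ab(2) by blast
      then have a: "a \<noteq> 0" using uv by (auto simp: fcoef_def)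
      have "gr_coord B J (e y) (u', u) = fcoef a b u' / fcoef a b u"
        using y member_coord[OF ab(1) J(1)] J(2) uv(1,6) unfolding ab(2) by auto
      then have "a * ?r y = b" using a uv by (simp add: fcoef_def)
      then show ?thesis unfolding ab(2) using member_eq[OF ab(1), of 1 "?r y"] ab(2) by simp
    qed
    moreover have "rational_on (\<lambda>x. gr_coord B J (e x)) ?N ?r"
      by (intro rational_on_mult rational_on_coord rational_on_const)
    ultimately show ?thesis
      using openin_chart[OF J(1)] J assms
      by (intro exI[of _ J] exI[of _ ?N] exI[of _ "\<lambda>_. 1"] exI[of _ ?r]) (simp add: rational_on_const)
  next
    case True
    then have "fcoef \<alpha> \<beta> v \<noteq> 0" using uv ab(1) by (simp add: fcoef_def)
    then obtain J where J: "J \<in> gr_index B n" "v \<in> J" "e x \<in> gr_chart B n J"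
      using ex_member_chart[OF ab(1)] uv(1) ab(2) by blast
    let ?N = "{x \<in> members. e x \<in> gr_chart B n J}"
    let ?r = "\<lambda>x. gr_coord B J (e x) (v', v) * (K v / K v')"
    have "y = member (?r y) 1" if y: "y \<in> ?N" for y
    proof -
      obtain a b where ab: "a \<noteq> 0 \<or> b \<noteq> 0" "y = member a b" using y unfolding members_def by blast
      have "fcoef a b v \<noteq> 0" using y member_chart[OF ab(1) J(1)] J(2) unfolding ab(2) by blast
      then have b: "b \<noteq> 0" using uv by (auto simp: fcoef_def)
      have "gr_coord B J (e y) (v', v) = fcoef a b v' / fcoef a b v"
        using y member_coord[OF ab(1) J(1)] J(2) uv(1,7) unfolding ab(2) by auto
      then have "?r y * b = a" using b uv by (simp add: fcoef_def)
      then show ?thesis unfolding ab(2) using member_eq[OF ab(1), of "?r y" 1] ab(2) by simp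
    qed
    moreover have "rational_on (\<lambda>x. gr_coord B J (e x)) ?N ?r"
      by (intro rational_on_mult rational_on_coord rational_on_const)
    ultimately show ?thesis
      using openin_chart[OF J(1)] J assms
      by (intro exI[of _ J] exI[of _ ?N] exI[of _ ?r] exI[of _ "\<lambda>_. 1"]) (simp add: rational_on_const)
  qed
qed

text \<open>In the parameters, chart coordinates are quotients of polynomials, so Zariski open sets
  pull back to Euclidean open sets, and the complex plane without the origin is connected.\<close>

lemma connected_members:
  assumes "members \<subseteq> X" shows "connectedin (emb_topology B n X e) members"
proof -
  let ?D = "- {0} :: (complex \<times> complex) set"
  let ?x = "\<lambda>z. member (fst z) (snd z)"
  let ?S = "{{W \<in> gr_chart B n J. peval P (gr_coord B J W) \<noteq> 0} |J P. J \<in> gr_index B n}"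
  have D: "fst z \<noteq> 0 \<or> snd z \<noteq> 0" if "z \<in> ?D" for z using that by (auto simp: prod_eq_iff)
  have im: "?x ` ?D = members"
  proof
    show "?x ` ?D \<subseteq> members" using D by (auto simp: members_def)
    show "members \<subseteq> ?x ` ?D"
    proof
      fix y assume "y \<in> members"
      then obtain a b where ab: "a \<noteq> 0 \<or> b \<noteq> 0" "y = member a b" unfolding members_def by blast
      then show "y \<in> ?x ` ?D" by (intro image_eqI[of _ _ "(a, b)"]) (auto simp: prod_eq_iff)
    qed
  qed
  have "continuous_map (top_of_set ?D) (topology_generated_by ?S) (e \<circ> ?x)"
  proof (rule continuous_on_generated_topo)
    fix U assume "U \<in> ?S"
    then obtain J P where U: "J \<in> gr_index B n" "U = {W \<in> gr_chart B n J. peval P (gr_coord B J W) \<noteq> 0}" by blast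
    show "openin (top_of_set ?D) ((e \<circ> ?x) -` U \<inter> topspace (top_of_set ?D))"
    proof (cases "inj_on \<pi> J")
      case True
      let ?c = "\<lambda>z. fcoef (fst z) (snd z)"
      let ?O = "?D \<inter> (\<lambda>z. \<Prod>j\<in>J. ?c z j) -` (- {0})"
      let ?k = "\<lambda>z (b, j). if b \<in> B \<and> j \<in> J \<and> \<pi> b = \<pi> j then ?c z b / ?c z j else 0"
      have finJ: "finite J" using U(1) B finite_subset unfolding gr_index_def by blast
      have c: "continuous_on S (\<lambda>z. ?c z b)" for S b
        unfolding fcoef_def by (intro continuous_intros)
      have O: "open ?O"
        by (intro continuous_open_preimage continuous_on_prod c) auto
      have nz: "?c z j \<noteq> 0" if "z \<in> ?O" "j \<in> J" for z j using that finJ by auto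
      have k: "continuous_on ?O (\<lambda>z. ?k z i)" for i
      proof -
        obtain b j where i: "i = (b, j)" by (cases i)
        show ?thesis
        proof (cases "b \<in> B \<and> j \<in> J \<and> \<pi> b = \<pi> j")
          case True
          have "\<forall>z\<in>?O. ?c z j \<noteq> 0" using nz True by blast
          then have "continuous_on ?O (\<lambda>z. ?c z b / ?c z j)"
            by (rule continuous_on_divide[OF c c])
          then show ?thesis using True by (simp only: i prod.case if_True simp_thms)
        next
          case False
          then show ?thesis by (simp only: i prod.case if_False) (rule continuous_on_const)
        qed
      qed
      have "continuous_on ?O (\<lambda>z. peval P (?k z))"
        unfolding peval_def by (intro continuous_intros k)
      then have "open (?O \<inter> (\<lambda>z. peval P (?k z)) -` (- {0}))"
        using continuous_open_preimage[OF _ O, of _ "- {0 :: complex}"] by (simp add: open_Compl)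
      moreover have "(e \<circ> ?x) -` U \<inter> ?D = ?O \<inter> (\<lambda>z. peval P (?k z)) -` (- {0})"
      proof -
        have "e (?x z) \<in> U \<longleftrightarrow> z \<in> ?O \<inter> (\<lambda>z. peval P (?k z)) -` (- {0})" if z: "z \<in> ?D" for z
        proof -
          have "e (?x z) \<in> gr_chart B n J \<longleftrightarrow> z \<in> ?O"
            using member_chart[OF D[OF z] U(1)] z finJ True by auto
          moreover have "gr_coord B J (e (?x z)) = ?k z" if "e (?x z) \<in> gr_chart B n J"
            using member_coord[OF D[OF z] U(1) that] by (auto simp: fun_eq_iff)
          ultimately show ?thesis unfolding U(2) by auto
        qed
        then show ?thesis by auto
      qed
      ultimately show ?thesis by (simp add: openin_open_eq open_Compl)
    next
      case False
      then have "(e \<circ> ?x) -` U \<inter> ?D = {}"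
        using member_chart[OF D U(1)] U(2) by auto
      then show ?thesis by simp
    qed
  next
    show "(e \<circ> ?x) ` topspace (top_of_set ?D) \<subseteq> \<Union> ?S"
    proof
      fix W assume "W \<in> (e \<circ> ?x) ` topspace (top_of_set ?D)"
      then obtain z where z: "z \<in> ?D" "W = e (?x z)" by auto
      obtain J where J: "J \<in> gr_index B n" "W \<in> gr_chart B n J" using member_in_chart[OF D[OF z(1)]] z(2) by blast
      then have "W \<in> {W \<in> gr_chart B n J. peval 1 (gr_coord B J W) \<noteq> 0}" by simp
      then show "W \<in> \<Union> ?S" using J(1) by blast
    qed
  qed
  then have "continuous_map (top_of_set ?D) (gr_zariski B n) (e \<circ> ?x)" unfolding gr_zariski_def .
  moreover have "topspace (top_of_set ?D) \<subseteq> ?x -` X"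
    using im assms by auto
  ultimately have "continuous_map (top_of_set ?D) (emb_topology B n X e) ?x" by (rule continuous_map_pullback')
  moreover have "connectedin (top_of_set ?D) ?D"
    using connected_punctured_universe[of "0 :: complex \<times> complex"] by (simp add: connectedin_subtopology)
  ultimately have "connectedin (emb_topology B n X e) (?x ` ?D)" by (rule connectedin_continuous_map_image)
  then show ?thesis unfolding im .
qed

end

text \<open>In the parameters given by \<open>local_parameters\<close>, chart coordinates of the
  target are rational. Treating the line as another such family makes the inverse morphism an
  instance of the same lemma.\<close>

lemma binary_family_morphism:
  assumes "binary_family B n \<pi> K p q e G u u' v v'" and "binary_family B' n' \<pi>' K' p' q' e' G' w w' z z'"
    and \<phi>: "\<And>\<alpha> \<beta>. \<alpha> \<noteq> 0 \<or> \<beta> \<noteq> 0 \<Longrightarrow>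
      \<phi> (binary_family.member \<pi> K p q G \<alpha> \<beta>) = binary_family.member \<pi>' K' p' q' G' \<alpha> \<beta>"
  shows "is_morphism (embedded_variety B n (binary_family.members \<pi> K p q G) e)
    (embedded_variety B' n' (binary_family.members \<pi>' K' p' q' G') e') \<phi>"
proof -
  interpret F: binary_family B n \<pi> K p q e G u u' v v' by (rule assms(1))
  interpret F': binary_family B' n' \<pi>' K' p' q' e' G' w w' z z' by (rule assms(2))
  show ?thesis
  proof (rule is_morphismI)
    fix x assume "x \<in> topspace F.members_topology"
    then have "x \<in> F.members" unfolding F.topspace_members .
    then obtain \<alpha> \<beta> where ab: "\<alpha> \<noteq> 0 \<or> \<beta> \<noteq> 0" "x = F.member \<alpha> \<beta>" unfolding F.members_def by blast
    have "F'.member \<alpha> \<beta> \<in> F'.members" unfolding F'.members_def using ab(1) by blast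
    then show "\<phi> x \<in> topspace F'.members_topology"
      unfolding F'.topspace_members ab(2) \<phi>[OF ab(1)] .
  next
    fix x J' assume x: "x \<in> topspace F.members_topology" and J': "J' \<in> gr_index B' n'"
      and ch: "e' (\<phi> x) \<in> gr_chart B' n' J'"
    have xm: "x \<in> F.members" using x unfolding F.topspace_members .
    obtain J N f g where N: "J \<in> gr_index B n" "openin F.members_topology N" "x \<in> N"
      "\<And>x. x \<in> N \<Longrightarrow> e x \<in> gr_chart B n J \<and> (f x \<noteq> 0 \<or> g x \<noteq> 0) \<and> x = F.member (f x) (g x)"
      "rational_on (\<lambda>x. gr_coord B J (e x)) N f" "rational_on (\<lambda>x. gr_coord B J (e x)) N g"
      using F.local_parameters[OF xm]
      by (elim exE conjE) (rule that, assumption, assumption, assumption, erule bspec, assumption, assumption, assumption)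
    have phi: "\<phi> y = F'.member (f y) (g y)" if "y \<in> N" for y
      using N(4)[OF that] \<phi>[of "f y" "g y"] by simp
    let ?c = "\<lambda>y. F'.fcoef (f y) (g y)"
    have finJ: "finite J'" using J' F'.B finite_subset unfolding gr_index_def by blast
    have rc: "rational_on (\<lambda>x. gr_coord B J (e x)) N (\<lambda>y. ?c y b)" for b
      unfolding F'.fcoef_def by (intro rational_on_mult rational_on_power rational_on_const N)
    have chart: "e' (\<phi> y) \<in> gr_chart B' n' J' \<longleftrightarrow> inj_on \<pi>' J' \<and> (\<forall>j\<in>J'. ?c y j \<noteq> 0)" if "y \<in> N" for y
      using F'.member_chart[OF _ J'] N(4)[OF that] phi[OF that] by simp
    let ?N = "{y \<in> N. (\<Prod>j\<in>J'. ?c y j) \<noteq> 0}"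
    have N': "e' (\<phi> y) \<in> gr_chart B' n' J' \<and> (\<forall>j\<in>J'. ?c y j \<noteq> 0)" if "y \<in> ?N" for y
      using that chart[of y] chart[OF N(3)] ch finJ by auto
    have "openin F.members_topology ?N"
      using N by (intro openin_rational[OF N(2) _ N(1)] rational_on_prod rc) auto
    moreover have "x \<in> ?N" using chart[OF N(3)] ch finJ N(3) by simp
    moreover have "rational_on (\<lambda>y. gr_coord B J (e y)) ?N (\<lambda>y. gr_coord B' J' (e' (\<phi> y)) (b, j))" for b j
    proof (rule iffD2[OF rational_on_cong])
      show "gr_coord B' J' (e' (\<phi> y)) (b, j) = (if b \<in> B' \<and> j \<in> J' \<and> \<pi>' b = \<pi>' j then ?c y b / ?c y j else 0)"
        if "y \<in> ?N" for y
        using F'.member_coord[OF _ J'] N(4)[of y] N'[OF that] phi[of y] that by simp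
      show "rational_on (\<lambda>y. gr_coord B J (e y)) ?N (\<lambda>y. if b \<in> B' \<and> j \<in> J' \<and> \<pi>' b = \<pi>' j then ?c y b / ?c y j else 0)"
      proof (cases "b \<in> B' \<and> j \<in> J' \<and> \<pi>' b = \<pi>' j")
        case True
        then show ?thesis
          using N' by (simp, intro rational_on_divide rational_on_subset[OF rc]) auto
      next
        case False
        then show ?thesis by (simp only: if_False) (rule rational_on_const)
      qed
    qed
    ultimately show "\<exists>N J. openin F.members_topology N \<and> x \<in> N \<and> J \<in> gr_index B n \<and>
        (\<forall>y\<in>N. e y \<in> gr_chart B n J \<and> e' (\<phi> y) \<in> gr_chart B' n' J') \<and>
        (\<forall>i. rational_on (\<lambda>y. gr_coord B J (e y)) N (\<lambda>y. gr_coord B' J' (e' (\<phi> y)) i))"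
      using N(1,4) N' by (intro exI[of _ ?N] exI[of _ J]) auto
  qed
qed

text \<open>In both families parameters give the same member iff they are proportional, so matching
  parameters is a well-defined bijection.\<close>

lemma binary_family_isomorphic:
  assumes "binary_family B n \<pi> K p q e G u u' v v'" and "binary_family B' n' \<pi>' K' p' q' e' G' w w' z z'"
  shows "isomorphic (embedded_variety B n (binary_family.members \<pi> K p q G) e)
    (embedded_variety B' n' (binary_family.members \<pi>' K' p' q' G') e')"
proof -
  interpret F: binary_family B n \<pi> K p q e G u u' v v' by (rule assms(1))
  interpret F': binary_family B' n' \<pi>' K' p' q' e' G' w w' z z' by (rule assms(2))
  let ?D = "- {0} :: (complex \<times> complex) set"
  let ?x = "\<lambda>z. F.member (fst z) (snd z)" and ?y = "\<lambda>z. F'.member (fst z) (snd z)"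
  let ?f = "\<lambda>x. ?y (inv_into ?D ?x x)" and ?g = "\<lambda>y. ?x (inv_into ?D ?y y)"
  have D: "(\<alpha>, \<beta>) \<in> ?D \<longleftrightarrow> \<alpha> \<noteq> 0 \<or> \<beta> \<noteq> 0" for \<alpha> \<beta> :: complex by (simp add: zero_prod_def)
  have f: "?f (F.member \<alpha> \<beta>) = F'.member \<alpha> \<beta>" if "\<alpha> \<noteq> 0 \<or> \<beta> \<noteq> 0" for \<alpha> \<beta>
  proof -
    have "F.member \<alpha> \<beta> \<in> ?x ` ?D" using that D by (intro image_eqI[of _ _ "(\<alpha>, \<beta>)"]) auto
    then have "inv_into ?D ?x (F.member \<alpha> \<beta>) \<in> ?D" "?x (inv_into ?D ?x (F.member \<alpha> \<beta>)) = F.member \<alpha> \<beta>"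
      by (rule inv_into_into, rule f_inv_into_f)
    moreover obtain a b where ab: "inv_into ?D ?x (F.member \<alpha> \<beta>) = (a, b)" by force
    ultimately show ?thesis using F.member_eq[of a b \<alpha> \<beta>] F'.member_eq[of a b \<alpha> \<beta>] that D[of a b] by simp
  qed
  have g: "?g (F'.member \<alpha> \<beta>) = F.member \<alpha> \<beta>" if "\<alpha> \<noteq> 0 \<or> \<beta> \<noteq> 0" for \<alpha> \<beta>
  proof -
    have "F'.member \<alpha> \<beta> \<in> ?y ` ?D" using that D by (intro image_eqI[of _ _ "(\<alpha>, \<beta>)"]) auto
    then have "inv_into ?D ?y (F'.member \<alpha> \<beta>) \<in> ?D" "?y (inv_into ?D ?y (F'.member \<alpha> \<beta>)) = F'.member \<alpha> \<beta>"
      by (rule inv_into_into, rule f_inv_into_f)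
    moreover obtain a b where ab: "inv_into ?D ?y (F'.member \<alpha> \<beta>) = (a, b)" by force
    ultimately show ?thesis using F.member_eq[of a b \<alpha> \<beta>] F'.member_eq[of a b \<alpha> \<beta>] that D[of a b] by simp
  qed
  have "?g (?f x) = x" if "x \<in> F.members" for x
  proof -
    obtain \<alpha> \<beta> where x: "\<alpha> \<noteq> 0 \<or> \<beta> \<noteq> 0" "x = F.member \<alpha> \<beta>" using \<open>x \<in> F.members\<close> unfolding F.members_def by blast
    show ?thesis by (simp only: x(2) f[OF x(1)] g[OF x(1)])
  qed
  moreover have "?f (?g x) = x" if "x \<in> F'.members" for x
  proof -
    obtain \<alpha> \<beta> where x: "\<alpha> \<noteq> 0 \<or> \<beta> \<noteq> 0" "x = F'.member \<alpha> \<beta>" using \<open>x \<in> F'.members\<close> unfolding F'.members_def by blast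
    show ?thesis by (simp only: x(2) f[OF x(1)] g[OF x(1)])
  qed
  ultimately have "\<forall>x\<in>topspace F.members_topology. ?g (?f x) = x" "\<forall>y\<in>topspace F'.members_topology. ?f (?g y) = y"
    unfolding F.topspace_members F'.topspace_members by blast+
  then show ?thesis
    unfolding isomorphic_def Top_embedded
    using binary_family_morphism[OF assms, of ?f, OF f] binary_family_morphism[OF assms(2,1), of ?g, OF g]
    by (intro exI[of _ ?f] exI[of _ ?g]) (intro conjI)
qed

subsection \<open>The two curves\<close>

definition alpha_exponent :: "pluecker \<Rightarrow> (pluecker \<Rightarrow>\<^sub>0 nat) \<Rightarrow> nat" where
  "alpha_exponent y m = (case position y m of (k, i, j) \<Rightarrow> j div 3)"

definition beta_exponent :: "pluecker \<Rightarrow> (pluecker \<Rightarrow>\<^sub>0 nat) \<Rightarrow> nat" where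
  "beta_exponent y m = (case position y m of (k, i, j) \<Rightarrow> min i (2 * k - (2 * i + j)))"

lemma family_coef_eq: "family_coef y \<alpha> \<beta> = (\<lambda>m. coef y m * \<alpha> ^ alpha_exponent y m * \<beta> ^ beta_exponent y m)"
  by (simp add: family_coef_def family_factor_def alpha_exponent_def beta_exponent_def fun_eq_iff split: prod.split)

text \<open>With w the exponent of T, i + j div 3 = t div 3 and i - min i w = t - 2 k. This is the
  homogeneity required of a \<open>binary_family\<close>.\<close>

lemma exp_sum:
  assumes y: "y \<in> ends" and m: "family_position y m = (k, t, s)"
  shows "alpha_exponent y m + beta_exponent y m = t div 3 - (t - 2 * k)"
proof -
  obtain i j where ij: "position y m = (k, i, j)" "t = 3 * i + j"
    using m by (cases "position y m") (auto simp: family_position_def family_class_def)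
  then obtain w where w: "2 * k = 2 * i + j + w"
    using position_in_polygon[OF y ij(1)] le_Suc_ex by metis
  have "t div 3 = i + j div 3" unfolding ij(2) by simp
  moreover have "t - 2 * k = i - w" unfolding w ij(2) by simp
  moreover have "beta_exponent y m = min i w" unfolding beta_exponent_def ij(1) prod.case w by simp
  moreover have "alpha_exponent y m = j div 3" unfolding alpha_exponent_def ij(1) by simp
  ultimately show ?thesis by linarith
qed

text \<open>The monomials S^8, V S^5 T and V^2 S^2 T^2 all have 3 i + j = 8, with factors
  \<alpha>^2, \<alpha> \<beta> and \<beta>^2; neighbouring ones give the two affine
  coordinates.\<close>

lemma curve_binary_family:
  assumes y: "y \<in> ends"
  shows "binary_family (monomials 4) 13 (family_position y) (coef y) (alpha_exponent y) (beta_exponent y) degree_4_part id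
    (normal_monomial y 4 0 8) (normal_monomial y 4 1 5) (normal_monomial y 4 2 2) (normal_monomial y 4 1 5)"
proof -
  have yc: "y \<in> coords" and poly: "(0, 8) \<in> polygon y 4" "(1, 5) \<in> polygon y 4" "(2, 2) \<in> polygon y 4"
    using ends_coords[OF y] by (simp_all add: polygon_def)
  note n = normal_monomial_4[OF yc poly(1)] normal_monomial_4[OF yc poly(2)] normal_monomial_4[OF yc poly(3)]
  show ?thesis
  proof
    show "card (classes (family_position y) (\<lambda>b. coef y b * \<alpha> ^ alpha_exponent y b * \<beta> ^ beta_exponent y b) (monomials 4)) = 13"
      if "\<alpha> \<noteq> 0 \<or> \<beta> \<noteq> 0" for \<alpha> \<beta> using card_classes_family[OF y that, of 4] by (simp add: family_coef_eq)
    show "alpha_exponent y b + beta_exponent y b = alpha_exponent y b' + beta_exponent y b'" if "family_position y b = family_position y b'" for b b'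
      using exp_sum[OF y, of b] exp_sum[OF y, of b'] that by (cases "family_position y b'") simp
  qed (use n in \<open>simp_all add: finite_monomials forms_def family_position_def family_class_def alpha_exponent_def beta_exponent_def\<close>)
qed

lemma members_curve:
  "binary_family.members (family_position y) (coef y) (alpha_exponent y) (beta_exponent y) id = curves y" if "y \<in> ends"
proof -
  interpret F: binary_family "monomials 4" 13 "family_position y" "coef y" "alpha_exponent y" "beta_exponent y" degree_4_part id
    "normal_monomial y 4 0 8" "normal_monomial y 4 1 5" "normal_monomial y 4 2 2" "normal_monomial y 4 1 5"
    by (rule curve_binary_family[OF that])
  have "F.member \<alpha> \<beta> = curve y \<alpha> \<beta>" for \<alpha> \<beta>
    by (simp add: F.member_def curve_def family_coef_eq F.fcoef_def[abs_def])
  then show ?thesis by (simp add: F.members_def curves_def)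
qed

section \<open>The projective line as a binary family\<close>

definition line_p :: "nat \<Rightarrow> nat" where "line_p i = (if i = 0 then 1 else 0)"
definition line_q :: "nat \<Rightarrow> nat" where "line_q i = (if i = 1 then 1 else 0)"
definition line_K :: "nat \<Rightarrow> complex" where "line_K i = (if i \<in> {0, 1} then 1 else 0)"
definition plane_part :: "(nat \<Rightarrow>\<^sub>0 complex) set \<Rightarrow> (nat \<Rightarrow>\<^sub>0 complex) set" where
  "plane_part M = M \<inter> coord_space {0, 1}"

lemma line_binary_family:
  "binary_family {0, 1} 1 (\<lambda>_. ()) line_K line_p line_q id plane_part 0 1 1 0"
proof
  show "card (classes (\<lambda>_. ()) (\<lambda>b. line_K b * \<alpha> ^ line_p b * \<beta> ^ line_q b) {0, 1}) = 1"
    if "\<alpha> \<noteq> 0 \<or> \<beta> \<noteq> 0" for \<alpha> \<beta>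
  proof -
    have "classes (\<lambda>_. ()) (\<lambda>b. line_K b * \<alpha> ^ line_p b * \<beta> ^ line_q b) {0, 1} = {()}"
      using that by (auto simp: classes_def line_K_def line_p_def line_q_def)
    then show ?thesis by simp
  qed
qed (auto simp: line_K_def line_p_def line_q_def plane_part_def split: if_splits)

lemma members_line: "binary_family.members (\<lambda>_. ()) line_K line_p line_q plane_part = grassmannian {0, 1} 1"
proof -
  interpret F: binary_family "{0, 1}" 1 "\<lambda>_. ()" line_K line_p line_q id plane_part 0 1 1 0
    by (rule line_binary_family)
  have gr: "F.member \<alpha> \<beta> \<in> grassmannian {0, 1} 1" if "\<alpha> \<noteq> 0 \<or> \<beta> \<noteq> 0" for \<alpha> \<beta>
    unfolding F.member_def plane_part_def by (rule mq_grassmannian[OF F.B F.card_fcoef[OF that]])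
  show ?thesis
  proof
    show "F.members \<subseteq> grassmannian {0, 1} 1" using gr unfolding F.members_def by blast
    show "grassmannian {0, 1} 1 \<subseteq> F.members"
    proof
      fix W :: "(nat \<Rightarrow>\<^sub>0 complex) set" assume W: "W \<in> grassmannian {0, 1} 1"
      then have W': "vec.subspace W" "W \<subseteq> coord_space {0, 1}" "vec.dim W = 1" by (auto simp: grassmannian_def)
      have "vec.dim {0 :: nat \<Rightarrow>\<^sub>0 complex} = card ({} :: nat set)"
        by (subst dim_coord_space[symmetric]) (simp_all add: coord_space_def)
      then have "W \<noteq> {0}" using W'(3) by (metis card.empty zero_neq_one)
      then have "\<exists>w\<in>W. w \<noteq> 0" using vec.subspace_0[OF W'(1)] by blast
      then obtain w where w: "w \<in> W" "w \<noteq> 0" by blast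
      \<comment> \<open>The line through w is the kernel of the functional with coefficients w_1 and
        - w_0.\<close>
      define \<alpha> \<beta> where "\<alpha> = lookup w 1" and "\<beta> = - lookup w 0"
      have wB: "w \<in> coord_space {0, 1}" using w(1) W'(2) by blast
      have ab: "\<alpha> \<noteq> 0 \<or> \<beta> \<noteq> 0"
      proof (rule ccontr)
        assume "\<not> (\<alpha> \<noteq> 0 \<or> \<beta> \<noteq> 0)"
        then have "lookup w i = 0" for i using wB unfolding in_coord_space \<alpha>_def \<beta>_def by auto
        then show False using w(2) by (simp add: poly_mapping_eq_iff fun_eq_iff)
      qed
      have "keys w \<subseteq> {0, 1}" using wB by (simp add: coord_space_def)
      then have "qmap (\<lambda>_. ()) (F.fcoef \<alpha> \<beta>) w = 0"
        by (intro poly_mapping_eqI) (simp add: lookup_qmap_superset[of "{0, 1}"] F.fcoef_def line_K_def line_p_def line_q_def \<alpha>_def \<beta>_def)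
      then have wM: "w \<in> F.member \<alpha> \<beta>" using wB unfolding F.member_def plane_part_def mq_def by blast
      have eq: "vec.span {w} = V" if V: "V \<in> grassmannian {0, 1} 1" "w \<in> V" for V
      proof (rule subspace_eq_of_dim)
        show "vec.subspace V" "V \<subseteq> coord_space {0, 1}" using V by (auto simp: grassmannian_def)
        then show "vec.span {w} \<subseteq> V" using V(2) vec.span_minimal by blast
        have "vec.dim (vec.span {w}) = 1"
          unfolding vec.dim_span using w(2) by (subst vec.dim_eq_card_independent) (simp_all add: vec.dependent_single)
        then show "vec.dim V \<le> vec.dim (vec.span {w})" using V by (simp add: grassmannian_def)
      qed auto
      have "W = F.member \<alpha> \<beta>" using eq[OF W w(1)] eq[OF gr[OF ab] wM] by simp
      then show "W \<in> F.members" using ab unfolding F.members_def by blast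
    qed
  qed
qed

lemma curves_isomorphic: "y \<in> ends \<Longrightarrow> isomorphic (cubic_variety (curves y)) proj_line"
  using binary_family_isomorphic[OF curve_binary_family line_binary_family]
  unfolding cubic_variety_def proj_line_def members_line by (simp add: members_curve)

lemma connectedin_curves: assumes y: "y \<in> ends" shows "connectedin fixed_topology (curves y)"
proof -
  have "curves y \<subseteq> fixed_locus 3" using curve_in_fixed_locus[OF y] by (auto simp: curves_def)
  then show ?thesis
    using binary_family.connected_members[OF curve_binary_family[OF y]] by (simp add: members_curve[OF y])
qed

section \<open>The connected components of the fixed locus\<close>

lemma topspace_fixed: "topspace fixed_topology = fixed_locus 3"
proof
  show "topspace fixed_topology \<subseteq> fixed_locus 3" unfolding topspace_emb by (rule Collect_restrict)
  have "\<Union> components \<subseteq> topspace fixed_topology"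
    by (rule Union_least, rule openin_subset, rule openin_component)
  then show "fixed_locus 3 \<subseteq> topspace fixed_topology" by (simp only: Union_components)
qed

text \<open>The complement of a member is the union of the others, so each member is clopen as well
  as connected.\<close>

lemma connected_components_of_eqI:
  assumes "\<And>C. C \<in> \<C> \<Longrightarrow> openin X C \<and> connectedin X C \<and> C \<noteq> {}"
    and "\<Union> \<C> = topspace X" "pairwise disjnt \<C>"
  shows "connected_components_of X = \<C>"
proof -
  have clopen: "closedin X C" if C: "C \<in> \<C>" for C
  proof -
    have "topspace X - C = \<Union> (\<C> - {C})"
      using assms(2,3) C unfolding pairwise_def disjnt_def by blast
    then have "openin X (topspace X - C)" using assms(1) by (simp only:) (rule openin_Union, blast)
    then show ?thesis using openin_closedin_eq C assms(1) by (metis closedin_def openin_subset)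
  qed
  have sub: "C \<in> connected_components_of X" if C: "C \<in> \<C>" for C
  proof -
    obtain x where x: "x \<in> C" using assms(1)[OF C] by blast
    then have "x \<in> topspace X" using C assms(2) by blast
    then have "x \<in> \<Union> (connected_components_of X)" unfolding Union_connected_components_of .
    then obtain D where D: "D \<in> connected_components_of X" "x \<in> D" by blast
    have "\<not> disjnt D C" using x D(2) by (auto simp: disjnt_def)
    then have "C \<subseteq> D" using connected_components_of_maximal[OF D(1)] assms(1)[OF C] by simp
    moreover have "D \<subseteq> C"
      using connectedin_clopen_cases[OF connectedin_connected_components_of[OF D(1)] clopen[OF C]]
        assms(1)[OF C] \<open>\<not> disjnt D C\<close> by simp
    ultimately show ?thesis using D(1) by simp
  qed
  show ?thesis
  proof
    show "\<C> \<subseteq> connected_components_of X" using sub by blast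
    show "connected_components_of X \<subseteq> \<C>"
    proof
      fix D assume D: "D \<in> connected_components_of X"
      then obtain x where x: "x \<in> D" using nonempty_connected_components_of by blast
      then obtain C where C: "C \<in> \<C>" "x \<in> C" using connected_components_of_subset[OF D] assms(2) by blast
      have "C = D" using connected_components_of_overlap[OF sub[OF C(1)] D] x C(2) by blast
      then show "D \<in> \<C>" using C(1) by simp
    qed
  qed
qed

theorem proposition1p1:
  shows "\<exists>A C\<^sub>1 C\<^sub>2.
    fixed_locus 3 = A \<union> C\<^sub>1 \<union> C\<^sub>2 \<and>
    A \<inter> (C\<^sub>1 \<union> C\<^sub>2) = {} \<and> C\<^sub>1 \<inter> C\<^sub>2 = {} \<and>
    connected_components_of (Top (cubic_variety (fixed_locus 3))) = (\<lambda>a. {a}) ` A \<union> {C\<^sub>1, C\<^sub>2} \<and>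
    card A = 32 \<and>
    (\<forall>a\<in>A. openin (Top (cubic_variety (fixed_locus 3))) {a}) \<and>
    isomorphic (cubic_variety C\<^sub>1) proj_line \<and>
    isomorphic (cubic_variety C\<^sub>2) proj_line"
proof (intro exI conjI)
  let ?A = "point ` isolated_indices"
  have T: "Top (cubic_variety (fixed_locus 3)) = fixed_topology" by (simp add: cubic_variety_def Top_embedded)
  have ends: "P3_1 \<in> ends" "Pm1_m3 \<in> ends" by (simp_all add: ends_def)
  show "fixed_locus 3 = ?A \<union> curves P3_1 \<union> curves Pm1_m3"
    unfolding Union_components[symmetric] components_def by auto
  show "?A \<inter> (curves P3_1 \<union> curves Pm1_m3) = {}" by (rule points_curves_disjoint)
  show "curves P3_1 \<inter> curves Pm1_m3 = {}" by (rule curves_disjoint)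
  show "card ?A = 32" by (simp add: card_image[OF inj_on_point] card_isolated_indices)
  show "\<forall>a\<in>?A. openin (Top (cubic_variety (fixed_locus 3))) {a}"
    unfolding T using openin_component by (auto simp: components_def)
  show "isomorphic (cubic_variety (curves P3_1)) proj_line" "isomorphic (cubic_variety (curves Pm1_m3)) proj_line"
    by (intro curves_isomorphic ends)+
  have "connected_components_of fixed_topology = components"
  proof (rule connected_components_of_eqI)
    fix C assume C: "C \<in> components"
    have "connectedin fixed_topology C"
      using C ends Union_components
      by (auto simp: components_def connectedin_curves connectedin_sing topspace_fixed)
    moreover have "curves y \<noteq> {}" for y by (auto simp: curves_def intro: exI[of _ 1])
    then have "C \<noteq> {}" using C by (auto simp: components_def)
    ultimately show "openin fixed_topology C \<and> connectedin fixed_topology C \<and> C \<noteq> {}"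
      using openin_component[OF C] by blast
  next
    show "\<Union> components = topspace fixed_topology" using Union_components topspace_fixed by simp
    show "pairwise disjnt components"
      using separable_components separableD unfolding pairwise_def disjnt_def by blast
  qed
  then show "connected_components_of (Top (cubic_variety (fixed_locus 3)))
      = (\<lambda>a. {a}) ` ?A \<union> {curves P3_1, curves Pm1_m3}"
    unfolding T components_def .
qed

end
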